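(* Let $\lambda,\delta$ be algebraic real numbers with $0<\lambda<1$ and $0<\delta<1$. Then the rotation number $\rho_{\lambda,\delta}$ of the contracted rotation $f_{\lambda,\delta}$ is a rational number.
   Context: For $x\in\mathbb{R}$, $[x]$ denotes the integer part (floor) and $\{x\}=x-[x]$ the fractional part. Let $I=[0,1)$. For $0<\lambda<1$ and $\delta\in I$, the contracted rotation is the map $f_{\lambda,\delta}:I\to I$, $f_{\lambda,\delta}(x)=\{\lambda x+\delta\}$. Its lift is $F_{\lambda,\delta}:\mathbb{R}\to\mathbb{R}$, $F_{\lambda,\delta}(x)=\lambda\{x\}+\delta+[x]$. The rotation number of $f_{\lambda,\delta}$ is $$\rho_{\lambda,\delta}=\lim_{k\to\infty}\frac{F_{\lambda,\delta}^k(x_0)}{k},$$ where $F_{\lambda,\delta}^k$ is the $k$-th iterate; it is known that the limit exists, does not depend on $x_0\in\mathbb{R}$, and satisfies $0\le\rho_{\lambda,\delta}<1$. *)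

theory Defs
  imports Complex_Main "HOL-Computational_Algebra.Polynomial"
begin

text \<open>Only the values on $[0,1)$ matter; they lie in $[0,1)$ again.\<close>

definition contracted_rotation :: "real \<Rightarrow> real \<Rightarrow> real \<Rightarrow> real" where
  "contracted_rotation l d x = frac (l * x + d)"

definition contracted_rotation_lift :: "real \<Rightarrow> real \<Rightarrow> real \<Rightarrow> real" where
  "contracted_rotation_lift l d x = l * frac x + d + of_int \<lfloor>x\<rfloor>"

text \<open>The defining property includes that the limit exists and is the same for every
  starting point; \<open>rotation_number_tendsto\<close> below shows that such a number exists.\<close>

definition rotation_number :: "real \<Rightarrow> real \<Rightarrow> real" where
  "rotation_number l d =
     (THE r. \<forall>x0. (\<lambda>k. (contracted_rotation_lift l d ^^ k) x0 / real k) \<longlonglongrightarrow> r)"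

lemma frac_contracted_rotation_lift:
  "frac (contracted_rotation_lift l d x) = contracted_rotation l d (frac x)"
  by (simp add: contracted_rotation_lift_def contracted_rotation_def frac_def)

lemma contracted_rotation_lift_add_int:
  "contracted_rotation_lift l d (x + of_int n) = contracted_rotation_lift l d x + of_int n"
  by (simp add: contracted_rotation_lift_def frac_def)

lemma funpow_lift_add_int:
  "(contracted_rotation_lift l d ^^ k) (x + of_int n) =
     (contracted_rotation_lift l d ^^ k) x + of_int n"
  by (induction k) (simp_all add: contracted_rotation_lift_add_int)

lemma mono_contracted_rotation_lift:
  assumes "0 < l" "l < 1"
  shows "mono (contracted_rotation_lift l d)"
proof (rule monoI)
  fix x y :: real
  assume xy: "x \<le> y"
  show "contracted_rotation_lift l d x \<le> contracted_rotation_lift l d y"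
  proof (cases "\<lfloor>x\<rfloor> = \<lfloor>y\<rfloor>")
    case True
    then show ?thesis
      using xy assms by (simp add: contracted_rotation_lift_def frac_def mult_left_mono)
  next
    case False
    with floor_mono[OF xy] have "\<lfloor>x\<rfloor> + 1 \<le> \<lfloor>y\<rfloor>" by linarith
    then have "real_of_int \<lfloor>x\<rfloor> + 1 \<le> of_int \<lfloor>y\<rfloor>" by linarith
    moreover have "l * frac x \<le> 1"
      using assms frac_lt_1[of x] frac_ge_0[of x] by (intro mult_le_one) auto
    moreover have "0 \<le> l * frac y"
      using assms by simp
    ultimately show ?thesis by (simp add: contracted_rotation_lift_def)
  qed
qed

lemma funpow_lift_dist_le:
  assumes "0 < l" "l < 1"
  shows "\<bar>(contracted_rotation_lift l d ^^ k) x - (contracted_rotation_lift l d ^^ k) 0 - x\<bar> \<le> 1"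
proof -
  let ?F = "contracted_rotation_lift l d ^^ k"
  have m: "mono ?F" by (rule mono_pow[OF mono_contracted_rotation_lift[OF assms]])
  have "?F (of_int \<lfloor>x\<rfloor>) \<le> ?F x" "?F x \<le> ?F (of_int \<lceil>x\<rceil>)"
    by (auto intro!: monoD[OF m])
  moreover have "?F (of_int n) = ?F 0 + of_int n" for n
    using funpow_lift_add_int[where x = 0] by simp
  ultimately have "?F 0 + of_int \<lfloor>x\<rfloor> \<le> ?F x" "?F x \<le> ?F 0 + of_int \<lceil>x\<rceil>" by simp_all
  then show ?thesis by linarith
qed

lemma ex_lift_limit:
  assumes "0 < l" "l < 1"
  shows "\<exists>r. \<forall>x0. (\<lambda>k. (contracted_rotation_lift l d ^^ k) x0 / real k) \<longlonglongrightarrow> r"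
proof -
  define a where "a k = (contracted_rotation_lift l d ^^ k) 0" for k
  have add: "\<bar>a (m + n) - a m - a n\<bar> \<le> 1" for m n
    using funpow_lift_dist_le[OF assms, where d = d and k = m and x = "a n"] by (simp add: a_def funpow_add)
  have mult: "\<bar>a (m * n) - real m * a n\<bar> \<le> real m" for m n
  proof (induction m)
    case 0
    show ?case by (simp add: a_def)
  next
    case (Suc m)
    have "real (Suc m) * a n = a n + real m * a n" by (simp add: algebra_simps)
    then show ?case using Suc add[of n "m * n"] by simp
  qed
  have close: "\<bar>a (m * n) / real (m * n) - a n / real n\<bar> \<le> 1 / real n" if "0 < m" "0 < n" for m n
  proof -
    have "a (m * n) / real (m * n) - a n / real n = (a (m * n) - real m * a n) / real (m * n)"
      using that by (simp add: field_simps)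
    then have "\<bar>a (m * n) / real (m * n) - a n / real n\<bar> = \<bar>a (m * n) - real m * a n\<bar> / real (m * n)"
      by simp
    also have "\<dots> \<le> real m / real (m * n)"
      using mult[of m n] by (intro divide_right_mono) auto
    also have "\<dots> = 1 / real n" using that by simp
    finally show ?thesis .
  qed
  have close2: "\<bar>a m / real m - a n / real n\<bar> \<le> 1 / real m + 1 / real n" if "0 < m" "0 < n" for m n
    using close[OF that] close[OF that(2) that(1)] by (simp add: mult.commute)
  have "Cauchy (\<lambda>n. a n / real n)"
  proof (rule metric_CauchyI)
    fix e :: real
    assume "0 < e"
    then obtain N where N: "inverse (real (Suc N)) < e / 2"
      using reals_Archimedean[of "e / 2"] by auto
    have "1 / real n < e / 2" if "n \<ge> Suc N" for n
    proof -
      have "1 / real n \<le> 1 / real (Suc N)"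
        using that by (intro divide_left_mono) auto
      then show ?thesis using N by (simp add: inverse_eq_divide)
    qed
    note small = this
    have "dist (a m / real m) (a n / real n) < e" if "m \<ge> Suc N" "n \<ge> Suc N" for m n
      using close2[of m n] small[OF that(1)] small[OF that(2)] that by (simp add: dist_real_def)
    then show "\<exists>M. \<forall>m\<ge>M. \<forall>n\<ge>M. dist (a m / real m) (a n / real n) < e" by blast
  qed
  then obtain r where r: "(\<lambda>n. a n / real n) \<longlonglongrightarrow> r"
    using Cauchy_convergent convergent_def by blast
  have "(\<lambda>k. (contracted_rotation_lift l d ^^ k) x0 / real k) \<longlonglongrightarrow> r" for x0
  proof -
    have "(\<lambda>k. ((contracted_rotation_lift l d ^^ k) x0 - a k) / real k) \<longlonglongrightarrow> 0"
    proof (rule metric_tendsto_imp_tendsto)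
      show "(\<lambda>k. (\<bar>x0\<bar> + 1) / real k) \<longlonglongrightarrow> 0" by (rule lim_const_over_n)
      show "\<forall>\<^sub>F k in sequentially.
          dist (((contracted_rotation_lift l d ^^ k) x0 - a k) / real k) 0
            \<le> dist ((\<bar>x0\<bar> + 1) / real k) 0"
      proof (intro always_eventually allI)
        fix k
        have "\<bar>(contracted_rotation_lift l d ^^ k) x0 - a k\<bar> \<le> \<bar>x0\<bar> + 1"
          using funpow_lift_dist_le[OF assms, where d = d and k = k and x = x0] unfolding a_def by linarith
        then show "dist (((contracted_rotation_lift l d ^^ k) x0 - a k) / real k) 0
            \<le> dist ((\<bar>x0\<bar> + 1) / real k) 0"
          by (simp add: dist_real_def divide_right_mono)
      qed
    qed
    from tendsto_add[OF this r] show ?thesis by (simp add: diff_divide_distrib)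
  qed
  then show ?thesis by blast
qed

lemma rotation_number_tendsto:
  assumes "0 < l" "l < 1"
  shows "(\<lambda>k. (contracted_rotation_lift l d ^^ k) x0 / real k) \<longlonglongrightarrow> rotation_number l d"
proof -
  let ?P = "\<lambda>r. \<forall>x0. (\<lambda>k. (contracted_rotation_lift l d ^^ k) x0 / real k) \<longlonglongrightarrow> r"
  obtain r where r: "?P r" using ex_lift_limit[OF assms] by blast
  have "?P (rotation_number l d)"
    unfolding rotation_number_def
  proof (rule theI)
    show "?P r" by (fact r)
    show "s = r" if "?P s" for s
      using that r LIMSEQ_unique by blast
  qed
  then show ?thesis by blast
qed

end

theory Submission
  imports Defs "HOL-Analysis.Analysis" "Jordan_Normal_Form.Char_Poly"
begin

text \<open>
  If the rotation number \<open>\<rho>\<close> is irrational, then the orbit of 0 under the lift shadows \<open>k \<rho>\<close> so closely that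
  \<open>\<Sum>k. \<lfloor>k \<rho>\<rfloor> l\<^sup>k\<close> is a rational function of \<open>l\<close> and \<open>d\<close>. This is a Hecke-Mahler series, and Mahler's method
  shows that its value cannot be algebraic. With \<open>u\<^sub>\<omega>(z, w) = \<Sum>k\<ge>1. z\<^sup>k w\<^bsup>\<lfloor>k \<omega>\<rfloor>\<^esup>\<close>, the continued fraction of \<open>\<rho>\<close>
  yields a chain of functional equations expressing \<open>u\<close> at \<open>(l ^ q\<^bsub>n+1\<^esub>, l ^ q\<^sub>n)\<close>, for the \<open>n\<close>-th tail \<open>\<omega>\<^sub>n\<close>, through \<open>l\<close> and \<open>d\<close>
  by rational expressions of size exponential in \<open>q\<^sub>n\<close>. As this value is positive and at most about
  \<open>l ^ q\<^bsub>n+1\<^esub>\<close>, a Liouville inequality bounds the partial quotients, and a subsequence of the tails \<open>\<omega>\<^sub>n\<close> and of the quotients \<open>q\<^bsub>n+1\<^esub> / q\<^sub>n\<close>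
  converges to irrational limits. An integer polynomial \<open>P\<close> such that \<open>P(z, w, u\<^sub>\<omega>(z, w))\<close> vanishes to high order in \<open>z\<close>
  for the limit tail \<open>\<omega>\<close> then takes values along the subsequence that are nonzero (one monomial dominates,
  because the limit quotient is irrational) but too small for the Liouville inequality.
\<close>

section \<open>A Liouville inequality for two algebraic numbers\<close>

text \<open>Mahler's method usually iterates one functional equation; here every step changes the
  function, because \<omega> moves on to the next tail, and yet one auxiliary polynomial P has to
  serve infinitely many steps. This works because the coefficients of \<open>z^k\<close>,
  \<open>k < T\<close>, in \<open>P(z, w, u)\<close> depend on \<omega> only through the integers
  \<open>floor (k * \<omega>)\<close>, and these are locally constant at an irrational \<omega>.
  Hence the detour through bounded partial quotients: they keep the limit tail irrational, which
  freezes the coefficients, and the limit quotient irrational, which separates the monomials in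
  \<open>z\<close> and \<open>w\<close>.

  With \<open>q = q_(n+1)\<close> and P of degree N in each variable, the height of the value at the
  n-th step grows like \<open>20 * N * q\<close> and its smallness like \<open>M * q\<close>, where
  M is the order of vanishing. So M must exceed an arbitrary multiple of N. Three variables leave
  room for this: about \<open>N^3\<close> unknowns against \<open>M * (N + M + 1)\<close> equations
  permit M of order \<open>N^(3/2)\<close>. P stays fixed while n grows, so its coefficients
  contribute only a constant.\<close>

definition majorized :: "int poly \<Rightarrow> int poly \<Rightarrow> bool" where
  "majorized p q \<longleftrightarrow> (\<forall>i. \<bar>coeff p i\<bar> \<le> coeff q i)"

lemma majorized_mult:
  assumes "majorized p q" "majorized p' q'"
  shows "majorized (p * p') (q * q')"
  unfolding majorized_def coeff_mult
proof
  fix i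
  have "\<bar>\<Sum>k\<le>i. coeff p k * coeff p' (i - k)\<bar> \<le> (\<Sum>k\<le>i. \<bar>coeff p k * coeff p' (i - k)\<bar>)"
    by (rule sum_abs)
  also have "\<dots> \<le> (\<Sum>k\<le>i. coeff q k * coeff q' (i - k))"
  proof (rule sum_mono)
    fix k
    have "\<bar>coeff p k\<bar> * \<bar>coeff p' (i - k)\<bar> \<le> coeff q k * coeff q' (i - k)"
      using assms unfolding majorized_def by (intro mult_mono) (auto intro: order_trans[OF abs_ge_zero])
    then show "\<bar>coeff p k * coeff p' (i - k)\<bar> \<le> coeff q k * coeff q' (i - k)"
      by (simp add: abs_mult)
  qed
  finally show "\<bar>\<Sum>k\<le>i. coeff p k * coeff p' (i - k)\<bar> \<le> (\<Sum>k\<le>i. coeff q k * coeff q' (i - k))" .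
qed

lemma majorized_prod:
  assumes "\<And>i. i \<in> I \<Longrightarrow> majorized (p i) (q i)"
  shows "majorized (\<Prod>i\<in>I. p i) (\<Prod>i\<in>I. q i)"
  using assms
proof (induction I rule: infinite_finite_induct)
  case (insert x F)
  then show ?case by (simp add: majorized_mult)
qed (simp_all add: majorized_def)

lemma majorized_sum:
  assumes "\<And>i. i \<in> I \<Longrightarrow> majorized (p i) (q i)"
  shows "majorized (\<Sum>i\<in>I. p i) (\<Sum>i\<in>I. q i)"
  using assms unfolding majorized_def coeff_sum
  by (auto intro!: order_trans[OF sum_abs] sum_mono)

lemma majorized_coeff_le:
  assumes "majorized p q"
  shows "\<bar>coeff p i\<bar> \<le> poly q 1"
proof -
  have nn: "0 \<le> coeff q j" for j
    using assms unfolding majorized_def by (meson abs_ge_zero order_trans)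
  have "coeff q i \<le> (\<Sum>j\<le>degree q. coeff q j)"
  proof (cases "i \<le> degree q")
    case True
    then show ?thesis using nn by (intro member_le_sum) auto
  next
    case False
    then show ?thesis using nn by (simp add: coeff_eq_0 sum_nonneg)
  qed
  then show ?thesis using assms unfolding majorized_def poly_altdef by simp (meson order_trans)
qed

lemma poly_fact: "poly (fact n) (x::int) = fact n"
  by (induction n) (simp_all add: algebra_simps)

text \<open>Leibniz expansion: every entry of the characteristic matrix is majorized by the
  polynomial \<open>x + H\<close>, so each of the \<open>n!\<close> signed products is majorized by
  \<open>(x + H)^n\<close>; setting \<open>x = 1\<close> gives the bound.\<close>

lemma abs_coeff_char_poly_le:
  fixes M :: "int mat"
  assumes M: "M \<in> carrier_mat n n" and H: "\<And>i j. i < n \<Longrightarrow> j < n \<Longrightarrow> \<bar>M $$ (i, j)\<bar> \<le> H"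
  shows "\<bar>coeff (char_poly M) k\<bar> \<le> fact n * (H + 1) ^ n"
proof -
  let ?q = "[:H, 1:]"
  have entry: "majorized (char_poly_matrix M $$ (i, j)) ?q" if "i < n" "j < n" for i j
  proof -
    have "char_poly_matrix M $$ (i, j) = (if i = j then [:- (M $$ (i, j)), 1:] else [:- (M $$ (i, j)):])"
      using M that by (simp add: char_poly_matrix_def)
    moreover have "0 \<le> H" using H[OF that] by linarith
    ultimately show ?thesis
      using H[OF that] by (auto simp: majorized_def coeff_pCons split: nat.splits)
  qed
  have "majorized (det (char_poly_matrix M)) (\<Sum>p | p permutes {0..<n}. ?q ^ n)"
    unfolding det_def'[OF char_poly_matrix_closed[OF M]]
  proof (rule majorized_sum)
    fix p assume p: "p \<in> {p. p permutes {0..<n}}"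
    have "majorized (\<Prod>i = 0..<n. char_poly_matrix M $$ (i, p i)) (\<Prod>i = 0..<n. ?q)"
      using p by (intro majorized_prod entry) (auto simp: permutes_in_image)
    moreover have "majorized (signof p) 1"
      by (simp add: majorized_def sign_def)
    ultimately show "majorized (signof p * (\<Prod>i = 0..<n. char_poly_matrix M $$ (i, p i))) (?q ^ n)"
      using majorized_mult by fastforce
  qed
  from majorized_coeff_le[OF this, of k] show ?thesis
    by (simp add: char_poly_def card_permutations[of "{0..<n}" n] add.commute poly_fact)
qed

text \<open>Liouville's argument at the lower end of the polynomial: after division by the largest
  possible power of \<alpha>, the lowest nonzero coefficient is an integer of absolute value at
  least 1, and every other term carries a factor \<alpha>.\<close>

lemma root_lower_bound:
  fixes \<alpha> B :: real
  assumes "p \<noteq> 0" and root: "poly (map_poly real_of_int p) \<alpha> = 0" and "\<alpha> \<noteq> 0"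
    and B: "\<And>i. \<bar>real_of_int (coeff p i)\<bar> \<le> B" and "1 \<le> B"
  shows "1 \<le> max 1 (real (degree p)) * B * \<bar>\<alpha>\<bar>"
proof (cases "\<bar>\<alpha>\<bar> \<ge> 1")
  case True
  have "1 * 1 * 1 \<le> max 1 (real (degree p)) * B * \<bar>\<alpha>\<bar>"
    using True assms by (intro mult_mono) auto
  then show ?thesis by simp
next
  case False
  define r where "r = (LEAST i. coeff p i \<noteq> 0)"
  have ex: "\<exists>i. coeff p i \<noteq> 0" using assms(1) by (auto simp: poly_eq_iff)
  have r: "coeff p r \<noteq> 0" unfolding r_def using ex by (rule LeastI_ex)
  have r0: "coeff p i = 0" if "i < r" for i using that not_less_Least unfolding r_def by blast
  have rd: "r \<le> degree p" using r by (rule le_degree)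
  let ?c = "\<lambda>i. real_of_int (coeff p i)"
  have "0 = (\<Sum>i\<le>degree p. ?c i * \<alpha> ^ i)"
    using root by (simp add: poly_altdef)
  also have "\<dots> = (\<Sum>i\<in>{r..degree p}. ?c i * \<alpha> ^ i)"
    by (rule sum.mono_neutral_right) (auto simp: r0)
  also have "\<dots> = (\<Sum>i\<in>{r..degree p}. \<alpha> ^ r * (?c i * \<alpha> ^ (i - r)))"
    by (rule sum.cong) (auto simp flip: power_add)
  also have "\<dots> = \<alpha> ^ r * (\<Sum>i\<in>{r..degree p}. ?c i * \<alpha> ^ (i - r))"
    by (simp add: sum_distrib_left)
  finally have "(\<Sum>i\<in>{r..degree p}. ?c i * \<alpha> ^ (i - r)) = 0" using assms(3) by simp
  then have "?c r = - (\<Sum>i\<in>{r<..degree p}. ?c i * \<alpha> ^ (i - r))"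
    using rd by (simp add: sum.head)
  then have "\<bar>?c r\<bar> \<le> (\<Sum>i\<in>{r<..degree p}. \<bar>?c i * \<alpha> ^ (i - r)\<bar>)"
    using sum_abs[of "\<lambda>i. ?c i * \<alpha> ^ (i - r)" "{r<..degree p}"] by simp
  also have "\<dots> \<le> (\<Sum>i\<in>{r<..degree p}. B * \<bar>\<alpha>\<bar>)"
  proof (rule sum_mono)
    fix i assume i: "i \<in> {r<..degree p}"
    have "\<bar>\<alpha>\<bar> ^ (i - r) \<le> \<bar>\<alpha>\<bar> ^ 1"
      using i False by (intro power_decreasing) auto
    then have "\<bar>?c i\<bar> * \<bar>\<alpha>\<bar> ^ (i - r) \<le> B * \<bar>\<alpha>\<bar>"
      using B[of i] assms(5) by (intro mult_mono) auto
    then show "\<bar>?c i * \<alpha> ^ (i - r)\<bar> \<le> B * \<bar>\<alpha>\<bar>"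
      by (simp add: abs_mult power_abs)
  qed
  also have "\<dots> = real (degree p - r) * (B * \<bar>\<alpha>\<bar>)" by simp
  also have "\<dots> \<le> max 1 (real (degree p)) * (B * \<bar>\<alpha>\<bar>)"
    using assms(5) by (intro mult_right_mono) auto
  finally have "\<bar>?c r\<bar> \<le> max 1 (real (degree p)) * B * \<bar>\<alpha>\<bar>" by (simp add: mult.assoc)
  moreover have "1 \<le> \<bar>?c r\<bar>" using r by linarith
  ultimately show ?thesis by linarith
qed

text \<open>Such an \<open>x\<close> is an eigenvalue of an integer matrix with row sums at most \<open>H\<close>. The family \<open>v\<close> need not be linearly
  independent: the lowest nonzero coefficient of the characteristic polynomial takes over the role of the norm.\<close>

definition mulrep :: "'i set \<Rightarrow> ('i \<Rightarrow> real) \<Rightarrow> real \<Rightarrow> real \<Rightarrow> bool" where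
  "mulrep I v H x \<longleftrightarrow> (\<exists>c :: 'i \<Rightarrow> 'i \<Rightarrow> int. \<forall>s\<in>I.
     x * v s = (\<Sum>t\<in>I. of_int (c s t) * v t) \<and> (\<Sum>t\<in>I. \<bar>real_of_int (c s t)\<bar>) \<le> H)"

lemma mulrep_mono:
  assumes "mulrep I v H x" "H \<le> H'"
  shows "mulrep I v H' x"
proof -
  obtain c :: "'a \<Rightarrow> 'a \<Rightarrow> int" where c: "\<And>s. s \<in> I \<Longrightarrow>
     x * v s = (\<Sum>t\<in>I. of_int (c s t) * v t) \<and> (\<Sum>t\<in>I. \<bar>real_of_int (c s t)\<bar>) \<le> H"
    using assms(1) unfolding mulrep_def by blast
  have "\<forall>s\<in>I. x * v s = (\<Sum>t\<in>I. of_int (c s t) * v t) \<and> (\<Sum>t\<in>I. \<bar>real_of_int (c s t)\<bar>) \<le> H'"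
    using c order_trans[OF _ assms(2)] by simp
  then show ?thesis unfolding mulrep_def by (rule exI[of _ c])
qed

lemma mulrep_of_int:
  assumes "finite I" shows "mulrep I v \<bar>of_int n\<bar> (of_int n)"
  unfolding mulrep_def
proof (intro exI ballI conjI)
  fix s assume s: "s \<in> I"
  let ?c = "\<lambda>s t. if s = t then n else 0"
  have "(\<Sum>t\<in>I. of_int (?c s t) * v t) = (\<Sum>t\<in>I. if s = t then of_int n * v t else 0)"
    by (rule sum.cong) auto
  then show "of_int n * v s = (\<Sum>t\<in>I. of_int (?c s t) * v t)"
    using assms s by simp
  have "(\<Sum>t\<in>I. \<bar>real_of_int (?c s t)\<bar>) = (\<Sum>t\<in>I. if s = t then \<bar>of_int n\<bar> else 0)"
    by (rule sum.cong) auto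
  then show "(\<Sum>t\<in>I. \<bar>real_of_int (?c s t)\<bar>) \<le> \<bar>of_int n\<bar>" using assms s by simp
qed

lemma mulrep_add:
  assumes "mulrep I v H x" "mulrep I v H' y"
  shows "mulrep I v (H + H') (x + y)"
proof -
  from assms obtain c d where
    c: "\<And>s. s \<in> I \<Longrightarrow> x * v s = (\<Sum>t\<in>I. of_int (c s t) * v t) \<and> (\<Sum>t\<in>I. \<bar>real_of_int (c s t)\<bar>) \<le> H"
    and d: "\<And>s. s \<in> I \<Longrightarrow> y * v s = (\<Sum>t\<in>I. of_int (d s t) * v t) \<and> (\<Sum>t\<in>I. \<bar>real_of_int (d s t)\<bar>) \<le> H'"
    unfolding mulrep_def by blast
  have "(\<Sum>t\<in>I. \<bar>real_of_int (c s t + d s t)\<bar>) \<le> H + H'" if "s \<in> I" for s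
  proof -
    have "(\<Sum>t\<in>I. \<bar>real_of_int (c s t + d s t)\<bar>) \<le> (\<Sum>t\<in>I. \<bar>real_of_int (c s t)\<bar> + \<bar>real_of_int (d s t)\<bar>)"
      by (rule sum_mono) simp
    then show ?thesis using c[OF that] d[OF that] by (simp add: sum.distrib)
  qed
  then show ?thesis using c d unfolding mulrep_def
    by (intro exI[of _ "\<lambda>s t. c s t + d s t"]) (simp add: sum.distrib distrib_right)
qed

text \<open>The coefficient matrices multiply, in the opposite order, and the maximal row sum is
  submultiplicative.\<close>

lemma mulrep_mult:
  assumes "mulrep I v H x" "mulrep I v H' y" "0 \<le> H"
  shows "mulrep I v (H * H') (x * y)"
proof -
  from assms obtain c d where
    c: "\<And>s. s \<in> I \<Longrightarrow> x * v s = (\<Sum>t\<in>I. of_int (c s t) * v t) \<and> (\<Sum>t\<in>I. \<bar>real_of_int (c s t)\<bar>) \<le> H"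
    and d: "\<And>s. s \<in> I \<Longrightarrow> y * v s = (\<Sum>t\<in>I. of_int (d s t) * v t) \<and> (\<Sum>t\<in>I. \<bar>real_of_int (d s t)\<bar>) \<le> H'"
    unfolding mulrep_def by blast
  define e where "e s u = (\<Sum>t\<in>I. d s t * c t u)" for s u
  have 1: "x * y * v s = (\<Sum>u\<in>I. of_int (e s u) * v u)" if s: "s \<in> I" for s
  proof -
    have "x * y * v s = (\<Sum>t\<in>I. of_int (d s t) * (x * v t))"
      using d[OF s] by (simp add: sum_distrib_left mult_ac)
    also have "\<dots> = (\<Sum>t\<in>I. \<Sum>u\<in>I. of_int (d s t) * (of_int (c t u) * v u))"
      by (rule sum.cong) (simp_all add: c sum_distrib_left)
    also have "\<dots> = (\<Sum>u\<in>I. \<Sum>t\<in>I. of_int (d s t) * (of_int (c t u) * v u))"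
      by (rule sum.swap)
    finally show ?thesis by (simp add: e_def sum_distrib_right mult.assoc)
  qed
  have 2: "(\<Sum>u\<in>I. \<bar>real_of_int (e s u)\<bar>) \<le> H * H'" if s: "s \<in> I" for s
  proof -
    have "(\<Sum>u\<in>I. \<bar>real_of_int (e s u)\<bar>) \<le> (\<Sum>u\<in>I. \<Sum>t\<in>I. \<bar>real_of_int (d s t)\<bar> * \<bar>real_of_int (c t u)\<bar>)"
      unfolding e_def by (intro sum_mono) (auto intro!: order_trans[OF sum_abs] simp: abs_mult)
    also have "\<dots> = (\<Sum>t\<in>I. \<Sum>u\<in>I. \<bar>real_of_int (d s t)\<bar> * \<bar>real_of_int (c t u)\<bar>)"
      by (rule sum.swap)
    also have "\<dots> \<le> (\<Sum>t\<in>I. \<bar>real_of_int (d s t)\<bar> * H)"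
      unfolding sum_distrib_left[symmetric] using c by (intro sum_mono mult_left_mono) auto
    also have "\<dots> \<le> H' * H"
      unfolding sum_distrib_right[symmetric] using d[OF s] assms(3) by (intro mult_right_mono) auto
    finally show ?thesis by (simp add: mult.commute)
  qed
  show ?thesis unfolding mulrep_def using 1 2 by (intro exI[of _ e]) auto
qed

text \<open>The nonzero vector of the values \<open>v s\<close> is an eigenvector for
  \<open>x\<close>, so \<open>x\<close> is a root of a monic integer polynomial whose coefficients
  are controlled by \<open>H\<close>.\<close>

lemma mulrep_lower_bound:
  assumes "finite I" "s \<in> I" "v s \<noteq> 0" "mulrep I v H x" "x \<noteq> 0"
  shows "1 \<le> real (card I) * fact (card I) * (H + 1) ^ card I * \<bar>x\<bar>"
proof -
  define n where "n = card I"
  obtain f where f: "bij_betw f {0..<n} I"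
    using ex_bij_betw_nat_finite[OF assms(1)] n_def by blast
  obtain c where
    c: "\<And>s. s \<in> I \<Longrightarrow> x * v s = (\<Sum>t\<in>I. of_int (c s t) * v t) \<and> (\<Sum>t\<in>I. \<bar>real_of_int (c s t)\<bar>) \<le> H"
    using assms(4) unfolding mulrep_def by blast
  have fI: "f i \<in> I" if "i < n" for i using f that by (auto simp: bij_betw_def)
  have n: "0 < n" using assms by (auto simp: n_def card_gt_0_iff)
  have H0: "0 \<le> H"
  proof -
    have "0 \<le> (\<Sum>t\<in>I. \<bar>real_of_int (c s t)\<bar>)" by (rule sum_nonneg) simp
    then show ?thesis using c[OF assms(2)] by linarith
  qed
  define M where "M = mat n n (\<lambda>(i, j). c (f i) (f j))"
  have M: "M \<in> carrier_mat n n" by (simp add: M_def)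
  define u where "u = vec n (\<lambda>i. v (f i))"
  let ?M = "map_mat real_of_int M"
  have "?M *\<^sub>v u = x \<cdot>\<^sub>v u"
  proof (rule eq_vecI)
    fix i assume "i < dim_vec (x \<cdot>\<^sub>v u)"
    then have i: "i < n" by (simp add: u_def)
    have "(?M *\<^sub>v u) $ i = (\<Sum>j = 0..<n. of_int (c (f i) (f j)) * v (f j))"
      using i by (simp add: M_def u_def scalar_prod_def)
    also have "\<dots> = (\<Sum>t\<in>I. of_int (c (f i) t) * v t)"
      by (rule sum.reindex_bij_betw[OF f])
    also have "\<dots> = x * v (f i)" using c[OF fI[OF i]] by simp
    finally show "(?M *\<^sub>v u) $ i = (x \<cdot>\<^sub>v u) $ i" using i by (simp add: u_def)
  qed (simp add: M_def u_def)
  moreover have "u \<noteq> 0\<^sub>v n"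
  proof
    assume u0: "u = 0\<^sub>v n"
    obtain i where "i < n" "f i = s" using f assms(2) by (auto simp: bij_betw_def)
    then have "u $ i = v s" by (simp add: u_def)
    then show False using u0 \<open>i < n\<close> assms(3) by simp
  qed
  ultimately have "eigenvalue ?M x"
    unfolding eigenvalue_def eigenvector_def by (intro exI[of _ u]) (simp add: M_def u_def)
  then have root: "poly (char_poly ?M) x = 0"
    using eigenvalue_root_char_poly[of ?M n] M by simp
  have cp: "char_poly ?M = map_poly real_of_int (char_poly M)"
    by (rule of_int_hom.char_poly_hom[OF M])
  have deg: "degree (char_poly M) = n" "coeff (char_poly M) n = 1"
    using degree_monic_char_poly[OF M] by auto
  \<comment> \<open>The entries are integers, so the real bound \<open>H\<close> can be rounded down
    to the integer bound that the estimate for the characteristic polynomial asks for.\<close>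
  have entry: "\<bar>M $$ (i, j)\<bar> \<le> \<lfloor>H\<rfloor>" if "i < n" "j < n" for i j
  proof -
    have "\<bar>real_of_int (c (f i) (f j))\<bar> \<le> (\<Sum>t\<in>I. \<bar>real_of_int (c (f i) t)\<bar>)"
      using fI[OF that(2)] assms(1) by (intro member_le_sum) auto
    then have "\<bar>real_of_int (c (f i) (f j))\<bar> \<le> H" using c[OF fI[OF that(1)]] by linarith
    then show ?thesis using that by (simp add: M_def le_floor_iff)
  qed
  have fl: "real_of_int \<lfloor>H\<rfloor> + 1 \<le> H + 1" "0 \<le> real_of_int \<lfloor>H\<rfloor> + 1"
    using H0 by linarith+
  have B: "\<bar>real_of_int (coeff (char_poly M) i)\<bar> \<le> fact n * (H + 1) ^ n" for i
  proof -
    have "real_of_int \<bar>coeff (char_poly M) i\<bar> \<le> of_int (fact n * (\<lfloor>H\<rfloor> + 1) ^ n)"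
      using abs_coeff_char_poly_le[OF M entry] of_int_le_iff by blast
    also have "\<dots> = fact n * (real_of_int \<lfloor>H\<rfloor> + 1) ^ n" by simp
    also have "\<dots> \<le> fact n * (H + 1) ^ n"
      by (rule mult_left_mono[OF power_mono[OF fl]]) simp
    finally show ?thesis by simp
  qed
  have B1: "1 \<le> fact n * (H + 1) ^ n"
    using mult_mono[of 1 "fact n" 1 "(H + 1) ^ n"] one_le_power[of "H + 1" n] H0 fact_ge_1[of n] by simp
  have "char_poly M \<noteq> 0" using deg(2) by auto
  from root_lower_bound[OF this _ assms(5) B B1]
  have "1 \<le> max 1 (real (degree (char_poly M))) * (fact n * (H + 1) ^ n) * \<bar>x\<bar>"
    using root unfolding cp .
  moreover have "max 1 (real (degree (char_poly M))) = real n" using n unfolding deg(1) by simp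
  ultimately show ?thesis unfolding n_def[symmetric] by (simp only: mult.assoc)
qed

section \<open>From algebraic numbers to a size function\<close>

text \<open>Multiplying the equation for \<open>x\<close> by the leading coefficient
  \<open>l\<close> to the power \<open>d - 1\<close> makes it monic in
  \<open>X = l * x\<close>.\<close>

lemma algebraic_integral_multiple:
  fixes x :: real
  assumes "algebraic x"
  obtains a d :: nat and c :: "nat \<Rightarrow> int" where
    "0 < a" "0 < d" "(real a * x) ^ d = (\<Sum>i<d. of_int (c i) * (real a * x) ^ i)"
proof -
  obtain p0 where p0: "p0 \<noteq> 0" "poly (map_poly real_of_int p0) x = 0"
    using algebraicE'[OF assms] by metis
  define p where "p = (if lead_coeff p0 > 0 then p0 else - p0)"
  have p: "lead_coeff p > 0" "poly (map_poly real_of_int p) x = 0"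
  proof -
    have "lead_coeff p0 \<noteq> 0" using p0 by simp
    then show "lead_coeff p > 0" by (auto simp: p_def)
    show "poly (map_poly real_of_int p) x = 0" 
    proof (cases "lead_coeff p0 > 0")
      case False
      have "map_poly real_of_int (- p0) = - map_poly real_of_int p0"
        by (simp add: poly_eq_iff coeff_map_poly)
      then show ?thesis using False p0 by (simp add: p_def)
    qed (simp add: p_def p0)
  qed
  define d where "d = degree p"
  have d: "d > 0"
  proof (rule ccontr)
    assume "\<not> d > 0"
    then obtain k where "p = [:k:]" using degree_eq_zeroE[of p] unfolding d_def by auto
    then show False using p by simp
  qed
  define l where "l = lead_coeff p"
  define X where "X = of_int l * x"
  have "0 = of_int l ^ (d - 1) * (\<Sum>i\<le>d. of_int (coeff p i) * x ^ i)"
    using p by (simp add: poly_altdef d_def)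
  also have "\<dots> = of_int l ^ (d - 1) * (\<Sum>i<d. of_int (coeff p i) * x ^ i) + of_int l ^ (d - 1) * (of_int l * x ^ d)"
  proof -
    have "{..d} = insert d {..<d}" by auto
    then show ?thesis by (simp add: distrib_left l_def d_def)
  qed
  also have "of_int l ^ (d - 1) * (of_int l * x ^ d) = X ^ d"
  proof -
    obtain d' where "d = Suc d'" using d by (cases d) auto
    then show ?thesis unfolding X_def power_mult_distrib by simp
  qed
  also have "of_int l ^ (d - 1) * (\<Sum>i<d. of_int (coeff p i) * x ^ i) = (\<Sum>i<d. of_int (coeff p i * l ^ (d - 1 - i)) * X ^ i)"
    unfolding sum_distrib_left
  proof (rule sum.cong)
    fix i assume "i \<in> {..<d}"
    then have "d - 1 = (d - 1 - i) + i" by auto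
    then have "of_int l ^ (d - 1) = of_int l ^ (d - 1 - i) * (of_int l ^ i :: real)"
      using power_add by metis
    then show "of_int l ^ (d - 1) * (of_int (coeff p i) * x ^ i) = of_int (coeff p i * l ^ (d - 1 - i)) * X ^ i"
      unfolding X_def power_mult_distrib by simp
  qed simp
  finally have 0: "(\<Sum>i<d. of_int (coeff p i * l ^ (d - 1 - i)) * X ^ i) + X ^ d = 0" by linarith
  have "X ^ d = (\<Sum>i<d. of_int (- (coeff p i * l ^ (d - 1 - i))) * X ^ i)"
    using 0 by (simp add: sum_negf)
  moreover have "X = real (nat l) * x" "nat l > 0" using p by (simp_all add: X_def l_def)
  ultimately show ?thesis using d
    by (intro that[of "nat l" d "\<lambda>i. - (coeff p i * l ^ (d - 1 - i))"]) auto
qed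

lemma mulrep_ex:
  assumes "finite I" "\<And>s. s \<in> I \<Longrightarrow> \<exists>c :: 'i \<Rightarrow> int. x * v s = (\<Sum>t\<in>I. of_int (c t) * v t)"
  shows "\<exists>H. mulrep I v H x"
proof -
  obtain c where c: "\<And>s. s \<in> I \<Longrightarrow> x * v s = (\<Sum>t\<in>I. of_int (c s t) * v t)"
    using bchoice[of I "\<lambda>s c. x * v s = (\<Sum>t\<in>I. of_int (c t) * v t)"] assms(2) by auto
  have "(\<Sum>t\<in>I. \<bar>real_of_int (c s t)\<bar>) \<le> (\<Sum>s\<in>I. \<Sum>t\<in>I. \<bar>real_of_int (c s t)\<bar>)" if "s \<in> I" for s
    using that assms(1) by (intro member_le_sum sum_nonneg) auto
  then have "mulrep I v (\<Sum>s\<in>I. \<Sum>t\<in>I. \<bar>real_of_int (c s t)\<bar>) x"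
    unfolding mulrep_def using c by (intro exI[of _ c]) simp
  then show ?thesis ..
qed

text \<open>The integer span of the monomials \<open>X^i * Y^j\<close>, with exponents below the
  degrees of the two monic equations, is stable under \<open>X\<close> and \<open>Y\<close>: the one
  power that overflows is rewritten by its equation. The monomial 1 supplies the nonzero
  entry.\<close>

lemma algebraic_pair_mulrep:
  fixes x y :: real
  assumes "algebraic x" "algebraic y"
  obtains a :: nat and I :: "(nat \<times> nat) set" and v s Hx Hy where
    "0 < a" "finite I" "s \<in> I" "v s \<noteq> 0" "mulrep I v Hx (real a * x)" "mulrep I v Hy (real a * y)"
proof -
  obtain a1 d1 c1 where 1: "0 < a1" "0 < d1" "(real a1 * x) ^ d1 = (\<Sum>i<d1. of_int (c1 i) * (real a1 * x) ^ i)"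
    using algebraic_integral_multiple[OF assms(1)] .
  obtain a2 d2 c2 where 2: "0 < a2" "0 < d2" "(real a2 * y) ^ d2 = (\<Sum>i<d2. of_int (c2 i) * (real a2 * y) ^ i)"
    using algebraic_integral_multiple[OF assms(2)] .
  define X Y where "X = real a1 * x" and "Y = real a2 * y"
  define v where "v = (\<lambda>(i, j). X ^ i * Y ^ j)"
  define I where "I = {..<d1} \<times> {..<d2}"
  have fin: "finite I" by (simp add: I_def)
  have "\<exists>H. mulrep I v H X"
  proof (rule mulrep_ex[OF fin])
    fix s assume "s \<in> I"
    then obtain i j where s: "s = (i, j)" "i < d1" "j < d2" by (auto simp: I_def)
    define c where "c = (\<lambda>(i', j'). if j' = j then (if Suc i < d1 then (if i' = Suc i then 1 else 0) else c1 i') else 0)"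
    have "(\<Sum>t\<in>I. of_int (c t) * v t) = (\<Sum>i'<d1. \<Sum>j'<d2. of_int (c (i', j')) * v (i', j'))"
      unfolding I_def by (simp add: sum.cartesian_product split_def)
    also have "\<dots> = (\<Sum>i'<d1. \<Sum>j'<d2. if j' = j then of_int (if Suc i < d1 then (if i' = Suc i then 1 else 0) else c1 i') * (X ^ i' * Y ^ j) else 0)"
      by (intro sum.cong refl) (simp add: c_def v_def)
    also have "\<dots> = (\<Sum>i'<d1. of_int (if Suc i < d1 then (if i' = Suc i then 1 else 0) else c1 i') * (X ^ i' * Y ^ j))"
      using s by simp
    also have "\<dots> = X * v s"
    proof (cases "Suc i < d1")
      case True
      have "(\<Sum>i'<d1. of_int (if Suc i < d1 then (if i' = Suc i then 1 else 0) else c1 i') * (X ^ i' * Y ^ j))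
          = (\<Sum>i'<d1. if i' = Suc i then X ^ i' * Y ^ j else 0)"
        using True by (intro sum.cong) auto
      then show ?thesis using True s by (simp add: v_def)
    next
      case False
      then have "d1 = Suc i" using s by simp
      then have "X * v s = X ^ d1 * Y ^ j" using s by (simp add: v_def)
      also have "\<dots> = (\<Sum>i'<d1. of_int (c1 i') * X ^ i') * Y ^ j"
        using 1(3) unfolding X_def by simp
      finally show ?thesis using False by (simp add: sum_distrib_right mult.assoc)
    qed
    finally have "X * v s = (\<Sum>t\<in>I. of_int (c t) * v t)" by (rule sym)
    then show "\<exists>c. X * v s = (\<Sum>t\<in>I. of_int (c t) * v t)" by (rule exI[of _ c])
  qed
  then obtain H1 where H1: "mulrep I v H1 X" ..
  have "\<exists>H. mulrep I v H Y"
  proof (rule mulrep_ex[OF fin])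
    fix s assume "s \<in> I"
    then obtain i j where s: "s = (i, j)" "i < d1" "j < d2" by (auto simp: I_def)
    define c where "c = (\<lambda>(i', j'). if i' = i then (if Suc j < d2 then (if j' = Suc j then 1 else 0) else c2 j') else 0)"
    have "(\<Sum>t\<in>I. of_int (c t) * v t) = (\<Sum>i'<d1. \<Sum>j'<d2. of_int (c (i', j')) * v (i', j'))"
      unfolding I_def by (simp add: sum.cartesian_product split_def)
    also have "\<dots> = (\<Sum>j'<d2. \<Sum>i'<d1. of_int (c (i', j')) * v (i', j'))"
      by (rule sum.swap)
    also have "\<dots> = (\<Sum>j'<d2. \<Sum>i'<d1. if i' = i then of_int (if Suc j < d2 then (if j' = Suc j then 1 else 0) else c2 j') * (X ^ i * Y ^ j') else 0)"
      by (intro sum.cong refl) (simp add: c_def v_def)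
    also have "\<dots> = (\<Sum>j'<d2. of_int (if Suc j < d2 then (if j' = Suc j then 1 else 0) else c2 j') * (X ^ i * Y ^ j'))"
      using s by simp
    also have "\<dots> = Y * v s"
    proof (cases "Suc j < d2")
      case True
      have "(\<Sum>j'<d2. of_int (if Suc j < d2 then (if j' = Suc j then 1 else 0) else c2 j') * (X ^ i * Y ^ j'))
          = (\<Sum>j'<d2. if j' = Suc j then X ^ i * Y ^ j' else 0)"
        using True by (intro sum.cong) auto
      then show ?thesis using True s by (simp add: v_def)
    next
      case False
      then have "d2 = Suc j" using s by simp
      then have "Y * v s = X ^ i * Y ^ d2" using s by (simp add: v_def)
      also have "\<dots> = X ^ i * (\<Sum>j'<d2. of_int (c2 j') * Y ^ j')"
        using 2(3) unfolding Y_def by simp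
      finally show ?thesis using False by (simp add: sum_distrib_left mult_ac)
    qed
    finally have "Y * v s = (\<Sum>t\<in>I. of_int (c t) * v t)" by (rule sym)
    then show "\<exists>c. Y * v s = (\<Sum>t\<in>I. of_int (c t) * v t)" by (rule exI[of _ c])
  qed
  then obtain H2 where H2: "mulrep I v H2 Y" ..
  have HH: "0 \<le> \<bar>real_of_int (int a)\<bar>" for a by simp
  have "mulrep I v (\<bar>of_int (int a2)\<bar> * H1) (of_int (int a2) * X)" "mulrep I v (\<bar>of_int (int a1)\<bar> * H2) (of_int (int a1) * Y)"
    by (intro mulrep_mult mulrep_of_int fin H1 H2 HH)+
  then have m: "mulrep I v (\<bar>of_int (int a2)\<bar> * H1) (real (a1 * a2) * x)" "mulrep I v (\<bar>of_int (int a1)\<bar> * H2) (real (a1 * a2) * y)"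
    by (simp_all add: X_def Y_def mult_ac)
  have "(0, 0) \<in> I" "v (0, 0) \<noteq> 0" using 1 2 by (simp_all add: I_def v_def)
  from that[OF _ fin this m] show ?thesis using 1 2 by simp
qed

text \<open>\<open>S e a\<close> says that \<open>A^e * a\<close> acts on the span by an integer
  matrix with row sums at most \<open>C^e\<close>. Denominator and matrix norm share the exponent,
  so sizes add up under multiplication.\<close>

theorem algebraic_pair_size:
  fixes x y :: real
  assumes "algebraic x" "algebraic y"
  obtains S :: "nat \<Rightarrow> real \<Rightarrow> bool" and \<kappa> :: real where
    "1 < \<kappa>" "S 1 x" "S 1 y" "S 0 1"
    "\<And>e e' a. S e a \<Longrightarrow> e \<le> e' \<Longrightarrow> S e' a"
    "\<And>e a. S e a \<Longrightarrow> S e (- a)"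
    "\<And>e a b. S e a \<Longrightarrow> S e b \<Longrightarrow> S (e + 1) (a + b)"
    "\<And>e e' a b. S e a \<Longrightarrow> S e' b \<Longrightarrow> S (e + e') (a * b)"
    "\<And>e a. S e a \<Longrightarrow> a \<noteq> 0 \<Longrightarrow> 1 \<le> \<kappa> ^ (e + 1) * \<bar>a\<bar>"
proof -
  obtain A :: nat and I :: "(nat \<times> nat) set" and v s Hx Hy where
    A: "0 < A" and fin: "finite I" and s: "s \<in> I" "v s \<noteq> 0"
    and mx: "mulrep I v Hx (real A * x)" and my: "mulrep I v Hy (real A * y)"
    using algebraic_pair_mulrep[OF assms] .
  \<comment> \<open>\<open>2 * A\<close> pays for a sum of two numbers of size \<open>e\<close>,
    rescaled to denominator \<open>A^(e+1)\<close>; \<open>Hx\<close> and \<open>Hy\<close> give the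
    generators size 1.\<close>
  define C where "C = max (2 * real A) (max Hx Hy)"
  have C: "2 * real A \<le> C" "Hx \<le> C" "Hy \<le> C" by (simp_all add: C_def)
  have C2: "2 \<le> C" using C A by simp
  have A1: "1 \<le> real A" using A by simp
  define S where "S e a \<longleftrightarrow> mulrep I v (C ^ e) (real A ^ e * a)" for e a
  have mA: "mulrep I v (real A) (real A)" using mulrep_of_int[OF fin, of v "int A"] by simp
  have suc: "S (Suc e) a" if "S e a" for e a
  proof -
    have "mulrep I v (real A * C ^ e) (real A * (real A ^ e * a))"
      using that A1 unfolding S_def by (intro mulrep_mult mA) auto
    moreover have "real A * C ^ e \<le> C ^ Suc e" using C C2 A1 by (auto intro!: mult_right_mono)
    ultimately show ?thesis unfolding S_def by (auto intro: mulrep_mono simp: mult.assoc)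
  qed
  have mono: "S e' a" if "S e a" "e \<le> e'" for e e' a
    using that(2,1) by (induction rule: dec_induct) (auto intro: suc)
  have neg: "S e (- a)" if "S e a" for e a
  proof -
    have "mulrep I v (\<bar>of_int (-1)\<bar> * C ^ e) (of_int (-1) * (real A ^ e * a))"
      using that unfolding S_def by (intro mulrep_mult mulrep_of_int fin) auto
    then show ?thesis by (simp add: S_def)
  qed
  have add: "S (e + 1) (a + b)" if "S e a" "S e b" for e a b
  proof -
    have "mulrep I v (real A * (C ^ e + C ^ e)) (real A * (real A ^ e * a + real A ^ e * b))"
      using that A1 unfolding S_def by (intro mulrep_mult mulrep_add mA) auto
    moreover have "real A * (C ^ e + C ^ e) = (2 * real A) * C ^ e" by simp
    moreover have "(2 * real A) * C ^ e \<le> C * C ^ e" using C C2 by (intro mult_right_mono) auto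
    ultimately have "mulrep I v (C * C ^ e) (real A * (real A ^ e * a + real A ^ e * b))"
      using mulrep_mono by metis
    then show ?thesis by (simp add: S_def algebra_simps)
  qed
  have mult: "S (e + e') (a * b)" if "S e a" "S e' b" for e e' a b
  proof -
    have "mulrep I v (C ^ e * C ^ e') ((real A ^ e * a) * (real A ^ e' * b))"
      using that C2 unfolding S_def by (intro mulrep_mult) auto
    then show ?thesis by (simp add: S_def power_add mult_ac)
  qed
  define n where "n = card I"
  have n: "1 \<le> n" using s fin by (auto simp: n_def Suc_le_eq card_gt_0_iff)
  \<comment> \<open>The estimate \<open>C^e + 1 <= 2 * C^e\<close> splits the Liouville factor into
    the constant \<open>B\<close> and the power \<open>E^e\<close>; the single base \<kappa>
    dominates both.\<close>
  define B where "B = real n * fact n * 2 ^ n"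
  define E where "E = real A * C ^ n"
  define \<kappa> where "\<kappa> = max 2 (max B E)"
  have lower: "1 \<le> \<kappa> ^ (e + 1) * \<bar>a\<bar>" if "S e a" "a \<noteq> 0" for e a
  proof -
    have "real A ^ e * a \<noteq> 0" using that A by simp
    from mulrep_lower_bound[OF fin s that(1)[unfolded S_def] this]
    have "1 \<le> real n * fact n * (C ^ e + 1) ^ n * \<bar>real A ^ e * a\<bar>" by (simp add: n_def)
    also have "\<dots> \<le> real n * fact n * (2 * C ^ e) ^ n * \<bar>real A ^ e * a\<bar>"
    proof -
      have "1 \<le> C ^ e" using C2 by (intro one_le_power) auto
      then show ?thesis by (intro mult_right_mono mult_left_mono power_mono) auto
    qed
    also have "\<dots> = B * E ^ e * \<bar>a\<bar>"
    proof -
      have "(C ^ e) ^ n = (C ^ n) ^ e" by (simp add: mult.commute flip: power_mult)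
      then show ?thesis by (simp add: B_def E_def power_mult_distrib abs_mult)
    qed
    also have "\<dots> \<le> \<kappa> * \<kappa> ^ e * \<bar>a\<bar>"
      using A1 C2 by (intro mult_right_mono mult_mono power_mono) (auto simp: \<kappa>_def E_def)
    finally show ?thesis by simp
  qed
  have Sxy: "S 1 x" "S 1 y" using mx my C unfolding S_def by (auto intro: mulrep_mono)
  have S1: "S 0 1" using mulrep_of_int[OF fin, of v 1] by (simp add: S_def)
  show ?thesis
  proof (rule that[of \<kappa> S])
    show "1 < \<kappa>" by (simp add: \<kappa>_def)
  qed (fact Sxy S1 mono neg add mult lower)+
qed

section \<open>Irrational rotation numbers\<close>

lemma irrational_mult_nat_neq_int:
  fixes \<rho> :: real
  assumes "\<rho> \<notin> \<rat>" "0 < k"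
  shows "real k * \<rho> \<noteq> of_int m"
proof
  assume "real k * \<rho> = of_int m"
  then have "\<rho> = of_int m / of_nat k" using assms(2) by (simp add: field_simps)
  then show False using assms(1) by simp
qed

text \<open>By monotonicity and integer translation, reaching \<open>m\<close> in \<open>k\<close>
  steps forces reaching \<open>j * m\<close> in \<open>k * j\<close> steps.\<close>

lemma rotation_number_ge:
  assumes "0 < l" "l < 1" "0 < k" and ge: "of_int m \<le> (contracted_rotation_lift l d ^^ k) 0"
  shows "of_int m \<le> real k * rotation_number l d"
proof -
  let ?F = "contracted_rotation_lift l d"
  have *: "real j * of_int m \<le> (?F ^^ (k * j)) 0" for j
  proof (induction j)
    case (Suc j)
    have "real (Suc j) * of_int m = of_int m + of_int (int j * m)" by (simp add: algebra_simps)
    also have "\<dots> \<le> (?F ^^ k) 0 + of_int (int j * m)" using ge by simp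
    also have "\<dots> = (?F ^^ k) (0 + of_int (int j * m))" by (simp only: funpow_lift_add_int)
    also have "\<dots> \<le> (?F ^^ k) ((?F ^^ (k * j)) 0)"
      using Suc by (intro monoD[OF mono_pow[OF mono_contracted_rotation_lift[OF assms(1,2)]]]) simp
    finally show ?case by (simp add: funpow_add)
  qed simp
  have "(\<lambda>j. (?F ^^ (k * Suc j)) 0 / real (k * Suc j)) \<longlonglongrightarrow> rotation_number l d"
    using LIMSEQ_subseq_LIMSEQ[OF rotation_number_tendsto[OF assms(1,2), of d 0], of "\<lambda>j. k * Suc j"] assms(3)
    by (simp add: strict_mono_def o_def)
  moreover have "of_int m / real k \<le> (?F ^^ (k * Suc j)) 0 / real (k * Suc j)" for j
  proof -
    have "of_int m / real k = real (Suc j) * of_int m / real (k * Suc j)"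
      using assms(3) by (simp del: of_nat_Suc mult_Suc_right)
    then show ?thesis using *[of "Suc j"] by (simp only: divide_right_mono of_nat_0_le_iff)
  qed
  ultimately have "of_int m / real k \<le> rotation_number l d"
    by (intro LIMSEQ_le_const) auto
  then show ?thesis using assms(3) by (simp add: field_simps)
qed

lemma rotation_number_le:
  assumes "0 < l" "l < 1" "0 < k" and le: "(contracted_rotation_lift l d ^^ k) 0 \<le> of_int m"
  shows "real k * rotation_number l d \<le> of_int m"
proof -
  let ?F = "contracted_rotation_lift l d"
  have *: "(?F ^^ (k * j)) 0 \<le> real j * of_int m" for j
  proof (induction j)
    case (Suc j)
    have "(?F ^^ (k * Suc j)) 0 = (?F ^^ k) ((?F ^^ (k * j)) 0)" by (simp add: funpow_add)
    also have "\<dots> \<le> (?F ^^ k) (0 + of_int (int j * m))"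
      using Suc by (intro monoD[OF mono_pow[OF mono_contracted_rotation_lift[OF assms(1,2)]]]) simp
    also have "\<dots> = (?F ^^ k) 0 + of_int (int j * m)" by (simp only: funpow_lift_add_int)
    also have "\<dots> \<le> of_int m + of_int (int j * m)" using le by simp
    also have "\<dots> = real (Suc j) * of_int m" by (simp add: algebra_simps)
    finally show ?case .
  qed simp
  have "(\<lambda>j. (?F ^^ (k * Suc j)) 0 / real (k * Suc j)) \<longlonglongrightarrow> rotation_number l d"
    using LIMSEQ_subseq_LIMSEQ[OF rotation_number_tendsto[OF assms(1,2), of d 0], of "\<lambda>j. k * Suc j"] assms(3)
    by (simp add: strict_mono_def o_def)
  moreover have "(?F ^^ (k * Suc j)) 0 / real (k * Suc j) \<le> of_int m / real k" for j
  proof -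
    have "of_int m / real k = real (Suc j) * of_int m / real (k * Suc j)"
      using assms(3) by (simp del: of_nat_Suc mult_Suc_right)
    then show ?thesis using *[of "Suc j"] by (simp only: divide_right_mono of_nat_0_le_iff)
  qed
  ultimately have "rotation_number l d \<le> of_int m / real k"
    by (intro LIMSEQ_le_const2) auto
  then show ?thesis using assms(3) by (simp add: field_simps)
qed

text \<open>The integer part \<open>m\<close> of the orbit point gives
  \<open>m <= k * \<rho> <= m + 1\<close> by the two preceding bounds; irrationality excludes
  equality on the right.\<close>

lemma floor_funpow_lift:
  assumes "0 < l" "l < 1" "rotation_number l d \<notin> \<rat>"
  shows "\<lfloor>(contracted_rotation_lift l d ^^ k) 0\<rfloor> = \<lfloor>real k * rotation_number l d\<rfloor>"
proof (cases "k = 0")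
  case False
  define m where "m = \<lfloor>(contracted_rotation_lift l d ^^ k) 0\<rfloor>"
  have "of_int m \<le> real k * rotation_number l d"
    using False assms by (intro rotation_number_ge) (auto simp: m_def)
  moreover have "real k * rotation_number l d \<le> of_int (m + 1)"
    using False assms by (intro rotation_number_le) (auto simp: m_def intro: order.strict_implies_order)
  moreover have "real k * rotation_number l d \<noteq> of_int (m + 1)"
    using False assms by (intro irrational_mult_nat_neq_int) auto
  ultimately show ?thesis unfolding m_def[symmetric] by (intro floor_unique[symmetric]) auto
qed simp

lemma irrational_rotation_number_bounds:
  assumes "0 < l" "l < 1" "0 < d" "d < 1" "rotation_number l d \<notin> \<rat>"
  shows "0 < rotation_number l d" "rotation_number l d < 1"
proof -
  have F: "(contracted_rotation_lift l d ^^ 1) 0 = d"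
    by (simp add: contracted_rotation_lift_def)
  have "of_int 0 \<le> real 1 * rotation_number l d"
    by (rule rotation_number_ge) (use assms F in auto)
  moreover have "real 1 * rotation_number l d \<le> of_int 1"
    by (rule rotation_number_le) (use assms F in auto)
  moreover have "rotation_number l d \<noteq> 0" "rotation_number l d \<noteq> 1"
    using assms(5) by (metis Rats_0, metis Rats_1)
  ultimately show "0 < rotation_number l d" "rotation_number l d < 1" by auto
qed

section \<open>Evaluation of the floor series\<close>

lemma floor_diff_cases:
  fixes a b :: real
  shows "\<lfloor>a\<rfloor> - \<lfloor>a - b\<rfloor> = (if frac a < frac b then \<lfloor>b\<rfloor> + 1 else \<lfloor>b\<rfloor>)"
proof -
  have "\<lfloor>a - b\<rfloor> = \<lfloor>a\<rfloor> - \<lfloor>b\<rfloor> - 1" if "frac a < frac b"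
    using that unfolding frac_def by (intro floor_unique) (simp; linarith)+
  moreover have "\<lfloor>a - b\<rfloor> = \<lfloor>a\<rfloor> - \<lfloor>b\<rfloor>" if "\<not> frac a < frac b"
    using that unfolding frac_def by (intro floor_unique) (simp; linarith)+
  ultimately show ?thesis by simp
qed

lemma frac_pos_irrational:
  fixes \<rho> :: real
  assumes "\<rho> \<notin> \<rat>"
  shows "0 < frac (real (Suc j) * \<rho>)"
proof -
  have "real (Suc j) * \<rho> \<notin> \<int>"
    using irrational_mult_nat_neq_int[OF assms, of "Suc j"] by (auto elim!: Ints_cases)
  then show ?thesis by (simp only: frac_gt_0_iff simp_thms)
qed

text \<open>The orbit of 0 satisfies \<open>\<lfloor>F\<^sup>k 0\<rfloor> = \<lfloor>k \<rho>\<rfloor>\<close>; letting \<open>k \<rho>\<close> approach the integers from either side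
  in \<open>0 \<le> F\<^sup>k 0 - \<lfloor>k \<rho>\<rfloor> < 1\<close> pins down \<open>d\<close>.\<close>

theorem sums_floor_rotation_number:
  assumes l: "0 < l" "l < 1" and d: "0 < d" "d < 1" and irr: "rotation_number l d \<notin> \<rat>"
  shows "(\<lambda>k. of_int \<lfloor>real k * rotation_number l d\<rfloor> * l ^ k) sums (l * (d - (1 - l)) / (1 - l)\<^sup>2)"
proof -
  define \<rho> where "\<rho> = rotation_number l d"
  have irr: "\<rho> \<notin> \<rat>" and \<rho>: "0 < \<rho>" "\<rho> < 1"
    using irr irrational_rotation_number_bounds[OF l d irr] by (simp_all add: \<rho>_def)
  define x where "x k = (contracted_rotation_lift l d ^^ k) 0" for k
  have fx: "\<lfloor>x k\<rfloor> = \<lfloor>real k * \<rho>\<rfloor>" for k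
    unfolding x_def \<rho>_def by (rule floor_funpow_lift) (use l irr in \<open>auto simp: \<rho>_def\<close>)
  have x_Suc: "x (Suc k) = l * x k + (d + (1 - l) * of_int \<lfloor>real k * \<rho>\<rfloor>)" for k
  proof -
    have "x (Suc k) = l * frac (x k) + d + of_int \<lfloor>x k\<rfloor>"
      by (simp add: x_def contracted_rotation_lift_def)
    then show ?thesis by (simp add: frac_def fx algebra_simps)
  qed
  \<comment> \<open>The unrolled recurrence; the floor in term \<open>j\<close> belongs to the index
    \<open>k - 1 - j\<close>, written as a difference of reals.\<close>
  have x_sum: "x k = (\<Sum>j<k. l ^ j * (d + (1 - l) * of_int \<lfloor>(real k - real (Suc j)) * \<rho>\<rfloor>))" for k
  proof (induction k)
    case 0
    show ?case by (simp add: x_def)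
  next
    case (Suc k)
    show ?case
      unfolding x_Suc Suc sum.lessThan_Suc_shift
      by (simp add: sum_distrib_left mult.assoc diff_add_eq_diff_diff_swap)
  qed
  \<comment> \<open>Replacing the floor of \<open>k * \<rho> - Suc j * \<rho>\<close> by the
    difference of the two floors, minus 1, plus \<open>e k j\<close>, separates a series
    \<open>t\<close> that does not depend on \<open>k\<close> from a comparison of fractional
    parts.\<close>
  define t where "t j = l ^ j * (d - (1 - l) * (of_int \<lfloor>real (Suc j) * \<rho>\<rfloor> + 1))" for j
  define e where "e k j = (if frac (real k * \<rho>) < frac (real (Suc j) * \<rho>) then 0 else 1 :: real)" for k j
  have geo: "(1 - l) * (\<Sum>j<k. l ^ j) = 1 - l ^ k" for k
    by (simp add: one_diff_power_eq)
  have y: "x k - of_int \<lfloor>real k * \<rho>\<rfloor> = (\<Sum>j<k. t j) + (1 - l) * (\<Sum>j<k. l ^ j * e k j) - l ^ k * of_int \<lfloor>real k * \<rho>\<rfloor>" for k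
  proof -
    have c: "of_int \<lfloor>(real k - real (Suc j)) * \<rho>\<rfloor> = of_int \<lfloor>real k * \<rho>\<rfloor> - (of_int \<lfloor>real (Suc j) * \<rho>\<rfloor> + 1) + e k j" for j
    proof -
      have "(real k - real (Suc j)) * \<rho> = real k * \<rho> - real (Suc j) * \<rho>" by (rule left_diff_distrib)
      then have "\<lfloor>real k * \<rho>\<rfloor> - \<lfloor>(real k - real (Suc j)) * \<rho>\<rfloor> =
          (if frac (real k * \<rho>) < frac (real (Suc j) * \<rho>) then \<lfloor>real (Suc j) * \<rho>\<rfloor> + 1 else \<lfloor>real (Suc j) * \<rho>\<rfloor>)"
        using floor_diff_cases by presburger
      then have "real_of_int (\<lfloor>real k * \<rho>\<rfloor> - \<lfloor>(real k - real (Suc j)) * \<rho>\<rfloor>) = of_int \<lfloor>real (Suc j) * \<rho>\<rfloor> + 1 - e k j"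
        by (simp add: e_def del: of_nat_Suc)
      then show ?thesis by simp
    qed
    have "x k = (\<Sum>j<k. t j + (1 - l) * (l ^ j * e k j) + (1 - l) * of_int \<lfloor>real k * \<rho>\<rfloor> * l ^ j)"
      unfolding x_sum c t_def by (intro sum.cong refl) (simp add: algebra_simps)
    also have "\<dots> = (\<Sum>j<k. t j) + (1 - l) * (\<Sum>j<k. l ^ j * e k j) + ((1 - l) * (\<Sum>j<k. l ^ j)) * of_int \<lfloor>real k * \<rho>\<rfloor>"
      by (simp add: sum.distrib sum_distrib_left mult_ac)
    finally show ?thesis unfolding geo by (simp add: algebra_simps)
  qed
  have fl_nonneg: "0 \<le> \<lfloor>real k * \<rho>\<rfloor>" for k using \<rho> by simp
  have fl_le: "of_int \<lfloor>real k * \<rho>\<rfloor> \<le> real k" for k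
  proof -
    have "of_int \<lfloor>real k * \<rho>\<rfloor> \<le> real k * \<rho>" by simp
    also have "\<dots> \<le> real k * 1" using \<rho> by (intro mult_left_mono) auto
    finally show ?thesis by simp
  qed
  have gs: "summable (\<lambda>j. real (Suc j) * l ^ j)"
    using geometric_deriv_sums[of l] l by (auto simp: sums_iff)
  have sum_fl: "summable (\<lambda>j. l ^ j * of_int \<lfloor>real (Suc j) * \<rho>\<rfloor>)"
  proof (rule summable_comparison_test'[OF gs])
    fix n
    show "norm (l ^ n * real_of_int \<lfloor>real (Suc n) * \<rho>\<rfloor>) \<le> real (Suc n) * l ^ n"
      using fl_nonneg[of "Suc n"] fl_le[of "Suc n"] l by (simp add: abs_mult mult.commute mult_left_mono del: of_nat_Suc)
  qed
  define V where "V = (\<Sum>j. l ^ j * of_int \<lfloor>real (Suc j) * \<rho>\<rfloor>)"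
  have V: "(\<lambda>j. l ^ j * of_int \<lfloor>real (Suc j) * \<rho>\<rfloor>) sums V"
    using sum_fl by (simp add: V_def summable_sums)
  have geo_sums: "(\<lambda>j. l ^ j) sums (1 / (1 - l))" using geometric_sums[of l] l by simp
  define T where "T = (d - (1 - l)) * (1 / (1 - l)) - (1 - l) * V"
  have "t = (\<lambda>j. (d - (1 - l)) * l ^ j - (1 - l) * (l ^ j * of_int \<lfloor>real (Suc j) * \<rho>\<rfloor>))"
    unfolding t_def by (rule ext) (simp add: algebra_simps)
  then have tT: "t sums T"
    unfolding T_def by (simp only:) (intro sums_diff sums_mult geo_sums V)
  then have tlim: "(\<lambda>k. \<Sum>j<k. t j) \<longlonglongrightarrow> T" by (simp add: sums_def)
  have pl: "(\<lambda>k. l ^ k) \<longlonglongrightarrow> 0" using l by (intro LIMSEQ_realpow_zero) auto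
  \<comment> \<open>If \<open>frac (k * \<rho>)\<close> lies below the first \<open>J\<close>
    fractional parts, then \<open>e k j = 0\<close> for \<open>j < J\<close>, and the
    \<open>e\<close>-sum contributes at most the geometric tail \<open>l^J\<close>.\<close>
  have small: "\<exists>k\<ge>J. (\<Sum>j<k. t j) \<ge> - (l ^ J)" for J
  proof -
    define \<delta> where "\<delta> = Min (insert 1 ((\<lambda>j. frac (real (Suc j) * \<rho>)) ` {..<J}))"
    have "\<delta> > 0" unfolding \<delta>_def by (subst Min_gr_iff) (auto simp del: of_nat_Suc frac_gt_0_iff intro!: frac_pos_irrational[OF irr])
    then obtain k where k: "k > 0" "\<bar>frac (real k * \<rho>) - 0\<bar> < \<delta>"
      using Kronecker_approx_1_explicit[OF irr, of 0 \<delta>] by auto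
    have lt: "frac (real k * \<rho>) < frac (real (Suc j) * \<rho>)" if "j < J" for j
    proof -
      have "\<delta> \<le> frac (real (Suc j) * \<rho>)" unfolding \<delta>_def using that by (intro Min_le) auto
      then show ?thesis using k by linarith
    qed
    \<comment> \<open>Otherwise \<open>j = k - 1\<close> would compare
      \<open>frac (k * \<rho>)\<close> with itself.\<close>
    have kJ: "k \<ge> J"
    proof (rule ccontr)
      assume "\<not> k \<ge> J"
      then have "k - 1 < J" using k(1) by linarith
      from lt[OF this] k(1) show False by simp
    qed
    have "(1 - l) * (\<Sum>j<k. l ^ j * e k j) \<le> (1 - l) * (\<Sum>j\<in>{J..<k}. l ^ j)"
    proof -
      have "(\<Sum>j<k. l ^ j * e k j) = (\<Sum>j\<in>{J..<k}. l ^ j * e k j)"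
        by (rule sum.mono_neutral_right) (use kJ lt in \<open>auto simp: e_def simp del: of_nat_Suc\<close>)
      also have "\<dots> \<le> (\<Sum>j\<in>{J..<k}. l ^ j)" using l by (intro sum_mono) (auto simp: e_def)
      finally show ?thesis using l by (intro mult_left_mono) auto
    qed
    also have "\<dots> = (1 - l) * (\<Sum>j<k. l ^ j) - (1 - l) * (\<Sum>j<J. l ^ j)"
      using sum_diff_nat_ivl[of 0 J k "\<lambda>j. l ^ j"] kJ by (simp add: atLeast0LessThan algebra_simps)
    also have "\<dots> \<le> l ^ J" unfolding geo using l by simp
    finally have "(1 - l) * (\<Sum>j<k. l ^ j * e k j) \<le> l ^ J" .
    moreover have "0 \<le> x k - of_int \<lfloor>real k * \<rho>\<rfloor>" using fx[of k] by linarith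
    moreover have "0 \<le> l ^ k * of_int \<lfloor>real k * \<rho>\<rfloor>" using l fl_nonneg[of k] by simp
    ultimately have "(\<Sum>j<k. t j) \<ge> - (l ^ J)" using y[of k] by linarith
    then show ?thesis using kJ by blast
  qed
  \<comment> \<open>The mirror image: with \<open>frac (k * \<rho>)\<close> close to 1,
    \<open>e k j = 1\<close> for \<open>j < J\<close>. The summand \<open>real k * l ^ k\<close>
    bounds the term \<open>l ^ k * floor (k * \<rho>)\<close>, which in the other direction could be
    dropped by its sign.\<close>
  have large: "\<exists>k\<ge>J. (\<Sum>j<k. t j) \<le> l ^ J + real k * l ^ k" for J
  proof -
    define \<delta> where "\<delta> = Max (insert 0 ((\<lambda>j. frac (real (Suc j) * \<rho>)) ` {..<J}))"
    have "\<delta> < 1" unfolding \<delta>_def by (subst Max_less_iff) (auto simp: frac_lt_1)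
    then obtain k where k: "k > 0" "\<bar>frac (real k * \<rho>) - 1\<bar> < 1 - \<delta>"
      using Kronecker_approx_1_explicit[OF irr, of 1 "1 - \<delta>"] by auto
    have lt: "frac (real k * \<rho>) > frac (real (Suc j) * \<rho>)" if "j < J" for j
    proof -
      have "\<delta> \<ge> frac (real (Suc j) * \<rho>)" unfolding \<delta>_def using that by (intro Max_ge) auto
      then show ?thesis using k by linarith
    qed
    have kJ: "k \<ge> J"
    proof (rule ccontr)
      assume "\<not> k \<ge> J"
      then have "k - 1 < J" using k(1) by linarith
      from lt[OF this] k(1) show False by simp
    qed
    have "(\<Sum>j<J. l ^ j) = (\<Sum>j<J. l ^ j * e k j)"
    proof (rule sum.cong[OF refl])
      fix j assume "j \<in> {..<J}"
      then have "\<not> frac (real k * \<rho>) < frac (real (Suc j) * \<rho>)" using lt[of j] by simp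
      then show "l ^ j = l ^ j * e k j" by (simp add: e_def del: of_nat_Suc)
    qed
    also have "\<dots> \<le> (\<Sum>j<k. l ^ j * e k j)"
      using kJ l by (intro sum_mono2) (auto simp: e_def)
    finally have "(1 - l) * (\<Sum>j<J. l ^ j) \<le> (1 - l) * (\<Sum>j<k. l ^ j * e k j)"
      using l by (intro mult_left_mono) auto
    then have "1 - l ^ J \<le> (1 - l) * (\<Sum>j<k. l ^ j * e k j)" unfolding geo .
    moreover have "x k - of_int \<lfloor>real k * \<rho>\<rfloor> < 1" using fx[of k] by linarith
    moreover have "l ^ k * of_int \<lfloor>real k * \<rho>\<rfloor> \<le> real k * l ^ k"
      using l fl_le[of k] by (simp add: mult.commute)
    ultimately have "(\<Sum>j<k. t j) \<le> l ^ J + real k * l ^ k" using y[of k] by linarith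
    then show ?thesis using kJ by blast
  qed
  have T0: "T = 0"
  proof (rule antisym)
    show "0 \<le> T"
    proof (rule ccontr)
      assume "\<not> 0 \<le> T"
      then have "eventually (\<lambda>k. (\<Sum>j<k. t j) < T / 2) sequentially" "eventually (\<lambda>k. l ^ k < - T / 2) sequentially"
        by (intro order_tendstoD[OF tlim] order_tendstoD[OF pl]; simp)+
      then have "eventually (\<lambda>k. (\<Sum>j<k. t j) < T / 2 \<and> l ^ k < - T / 2) sequentially" by (rule eventually_conj)
      then obtain K where K: "\<And>k. k \<ge> K \<Longrightarrow> (\<Sum>j<k. t j) < T / 2 \<and> l ^ k < - T / 2"
        by (auto simp: eventually_sequentially)
      obtain k where "k \<ge> K" "(\<Sum>j<k. t j) \<ge> - (l ^ K)" using small by blast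
      then show False using K[of k] K[of K] by simp
    qed
    show "T \<le> 0"
    proof (rule ccontr)
      assume T: "\<not> T \<le> 0"
      have pk: "(\<lambda>k. real k * l ^ k) \<longlonglongrightarrow> 0"
        using powser_times_n_limit_0[of l] l by simp
      have "eventually (\<lambda>k. T / 2 < (\<Sum>j<k. t j)) sequentially" "eventually (\<lambda>k. l ^ k < T / 4) sequentially"
        "eventually (\<lambda>k. real k * l ^ k < T / 4) sequentially"
        using T by (intro order_tendstoD[OF tlim] order_tendstoD[OF pl] order_tendstoD[OF pk]; simp)+
      then have "eventually (\<lambda>k. T / 2 < (\<Sum>j<k. t j) \<and> l ^ k < T / 4 \<and> real k * l ^ k < T / 4) sequentially"
        by (intro eventually_conj)
      then obtain K where K: "\<And>k. k \<ge> K \<Longrightarrow> T / 2 < (\<Sum>j<k. t j) \<and> l ^ k < T / 4 \<and> real k * l ^ k < T / 4"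
        unfolding eventually_sequentially by blast
      obtain k where "k \<ge> K" "(\<Sum>j<k. t j) \<le> l ^ K + real k * l ^ k" using large by blast
      then show False using K[of k] K[of K] by linarith
    qed
  qed
  then have "(1 - l) * V = (d - (1 - l)) / (1 - l)"
    unfolding T_def by simp
  then have "V = (d - (1 - l)) / (1 - l) / (1 - l)"
    using l by (metis diff_gt_0_iff_gt less_irrefl nonzero_mult_div_cancel_left)
  then have "V = (d - (1 - l)) / (1 - l)\<^sup>2"
    by (simp add: power2_eq_square)
  then have "(\<lambda>j. l * (l ^ j * of_int \<lfloor>real (Suc j) * \<rho>\<rfloor>)) sums (l * ((d - (1 - l)) / (1 - l)\<^sup>2))"
    using sums_mult[OF V, of l] by simp
  then have "(\<lambda>j. of_int \<lfloor>real (Suc j) * \<rho>\<rfloor> * l ^ Suc j) sums (l * (d - (1 - l)) / (1 - l)\<^sup>2)"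
    by (simp add: mult_ac)
  then show ?thesis
    unfolding \<rho>_def by (subst (asm) sums_Suc_iff) simp
qed

section \<open>Sturmian series and continued fractions\<close>

text \<open>The series \<open>u\<close> of the overview. The coefficient is one factor in front of
  \<open>z ^ k\<close>, with value 0 at \<open>k = 0\<close>, so that this is literally the
  evaluation of the formal power series \<open>sturm_fps_at \<omega> w\<close>.\<close>

definition sturm_series :: "real \<Rightarrow> real \<Rightarrow> real \<Rightarrow> real" where
  "sturm_series \<omega> z w = (\<Sum>k. (if k = 0 then 0 else w ^ nat \<lfloor>real k * \<omega>\<rfloor>) * z ^ k)"

lemma sturm_series_sums:
  assumes "0 \<le> z" "z < 1" "0 \<le> w" "w \<le> 1"
  shows "(\<lambda>k. z ^ Suc k * w ^ nat \<lfloor>real (Suc k) * \<omega>\<rfloor>) sums sturm_series \<omega> z w"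
    and "(\<lambda>k. (if k = 0 then 0 else w ^ nat \<lfloor>real k * \<omega>\<rfloor>) * z ^ k) sums sturm_series \<omega> z w"
proof -
  have "summable (\<lambda>k. (if k = 0 then 0 else w ^ nat \<lfloor>real k * \<omega>\<rfloor>) * z ^ k)"
  proof (rule summable_comparison_test')
    show "summable (\<lambda>k. z ^ k)" using assms by (intro summable_geometric) auto
    show "norm ((if k = 0 then 0 else w ^ nat \<lfloor>real k * \<omega>\<rfloor>) * z ^ k) \<le> z ^ k" for k
      using assms by (auto simp: abs_mult power_le_one intro!: mult_left_le_one_le)
  qed
  then show 1: "(\<lambda>k. (if k = 0 then 0 else w ^ nat \<lfloor>real k * \<omega>\<rfloor>) * z ^ k) sums sturm_series \<omega> z w"
    unfolding sturm_series_def by (rule summable_sums)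
  then have "(\<lambda>k. (if Suc k = 0 then 0 else w ^ nat \<lfloor>real (Suc k) * \<omega>\<rfloor>) * z ^ Suc k) sums (sturm_series \<omega> z w - 0)"
    by (subst sums_Suc_iff) simp
  then show "(\<lambda>k. z ^ Suc k * w ^ nat \<lfloor>real (Suc k) * \<omega>\<rfloor>) sums sturm_series \<omega> z w"
    by (simp add: mult.commute del: of_nat_Suc power_Suc)
qed

lemma sturm_series_pos:
  assumes "0 < z" "z < 1" "0 < w" "w \<le> 1"
  shows "0 < sturm_series \<omega> z w"
proof -
  have s: "(\<lambda>k. z ^ Suc k * w ^ nat \<lfloor>real (Suc k) * \<omega>\<rfloor>) sums sturm_series \<omega> z w"
    using assms by (intro sturm_series_sums) auto
  then have "sturm_series \<omega> z w = (\<Sum>k. z ^ Suc k * w ^ nat \<lfloor>real (Suc k) * \<omega>\<rfloor>)"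
    by (simp only: sums_iff)
  also have "\<dots> > 0"
    using s assms by (intro suminf_pos) (auto simp: sums_iff simp del: of_nat_Suc power_Suc)
  finally show ?thesis .
qed

lemma sturm_series_le:
  assumes "0 \<le> z" "z < 1" "0 \<le> w" "w \<le> 1"
  shows "sturm_series \<omega> z w \<le> z / (1 - z)"
proof (rule sums_le)
  show "(\<lambda>k. z ^ Suc k * w ^ nat \<lfloor>real (Suc k) * \<omega>\<rfloor>) sums sturm_series \<omega> z w"
    using assms by (rule sturm_series_sums)
  show "(\<lambda>k. z * z ^ k) sums (z / (1 - z))"
    using sums_mult[OF geometric_sums[of z], of z] assms by simp
  show "z ^ Suc k * w ^ nat \<lfloor>real (Suc k) * \<omega>\<rfloor> \<le> z * z ^ k" for k
    using assms by (simp add: mult_left_le power_le_one del: of_nat_Suc)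
qed

text \<open>Summation by parts: \<open>\<lfloor>k \<omega>\<rfloor>\<close> jumps from \<open>h\<close> to \<open>h + 1\<close> exactly between
  \<open>k = \<lfloor>(h + 1) / \<omega>\<rfloor>\<close> and \<open>k + 1\<close>.\<close>

lemma sums_floor_jumps:
  fixes B :: "nat \<Rightarrow> real"
  assumes irr: "\<omega> \<notin> \<rat>" and \<omega>: "0 < \<omega>" "\<omega> < 1"
    and s: "(\<lambda>k. B (nat \<lfloor>real k * \<omega>\<rfloor>) * z ^ k) sums s"
  shows "(\<lambda>h. z ^ Suc (nat \<lfloor>real (Suc h) / \<omega>\<rfloor>) * (B (Suc h) - B h)) sums ((1 - z) * s - B 0)"
proof -
  define b where "b k = B (nat \<lfloor>real k * \<omega>\<rfloor>)" for k
  define f where "f k = (b (Suc k) - b k) * z ^ Suc k" for k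
  define g where "g h = nat \<lfloor>real (Suc h) / \<omega>\<rfloor>" for h
  have "(\<lambda>k. b (Suc k) * z ^ Suc k) sums (s - B 0)"
    using s by (subst sums_Suc_iff) (simp add: b_def)
  moreover have "(\<lambda>k. z * (b k * z ^ k)) sums (z * s)"
    using s by (intro sums_mult) (simp add: b_def)
  ultimately have "(\<lambda>k. b (Suc k) * z ^ Suc k - z * (b k * z ^ k)) sums (s - B 0 - z * s)"
    by (rule sums_diff)
  then have f: "f sums ((1 - z) * s - B 0)"
    by (simp add: f_def[abs_def] algebra_simps)
  have g_pos: "0 \<le> \<lfloor>real (Suc h) / \<omega>\<rfloor>" for h using \<omega> by simp
  have gh: "real (g h) = of_int \<lfloor>real (Suc h) / \<omega>\<rfloor>" for h
    using g_pos[of h] by (simp add: g_def del: of_nat_Suc)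
  have lo: "real (g h) * \<omega> < real (Suc h)" for h
  proof -
    have "of_int \<lfloor>real (Suc h) / \<omega>\<rfloor> \<le> real (Suc h) / \<omega>" by linarith
    then have "real (g h) \<le> real (Suc h) / \<omega>" using gh[of h] by linarith
    then have "real (g h) * \<omega> \<le> real (Suc h)" using \<omega> by (simp add: pos_le_divide_eq)
    moreover have "real (g h) * \<omega> \<noteq> of_int (int (Suc h))"
    proof (cases "g h = 0")
      case False
      then show ?thesis using irr by (intro irrational_mult_nat_neq_int) auto
    qed (simp del: of_nat_Suc)
    ultimately show ?thesis by simp
  qed
  have hi: "real (Suc h) < real (Suc (g h)) * \<omega>" for h
  proof -
    have "real (Suc h) / \<omega> < of_int \<lfloor>real (Suc h) / \<omega>\<rfloor> + 1" by linarith
    then have "real (Suc h) / \<omega> < real (Suc (g h))" using gh[of h] of_nat_Suc[of "g h", where 'a = real] by linarith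
    then show ?thesis using \<omega> by (simp only: pos_divide_less_eq)
  qed
  have fl: "nat \<lfloor>real (g h) * \<omega>\<rfloor> = h" for h
  proof -
    have "real (Suc (g h)) * \<omega> = real (g h) * \<omega> + \<omega>" by (simp add: algebra_simps)
    then have "\<lfloor>real (g h) * \<omega>\<rfloor> = int h" using lo[of h] hi[of h] \<omega> by (intro floor_unique) auto
    then show ?thesis by simp
  qed
  have fl': "nat \<lfloor>real (Suc (g h)) * \<omega>\<rfloor> = Suc h" for h
  proof -
    have "real (Suc (g h)) * \<omega> = real (g h) * \<omega> + \<omega>" by (simp add: algebra_simps)
    then have "\<lfloor>real (Suc (g h)) * \<omega>\<rfloor> = int (Suc h)" using lo[of h] hi[of h] \<omega> by (intro floor_unique) auto
    then show ?thesis by simp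
  qed
  \<comment> \<open>The differences \<open>f\<close> vanish off the jump positions, so their sum can
    be taken along the strictly increasing \<open>g\<close>.\<close>
  have "strict_mono g"
    unfolding strict_mono_Suc_iff
  proof
    fix h
    show "g h < g (Suc h)"
    proof (rule ccontr)
      assume "\<not> g h < g (Suc h)"
      then have "real (Suc (g (Suc h))) * \<omega> \<le> real (Suc (g h)) * \<omega>" using \<omega> by (intro mult_right_mono) auto
      also have "\<dots> = real (g h) * \<omega> + \<omega>" by (simp add: algebra_simps)
      also have "\<dots> < real (Suc h) + 1" using lo[of h] \<omega> by linarith
      finally show False using hi[of "Suc h"] by simp
    qed
  qed
  moreover have "f k = 0" if k: "k \<notin> range g" for k
  proof -
    define h where "h = \<lfloor>real k * \<omega>\<rfloor>"
    have h0: "0 \<le> h" using \<omega> by (simp add: h_def)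
    have h: "of_int h \<le> real k * \<omega>" "real k * \<omega> < of_int h + 1" unfolding h_def by linarith+
    have Suc_k: "real (Suc k) * \<omega> = real k * \<omega> + \<omega>" by (simp add: algebra_simps)
    have "real (Suc k) * \<omega> < of_int h + 1"
    proof (rule ccontr)
      assume "\<not> real (Suc k) * \<omega> < of_int h + 1"
      moreover have "real (Suc k) * \<omega> \<noteq> of_int (h + 1)"
        using irr by (intro irrational_mult_nat_neq_int) auto
      ultimately have gt: "of_int h + 1 < real (Suc k) * \<omega>" by simp
      have n: "real (Suc (nat h)) = of_int h + 1" using h0 by simp
      have "\<lfloor>real (Suc (nat h)) / \<omega>\<rfloor> = int k"
      proof (rule floor_unique)
        show "of_int (int k) \<le> real (Suc (nat h)) / \<omega>"
          using h \<omega> unfolding n by (simp add: pos_le_divide_eq)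
        show "real (Suc (nat h)) / \<omega> < of_int (int k) + 1"
          using gt \<omega> unfolding n by (simp add: pos_divide_less_eq add.commute)
      qed
      then have "g (nat h) = k" by (simp add: g_def)
      then show False using k by blast
    qed
    then have "\<lfloor>real (Suc k) * \<omega>\<rfloor> = h" using h \<omega> Suc_k by (intro floor_unique) linarith+
    then show ?thesis by (simp add: f_def b_def h_def del: of_nat_Suc)
  qed
  ultimately have "(\<lambda>h. f (g h)) sums ((1 - z) * s - B 0)"
    using f by (subst sums_mono_reindex) auto
  moreover have "f (g h) = z ^ Suc (g h) * (B (Suc h) - B h)" for h
    unfolding f_def b_def fl fl' by (rule mult.commute)
  ultimately show ?thesis by (simp only: g_def)
qed

lemma floor_inverse_tail:
  assumes "1 / \<omega> = real a + \<omega>'" "0 \<le> \<omega>'"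
  shows "nat \<lfloor>real (Suc h) / \<omega>\<rfloor> = a * Suc h + nat \<lfloor>real (Suc h) * \<omega>'\<rfloor>"
proof -
  have "real (Suc h) / \<omega> = real (Suc h) * (1 / \<omega>)" by simp
  also have "\<dots> = real (Suc h) * \<omega>' + of_int (int (a * Suc h))"
    unfolding assms(1) by (simp add: algebra_simps)
  finally have "\<lfloor>real (Suc h) / \<omega>\<rfloor> = \<lfloor>real (Suc h) * \<omega>'\<rfloor> + int (a * Suc h)"
    by (simp only: floor_add_int)
  moreover have "0 \<le> \<lfloor>real (Suc h) * \<omega>'\<rfloor>" using assms(2) by simp
  ultimately show ?thesis by (simp only: nat_add_distrib of_nat_0_le_iff nat_int add.commute)
qed

text \<open>Summation by parts with \<open>B h = h\<close>: all jumps have height 1 and sit at the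
  integer parts of multiples of \<open>1 / \<omega>\<close>, so index and floor exchange roles and
  the next tail appears.\<close>

lemma sturm_series_initial:
  assumes irr: "\<omega> \<notin> \<rat>" and \<omega>: "0 < \<omega>" "\<omega> < 1" and z: "0 < z" "z < 1"
    and a: "1 / \<omega> = real a + \<omega>'" "0 \<le> \<omega>'" "0 < a"
    and s: "(\<lambda>k. of_int \<lfloor>real k * \<omega>\<rfloor> * z ^ k) sums s"
  shows "z * sturm_series \<omega>' (z ^ a) z = (1 - z) * s"
proof -
  have "(\<lambda>k. real (nat \<lfloor>real k * \<omega>\<rfloor>) * z ^ k) sums s"
    using s \<omega> by simp
  from sums_floor_jumps[OF irr \<omega> this]
  have 1: "(\<lambda>h. z ^ Suc (nat \<lfloor>real (Suc h) / \<omega>\<rfloor>)) sums ((1 - z) * s)"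
    by (simp del: power_Suc add: of_nat_Suc)
  have "(\<lambda>k. z * ((z ^ a) ^ Suc k * z ^ nat \<lfloor>real (Suc k) * \<omega>'\<rfloor>)) sums (z * sturm_series \<omega>' (z ^ a) z)"
    using z a(3) by (intro sums_mult sturm_series_sums) (auto simp: power_less_one_iff)
  then have "(\<lambda>h. z ^ Suc (nat \<lfloor>real (Suc h) / \<omega>\<rfloor>)) sums (z * sturm_series \<omega>' (z ^ a) z)"
    unfolding floor_inverse_tail[OF a(1,2)] by (simp only: power_Suc[of z] power_add power_mult)
  then show ?thesis by (rule sums_unique2[OF _ 1])
qed

text \<open>Summation by parts with \<open>B h = w ^ h\<close>, whose differences are
  \<open>w ^ h * (w - 1)\<close>. The extra factor \<open>w\<close> on the left raises
  \<open>w ^ h\<close> to \<open>w ^ Suc h\<close>, as in a series that starts at index 1.\<close>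

lemma sturm_series_step:
  assumes irr: "\<omega> \<notin> \<rat>" and \<omega>: "0 < \<omega>" "\<omega> < 1" and z: "0 < z" "z < 1" and w: "0 < w" "w < 1"
    and a: "1 / \<omega> = real a + \<omega>'" "0 \<le> \<omega>'"
  shows "w * (z - (1 - z) * sturm_series \<omega> z w) = z * (1 - w) * sturm_series \<omega>' (z ^ a * w) z"
proof -
  let ?s = "sturm_series \<omega> z w"
  have "(\<lambda>k. z ^ Suc k * w ^ nat \<lfloor>real (Suc k) * \<omega>\<rfloor>) sums ?s"
    using z w by (intro sturm_series_sums) auto
  then have "(\<lambda>k. w ^ nat \<lfloor>real (Suc k) * \<omega>\<rfloor> * z ^ Suc k) sums ?s"
    by (simp only: mult.commute)
  \<comment> \<open>Summation by parts includes \<open>k = 0\<close>, which contributes the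
    additional 1.\<close>
  then have "(\<lambda>k. w ^ nat \<lfloor>real k * \<omega>\<rfloor> * z ^ k) sums (?s + 1)"
    by (subst (asm) sums_Suc_iff) simp
  from sums_floor_jumps[OF irr \<omega> this]
  have 1: "(\<lambda>h. z ^ Suc (nat \<lfloor>real (Suc h) / \<omega>\<rfloor>) * (w ^ Suc h - w ^ h)) sums ((1 - z) * ?s - z)"
    by (simp del: power_Suc of_nat_Suc add: algebra_simps)
  have "z ^ a * w < 1"
  proof -
    have "z ^ a * w \<le> 1 * w" using z w by (intro mult_right_mono power_le_one) auto
    then show ?thesis using w by linarith
  qed
  then have "(\<lambda>k. (z * (w - 1)) * ((z ^ a * w) ^ Suc k * z ^ nat \<lfloor>real (Suc k) * \<omega>'\<rfloor>)) sums
      ((z * (w - 1)) * sturm_series \<omega>' (z ^ a * w) z)"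
    using z w by (intro sums_mult sturm_series_sums) auto
  moreover have "(z * (w - 1)) * ((z ^ a * w) ^ Suc k * z ^ nat \<lfloor>real (Suc k) * \<omega>'\<rfloor>)
     = w * (z ^ Suc (nat \<lfloor>real (Suc k) / \<omega>\<rfloor>) * (w ^ Suc k - w ^ k))" for k
    unfolding floor_inverse_tail[OF a(1,2)] power_mult_distrib
    by (simp only: power_Suc[of z] power_add power_mult) (simp add: algebra_simps)
  ultimately have "(\<lambda>k. w * (z ^ Suc (nat \<lfloor>real (Suc k) / \<omega>\<rfloor>) * (w ^ Suc k - w ^ k))) sums
      ((z * (w - 1)) * sturm_series \<omega>' (z ^ a * w) z)"
    by (simp only:)
  moreover have "(\<lambda>k. w * (z ^ Suc (nat \<lfloor>real (Suc k) / \<omega>\<rfloor>) * (w ^ Suc k - w ^ k))) sums (w * ((1 - z) * ?s - z))"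
    using 1 by (rule sums_mult)
  ultimately have "w * ((1 - z) * ?s - z) = (z * (w - 1)) * sturm_series \<omega>' (z ^ a * w) z"
    by (rule sums_unique2[THEN sym])
  then show ?thesis by (simp add: algebra_simps)
qed

section \<open>Continued fraction data\<close>

primrec cf_tail :: "real \<Rightarrow> nat \<Rightarrow> real" where
  "cf_tail \<rho> 0 = \<rho>"
| "cf_tail \<rho> (Suc n) = frac (1 / cf_tail \<rho> n)"

definition cf_digit :: "real \<Rightarrow> nat \<Rightarrow> nat" where
  "cf_digit \<rho> n = nat \<lfloor>1 / cf_tail \<rho> n\<rfloor>"

text \<open>Denominators of the convergents with the index shifted by one: the values at 0 and 1 are
  the customary \<open>q_(-1) = 0\<close> and \<open>q_0 = 1\<close>, and
  \<open>cf_digit \<rho> n\<close> is the customary partial quotient \<open>a_(n+1)\<close>.\<close>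

fun cf_den :: "real \<Rightarrow> nat \<Rightarrow> nat" where
  "cf_den \<rho> 0 = 0"
| "cf_den \<rho> (Suc 0) = 1"
| "cf_den \<rho> (Suc (Suc n)) = cf_digit \<rho> n * cf_den \<rho> (Suc n) + cf_den \<rho> n"

locale unit_irrational =
  fixes \<rho> :: real
  assumes irr: "\<rho> \<notin> \<rat>" and \<rho>: "0 < \<rho>" "\<rho> < 1"

lemma (in unit_irrational) cf_tail_props: "cf_tail \<rho> n \<notin> \<rat> \<and> 0 < cf_tail \<rho> n \<and> cf_tail \<rho> n < 1"
proof (induction n)
  case 0
  show ?case using irr \<rho> by simp
next
  case (Suc n)
  have "1 / cf_tail \<rho> n \<notin> \<rat>"
  proof
    assume "1 / cf_tail \<rho> n \<in> \<rat>"
    then have "inverse (inverse (cf_tail \<rho> n)) \<in> \<rat>"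
      unfolding inverse_eq_divide[symmetric] by (rule Rats_inverse)
    then show False using Suc by simp
  qed
  then have f: "frac (1 / cf_tail \<rho> n) \<notin> \<rat>"
    using Rats_add[of "frac (1 / cf_tail \<rho> n)" "of_int \<lfloor>1 / cf_tail \<rho> n\<rfloor>"] by (auto simp: frac_def)
  then have "frac (1 / cf_tail \<rho> n) \<noteq> 0" by (metis Rats_0)
  then show ?case using f frac_ge_0[of "1 / cf_tail \<rho> n"] frac_lt_1[of "1 / cf_tail \<rho> n"] by simp
qed

lemma (in unit_irrational) inverse_cf_tail: "1 / cf_tail \<rho> n = real (cf_digit \<rho> n) + cf_tail \<rho> (Suc n)"
  using cf_tail_props[of n] by (simp add: cf_digit_def frac_def)

lemma (in unit_irrational) cf_digit_pos: "0 < cf_digit \<rho> n"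
proof -
  have "1 < 1 / cf_tail \<rho> n" using cf_tail_props[of n] by simp
  then show ?thesis unfolding cf_digit_def by linarith
qed

lemma (in unit_irrational) cf_den_pos: "0 < cf_den \<rho> (Suc n)"
  by (induction n) (auto simp: cf_digit_pos)

lemma (in unit_irrational) cf_den_Suc_ge: "cf_den \<rho> (Suc n) + cf_den \<rho> n \<le> cf_den \<rho> (Suc (Suc n))"
  using cf_digit_pos[of n] by simp

lemma (in unit_irrational) cf_den_mono: "cf_den \<rho> n \<le> cf_den \<rho> (Suc n)"
proof (cases n)
  case (Suc m)
  then show ?thesis using cf_den_Suc_ge[of m] unfolding Suc by linarith
qed simp

lemma (in unit_irrational) cf_den_ge: "n \<le> cf_den \<rho> (Suc n)"
proof (induction n)
  case IH: (Suc n)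
  show ?case
  proof (cases n)
    case (Suc m)
    then show ?thesis using cf_den_Suc_ge[of n] cf_den_pos[of m] IH unfolding Suc by linarith
  qed (simp add: cf_digit_pos Suc_le_eq)
qed simp

text \<open>For \<open>z\<close> and \<open>w\<close> the two powers of \<open>l\<close>, the factor
  \<open>w / (1 - w)\<close> brings the step equation into the form
  \<open>X (n + 1) + X n = w * z / ((1 - w) * (1 - z))\<close>. At \<open>n = 0\<close> the quotient
  is a division by zero, with value 0, so the chain starts at \<open>n = 1\<close>.\<close>

definition (in unit_irrational) cf_value :: "real \<Rightarrow> nat \<Rightarrow> real" where
  "cf_value l n = l ^ cf_den \<rho> n / (1 - l ^ cf_den \<rho> n) * sturm_series (cf_tail \<rho> n) (l ^ cf_den \<rho> (Suc n)) (l ^ cf_den \<rho> n)"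

lemma (in unit_irrational) cf_value_1:
  assumes l: "0 < l" "l < 1" and s: "(\<lambda>k. of_int \<lfloor>real k * \<rho>\<rfloor> * l ^ k) sums s"
  shows "cf_value l 1 = s"
proof -
  have "l * sturm_series (cf_tail \<rho> 1) (l ^ cf_digit \<rho> 0) l = (1 - l) * s"
    using irr \<rho> l s inverse_cf_tail[of 0] cf_tail_props[of 1] cf_digit_pos[of 0]
    by (intro sturm_series_initial[where \<omega> = \<rho>]) auto
  then show ?thesis using l by (simp add: cf_value_def)
qed

text \<open>By the recursion for the denominators, the new argument \<open>z ^ a * w\<close> is
  again \<open>l\<close> to a denominator, so the shape of the arguments is preserved from step to
  step.\<close>

lemma (in unit_irrational) cf_value_Suc:
  assumes l: "0 < l" "l < 1" and n: "0 < n"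
  defines "z \<equiv> l ^ cf_den \<rho> (Suc n)" and "w \<equiv> l ^ cf_den \<rho> n"
  shows "(1 - w) * (1 - z) * cf_value l (Suc n) = w * z - (1 - w) * (1 - z) * cf_value l n"
proof -
  have p: "0 < cf_den \<rho> n" using cf_den_pos[of "n - 1"] n by simp
  have zw: "0 < z" "z < 1" "0 < w" "w < 1"
    using l p cf_den_pos[of n] by (auto simp: z_def w_def power_less_one_iff)
  have *: "w * (z - (1 - z) * sturm_series (cf_tail \<rho> n) z w) = z * (1 - w) * sturm_series (cf_tail \<rho> (Suc n)) (z ^ cf_digit \<rho> n * w) z"
    using cf_tail_props[of n] cf_tail_props[of "Suc n"] by (intro sturm_series_step zw inverse_cf_tail) auto
  have "l ^ cf_den \<rho> (Suc (Suc n)) = z ^ cf_digit \<rho> n * w"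
    by (simp add: z_def w_def power_add mult.commute flip: power_mult)
  then have "(1 - w) * (1 - z) * cf_value l (Suc n) = z * (1 - w) * sturm_series (cf_tail \<rho> (Suc n)) (z ^ cf_digit \<rho> n * w) z"
    using zw by (simp add: cf_value_def z_def[symmetric])
  moreover have "(1 - w) * (1 - z) * cf_value l n = (1 - z) * w * sturm_series (cf_tail \<rho> n) z w"
    using zw by (simp add: cf_value_def z_def[symmetric] w_def[symmetric])
  moreover have "w * (z - (1 - z) * u) = w * z - (1 - z) * w * u" for u
    by (simp add: algebra_simps)
  ultimately show ?thesis using * by (simp only:)
qed

declare cf_den.simps(3) [simp del]

text \<open>\<open>sz e a\<close> says that \<open>a\<close> has height at most exponential in \<open>e\<close>; absorbing constants into \<open>\<kappa>\<close> leaves a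
  single natural number to keep track of.\<close>

locale size_function =
  fixes sz :: "nat \<Rightarrow> real \<Rightarrow> bool" and \<kappa> l d :: real
  assumes \<kappa>: "1 < \<kappa>" and sz_l: "sz 1 l" and sz_d: "sz 1 d" and sz_1: "sz 0 1"
    and sz_mono: "\<And>e e' a. sz e a \<Longrightarrow> e \<le> e' \<Longrightarrow> sz e' a"
    and sz_minus: "\<And>e a. sz e a \<Longrightarrow> sz e (- a)"
    and sz_add: "\<And>e a b. sz e a \<Longrightarrow> sz e b \<Longrightarrow> sz (e + 1) (a + b)"
    and sz_mult: "\<And>e e' a b. sz e a \<Longrightarrow> sz e' b \<Longrightarrow> sz (e + e') (a * b)"
    and sz_lower: "\<And>e a. sz e a \<Longrightarrow> a \<noteq> 0 \<Longrightarrow> 1 \<le> \<kappa> ^ (e + 1) * \<bar>a\<bar>"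
    and l: "0 < l" "l < 1"
begin

lemma sz_diff: "sz e a \<Longrightarrow> sz e b \<Longrightarrow> sz (e + 1) (a - b)"
  using sz_add[of e a "- b"] sz_minus by simp

lemma sz_power: "sz e a \<Longrightarrow> sz (n * e) (a ^ n)"
proof (induction n)
  case (Suc n)
  then show ?case using sz_mult[of e a "n * e" "a ^ n"] by simp
qed (simp add: sz_1)

lemma sz_l_power: "sz k (l ^ k)"
  using sz_power[OF sz_l, of k] by simp

lemma sz_one_minus_l_power: "sz (k + 1) (1 - l ^ k)"
  using sz_diff[OF sz_mono[OF sz_1, of k] sz_l_power[of k]] by simp

lemma sz_0: "sz 1 0"
  using sz_diff[OF sz_1 sz_1] by (simp only: add_0 diff_self)

lemma sz_of_nat: "sz (n + 1) (real n)"
proof (induction n)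
  case (Suc n)
  have "sz (n + 1) 1" using sz_mono[OF sz_1] by simp
  from sz_add[OF Suc this] show ?case by (simp add: add.commute)
qed (use sz_0 in simp)

lemma sz_of_int: "sz (nat \<bar>n\<bar> + 1) (of_int n)"
proof (cases "0 \<le> n")
  case True
  then show ?thesis using sz_of_nat[of "nat n"] by simp
next
  case False
  then show ?thesis using sz_minus[OF sz_of_nat[of "nat (- n)"]] by simp
qed

text \<open>One unit per addition; the last 1 pays for the empty sum.\<close>

lemma sz_sum:
  assumes "finite I" "\<And>i. i \<in> I \<Longrightarrow> sz e (f i)"
  shows "sz (e + card I + 1) (\<Sum>i\<in>I. f i)"
  using assms
proof (induction I rule: finite_induct)
  case empty
  show ?case using sz_mono[OF sz_0, of "e + 1"] by simp
next
  case (insert x F)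
  have "sz (e + card F + 1) (f x)" by (rule sz_mono[OF insert.prems]) auto
  then have "sz (e + card F + 1 + 1) (f x + (\<Sum>i\<in>F. f i))" using insert by (intro sz_add) auto
  then show ?case using insert by (simp add: ac_simps)
qed

end

section \<open>Sizes along the chain of functional equations\<close>

locale mahler_setup = size_function sz \<kappa> l d + unit_irrational \<rho>
  for sz \<kappa> l d \<rho> +
  assumes floor_sums: "(\<lambda>k. of_int \<lfloor>real k * \<rho>\<rfloor> * l ^ k) sums (l * (d - (1 - l)) / (1 - l)\<^sup>2)"
begin

abbreviation "Q \<equiv> cf_den \<rho>"
abbreviation "X \<equiv> cf_value l"

text \<open>Clears the denominators of \<open>X (Suc n)\<close>: \<open>(1 - l)^2\<close> comes from
  the initial value, the other factors come from one functional equation each.\<close>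

fun common_den :: "nat \<Rightarrow> real" where
  "common_den 0 = (1 - l) ^ 2"
| "common_den (Suc n) = common_den n * ((1 - l ^ Q (Suc n)) * (1 - l ^ Q (Suc (Suc n))))"

lemma power_Q_bounds: "0 < l ^ Q (Suc n)" "l ^ Q (Suc n) \<le> l" "l ^ Q (Suc n) < 1"
proof -
  show "0 < l ^ Q (Suc n)" using l by simp
  have "l ^ Q (Suc n) \<le> l ^ 1" using l cf_den_pos[of n] by (intro power_decreasing) auto
  then show "l ^ Q (Suc n) \<le> l" by simp
  then show "l ^ Q (Suc n) < 1" using l by linarith
qed

lemma common_den_bounds: "0 < common_den n \<and> common_den n \<le> 1"
proof (induction n)
  case 0
  show ?case using l by (simp add: power_le_one)
next
  case (Suc n)
  then show ?case using power_Q_bounds[of n] power_Q_bounds[of "Suc n"]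
    by (auto intro!: mult_le_one mult_pos_pos)
qed

text \<open>A step adds \<open>Q (Suc n) + Q (Suc (Suc n)) + 3\<close> to the size. Since the
  denominators grow at least like Fibonacci numbers, the accumulated sum stays linear in the last
  two of them; the coefficient 6 also leaves room for the 3.\<close>

lemma size_bounds:
  "sz (4 + 6 * (Q n + Q (Suc n))) (common_den n) \<and>
   sz (4 + 6 * (Q n + Q (Suc n))) (common_den n * X (Suc n))"
proof (induction n)
  case 0
  have "sz 2 (1 - l)" using sz_one_minus_l_power[of 1] by (simp only: power_one_right one_add_one)
  from sz_power[OF this, of 2] have 1: "sz 4 ((1 - l) ^ 2)" by simp
  have "sz 3 (d - (1 - l))" using sz_diff[OF sz_mono[OF sz_d, of 2] \<open>sz 2 (1 - l)\<close>] by simp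
  from sz_mult[OF sz_l this] have 2: "sz 4 (l * (d - (1 - l)))" by simp
  have "common_den 0 * X (Suc 0) = l * (d - (1 - l))"
    using cf_value_1[OF l floor_sums] l by simp
  then show ?case using sz_mono[OF 1] sz_mono[OF 2] by simp
next
  case (Suc n)
  define e where "e = 4 + 6 * (Q n + Q (Suc n))"
  define z w where "z = l ^ Q (Suc (Suc n))" and "w = l ^ Q (Suc n)"
  define e' where "e' = e + (Q (Suc n) + 1 + (Q (Suc (Suc n)) + 1)) + 1"
  have D: "sz e (common_den n)" and Y: "sz e (common_den n * X (Suc n))"
    using Suc by (simp_all add: e_def)
  have zw: "sz (Q (Suc n) + 1 + (Q (Suc (Suc n)) + 1)) ((1 - w) * (1 - z))"
    unfolding z_def w_def by (intro sz_mult sz_one_minus_l_power)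
  have wz: "sz (Q (Suc n) + 1 + (Q (Suc (Suc n)) + 1)) (w * z)"
    using sz_mono[OF sz_mult[OF sz_l_power sz_l_power]] unfolding z_def w_def by simp
  have D': "sz (e + (Q (Suc n) + 1 + (Q (Suc (Suc n)) + 1))) (common_den (Suc n))"
    using sz_mult[OF D zw] by (simp add: z_def w_def)
  have "common_den (Suc n) * X (Suc (Suc n)) = common_den n * ((1 - w) * (1 - z) * X (Suc (Suc n)))"
    by (simp add: z_def w_def)
  also have "(1 - w) * (1 - z) * X (Suc (Suc n)) = w * z - (1 - w) * (1 - z) * X (Suc n)"
    unfolding z_def w_def by (rule cf_value_Suc[OF l]) simp
  also have "common_den n * \<dots> = common_den n * (w * z) - (common_den n * X (Suc n)) * ((1 - w) * (1 - z))"
    by (simp add: right_diff_distrib mult_ac)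
  finally have Y': "sz e' (common_den (Suc n) * X (Suc (Suc n)))"
    unfolding e'_def using sz_diff[OF sz_mult[OF D wz] sz_mult[OF Y zw]] by simp
  have "e' \<le> 4 + 6 * (Q (Suc n) + Q (Suc (Suc n)))"
  proof -
    have "4 + 6 * (a + b) + (b + 1 + (c + 1)) + 1 \<le> 4 + 6 * (b + c)"
      if "b + a \<le> c" "0 < b" "a \<le> b" for a b c :: nat
    proof -
      have "5 * b + 5 * a \<le> 5 * c" "3 \<le> 3 * b" using that by simp_all
      then show ?thesis using that(3) by simp
    qed
    from this[OF cf_den_Suc_ge[of n] cf_den_pos[of n] cf_den_mono[of n]]
    show ?thesis unfolding e'_def e_def .
  qed
  then show ?case using sz_mono[OF D'] sz_mono[OF Y'] by (simp add: e'_def)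
qed

lemma size_bounds':
  "sz (4 + 12 * Q (Suc n)) (common_den n)" "sz (4 + 12 * Q (Suc n)) (common_den n * X (Suc n))"
proof -
  have "4 + 6 * (Q n + Q (Suc n)) \<le> 4 + 12 * Q (Suc n)" using cf_den_mono[of n] by simp
  then show "sz (4 + 12 * Q (Suc n)) (common_den n)" "sz (4 + 12 * Q (Suc n)) (common_den n * X (Suc n))"
    using size_bounds[of n] sz_mono by blast+
qed

text \<open>The positive number \<open>common_den n * X (Suc n)\<close> has size linear in
  \<open>q = Q (Suc n)\<close> but is at most a constant times \<open>l ^ Q (Suc (Suc n))\<close>,
  hence times \<open>l ^ (a * q)\<close> for the digit \<open>a\<close>. The Liouville inequality
  rules out a large \<open>a\<close>.\<close>

lemma cf_digit_bounded: "\<exists>A. \<forall>n. cf_digit \<rho> n \<le> A"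
proof -
  \<comment> \<open>17 covers \<open>4 + 12 * q + 1\<close> because \<open>q >= 1\<close>. The
    constant \<open>1 / (1 - l)^2\<close>, being at least 1, is also raised to the power
    \<open>q\<close>, so that the whole bound becomes the \<open>q\<close>-th power of
    \<open>K * l ^ a\<close>.\<close>
  define K where "K = \<kappa> ^ 17 / (1 - l)\<^sup>2"
  have K1: "1 / (1 - l)\<^sup>2 \<ge> 1" using l by (simp add: power_le_one)
  have "(\<lambda>a. K * l ^ a) \<longlonglongrightarrow> K * 0"
    using l by (intro tendsto_mult tendsto_const LIMSEQ_realpow_zero) auto
  then have "eventually (\<lambda>a. K * l ^ a < 1) sequentially"
    by (intro order_tendstoD) auto
  then obtain A where A: "\<And>a. a \<ge> A \<Longrightarrow> K * l ^ a < 1"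
    by (auto simp: eventually_sequentially)
  have "cf_digit \<rho> n < A" for n
  proof (rule ccontr)
    assume "\<not> cf_digit \<rho> n < A"
    then have small: "K * l ^ cf_digit \<rho> n < 1" using A by simp
    define q where "q = Q (Suc n)"
    have q: "1 \<le> q" using cf_den_pos[of n] by (simp add: q_def)
    define z w where "z = l ^ Q (Suc (Suc n))" and "w = l ^ q"
    have zw: "0 < z" "z \<le> l" "z < 1" "0 < w" "w \<le> l" "w < 1"
      using power_Q_bounds[of n] power_Q_bounds[of "Suc n"] by (simp_all add: z_def w_def q_def)
    have X: "X (Suc n) = w / (1 - w) * sturm_series (cf_tail \<rho> (Suc n)) z w"
      by (simp add: cf_value_def z_def w_def q_def)
    have U: "0 < sturm_series (cf_tail \<rho> (Suc n)) z w" "sturm_series (cf_tail \<rho> (Suc n)) z w \<le> z / (1 - z)"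
      using zw by (auto intro!: sturm_series_pos sturm_series_le)
    have Xpos: "0 < X (Suc n)" unfolding X using zw U by simp
    have "w / (1 - w) \<le> 1 / (1 - l)" using zw l by (intro frac_le) auto
    moreover have "z / (1 - z) \<le> z / (1 - l)" using zw l by (intro divide_left_mono) auto
    ultimately have "X (Suc n) \<le> 1 / (1 - l) * (z / (1 - l))"
      unfolding X using U zw l by (intro mult_mono) auto
    then have Xle: "X (Suc n) \<le> z / (1 - l)\<^sup>2" by (simp add: power2_eq_square)
    have cd: "0 < common_den n" "common_den n \<le> 1" using common_den_bounds[of n] by auto
    have ne: "common_den n * X (Suc n) \<noteq> 0" using cd Xpos by simp
    have "1 \<le> \<kappa> ^ (4 + 12 * q + 1) * \<bar>common_den n * X (Suc n)\<bar>"
      unfolding q_def by (rule sz_lower[OF size_bounds'(2) ne])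
    also have "\<dots> \<le> \<kappa> ^ (17 * q) * (z / (1 - l)\<^sup>2)"
    proof (rule mult_mono)
      show "\<kappa> ^ (4 + 12 * q + 1) \<le> \<kappa> ^ (17 * q)" using q \<kappa> by (intro power_increasing) auto
      have "common_den n * X (Suc n) \<le> 1 * X (Suc n)" using cd Xpos by (intro mult_right_mono) auto
      then have "common_den n * X (Suc n) \<le> z / (1 - l)\<^sup>2" using Xle by linarith
      moreover have "0 < common_den n * X (Suc n)" using cd Xpos by simp
      ultimately show "\<bar>common_den n * X (Suc n)\<bar> \<le> z / (1 - l)\<^sup>2" by linarith
    qed (use \<kappa> in auto)
    also have "\<dots> = \<kappa> ^ (17 * q) * z * (1 / (1 - l)\<^sup>2)" by simp
    also have "\<dots> \<le> \<kappa> ^ (17 * q) * (l ^ cf_digit \<rho> n) ^ q * (1 / (1 - l)\<^sup>2) ^ q"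
    proof (intro mult_mono)
      have "z \<le> l ^ (cf_digit \<rho> n * q)" unfolding z_def q_def using l by (intro power_decreasing) (auto simp: cf_den.simps)
      then show "z \<le> (l ^ cf_digit \<rho> n) ^ q" by (simp add: power_mult)
      show "1 / (1 - l)\<^sup>2 \<le> (1 / (1 - l)\<^sup>2) ^ q" using power_increasing[OF q K1] by simp
    qed (use \<kappa> zw l in auto)
    also have "\<dots> = (K * l ^ cf_digit \<rho> n) ^ q"
      by (simp add: K_def power_mult_distrib power_mult power_divide)
    also have "\<dots> < 1"
      using small q l \<kappa> by (subst power_less_one_iff) (auto simp: K_def)
    finally show False by simp
  qed
  then show ?thesis by (intro exI[of _ A]) (auto intro: less_imp_le)
qed

end

section \<open>Irrational limits of tails and of denominator quotients\<close>

fun cf_set :: "nat \<Rightarrow> nat \<Rightarrow> real set" where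
  "cf_set A 0 = {0..1}"
| "cf_set A (Suc m) = (\<Union>a\<in>{1..A}. (\<lambda>x. 1 / (real a + x)) ` cf_set A m)"

lemma cf_set_SucE:
  assumes "x \<in> cf_set A (Suc m)"
  obtains a y where "1 \<le> a" "a \<le> A" "y \<in> cf_set A m" "x = 1 / (real a + y)"
  using assms by auto

lemma cf_set_subset: "cf_set A m \<subseteq> {0..1}"
proof (induction m)
  case (Suc m)
  show ?case
  proof
    fix x assume "x \<in> cf_set A (Suc m)"
    then obtain a y where a: "1 \<le> a" "y \<in> cf_set A m" "x = 1 / (real a + y)" by (rule cf_set_SucE)
    then have "0 \<le> y" using Suc by auto
    then show "x \<in> {0..1}" using a by auto
  qed
qed simp

lemma compact_cf_set: "compact (cf_set A m)"
proof (induction m)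
  case (Suc m)
  have "compact ((\<lambda>x. 1 / (real a + x)) ` cf_set A m)" if "a \<in> {1..A}" for a
  proof (rule compact_continuous_image[OF _ Suc])
    show "continuous_on (cf_set A m) (\<lambda>x. 1 / (real a + x))"
      using that cf_set_subset[of A m] by (intro continuous_intros) force
  qed
  then show ?case by (auto intro!: compact_UN)
qed simp

text \<open>Each inverse branch of the Gauss map strictly decreases the denominator of a rational number.\<close>

lemma rational_notin_cf_set:
  assumes "0 < q" "q < m"
  shows "real p / real q \<notin> cf_set A m"
  using assms
proof (induction q arbitrary: p m rule: less_induct)
  case (less q)
  show ?case
  proof
    assume mem: "real p / real q \<in> cf_set A m"
    obtain m' where m': "m = Suc m'" using less.prems by (cases m) auto
    with mem obtain a y where a: "1 \<le> a" "y \<in> cf_set A m'" and eq: "real p / real q = 1 / (real a + y)"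
      by (auto elim: cf_set_SucE simp del: cf_set.simps)
    have y: "0 \<le> y" "y \<le> 1" using cf_set_subset[of A m'] a(2) by auto
    have pos: "0 < real a + y" using a y by simp
    have p: "0 < p"
    proof (rule ccontr)
      assume "\<not> 0 < p"
      then show False using eq pos by simp
    qed
    have qp: "real q = real p * (real a + y)"
      using eq pos less.prems by (simp add: field_simps)
    have "real p * 1 \<le> real p * (real a + y)" using a y by (intro mult_left_mono) auto
    then have le: "p \<le> q" using qp by simp
    have "real (p * a) \<le> real q" using qp y by (simp add: distrib_left)
    then have pa: "p * a \<le> q" by (simp only: of_nat_le_iff)
    have "real p * y = real (q - p * a)" using qp pa by (simp add: of_nat_diff distrib_left)
    then have y_eq: "y = real (q - p * a) / real p" using p by (simp add: field_simps)
    show False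
    proof (cases "p < q")
      case True
      then have "real (q - p * a) / real p \<notin> cf_set A m'"
        using less.IH[of p m' "q - p * a"] p less.prems m' by simp
      then show False using a(2) y_eq by simp
    next
      \<comment> \<open>Here the point is 1, so \<open>y = 0\<close>. Since
        \<open>0 < q < m\<close>, at least one more level remains, and there 0 is not of the form
        \<open>1 / (b + u)\<close>.\<close>
      case False
      then have "p = q" using le by simp
      then have "p * a \<le> p * 1" using pa by simp
      then have "a = 1" using p a(1) by (metis le_antisym mult_le_cancel1)
      then have "y = 0" using y_eq \<open>p = q\<close> by simp
      moreover obtain m'' where "m' = Suc m''" using m' less.prems by (cases m') auto
      ultimately obtain b u where "1 \<le> b" "u \<in> cf_set A m''" "0 = 1 / (real b + u)"
        using a(2) by (auto elim: cf_set_SucE simp del: cf_set.simps)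
      moreover have "0 \<le> u" using \<open>u \<in> cf_set A m''\<close> cf_set_subset[of A m''] by auto
      ultimately show False by simp
    qed
  qed
qed

lemma all_cf_set_imp:
  assumes "\<And>m. x \<in> cf_set A m"
  shows "x \<notin> \<rat>" "0 < x" "x < 1"
proof -
  have x: "0 \<le> x" "x \<le> 1" using assms[of 0] by auto
  show irr: "x \<notin> \<rat>"
  proof
    assume "x \<in> \<rat>"
    then obtain i j where ij: "x = of_int i / of_int j" "0 < j" "coprime i j" by (rule Rats_cases')
    have "0 \<le> i"
    proof (rule ccontr)
      assume "\<not> 0 \<le> i"
      then have "x < 0" unfolding ij(1) using ij(2) by (intro divide_neg_pos) simp_all
      then show False using x by simp
    qed
    then have "real (nat i) = of_int i" "real (nat j) = of_int j" using ij(2) by simp_all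
    then have "x = real (nat i) / real (nat j)" using ij(1) by simp
    then have "x \<notin> cf_set A (Suc (nat j))"
      using rational_notin_cf_set[of "nat j" "Suc (nat j)" "nat i" A] ij(2) by simp
    then show False using assms by blast
  qed
  have "x \<noteq> 0" using irr Rats_0 by blast
  moreover have "x \<noteq> 1" using irr Rats_1 by blast
  ultimately show "0 < x" "x < 1" using x by linarith+
qed

lemma (in unit_irrational) cf_tail_in_cf_set:
  assumes "\<And>n. cf_digit \<rho> n \<le> A"
  shows "cf_tail \<rho> n \<in> cf_set A m"
proof (induction m arbitrary: n)
  case 0
  show ?case using cf_tail_props[of n] by simp
next
  case (Suc m)
  have "1 / (1 / cf_tail \<rho> n) = 1 / (real (cf_digit \<rho> n) + cf_tail \<rho> (Suc n))"
    unfolding inverse_cf_tail[of n] ..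
  then have "cf_tail \<rho> n = 1 / (real (cf_digit \<rho> n) + cf_tail \<rho> (Suc n))" by simp
  then show ?case using Suc[of "Suc n"] assms[of n] cf_digit_pos[of n] by (auto simp del: cf_tail.simps simp: Suc_le_eq)
qed

text \<open>The continued fraction of this quotient consists of the digits read backwards. It is
  finite, so depth \<open>m\<close> is available only from \<open>n = m\<close> on.\<close>

lemma (in unit_irrational) cf_den_quotient_in_cf_set:
  assumes "\<And>n. cf_digit \<rho> n \<le> A" "m \<le> n"
  shows "real (cf_den \<rho> n) / real (cf_den \<rho> (Suc n)) \<in> cf_set A m"
  using assms(2)
proof (induction m arbitrary: n)
  case 0
  show ?case using cf_den_mono[of n] cf_den_pos[of n] by simp
next
  case (Suc m)
  then obtain k where k: "n = Suc k" "m \<le> k" by (cases n) auto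
  have "real (cf_den \<rho> (Suc k)) / real (cf_den \<rho> (Suc (Suc k)))
      = 1 / (real (cf_digit \<rho> k) + real (cf_den \<rho> k) / real (cf_den \<rho> (Suc k)))"
    using cf_den_pos[of k] by (simp add: cf_den.simps field_simps)
  then show ?case using Suc.IH[OF k(2)] assms(1)[of k] cf_digit_pos[of k] unfolding k(1)
    by (auto simp: Suc_le_eq)
qed

text \<open>Tails and quotients are taken as points of one compact square, so that a single
  subsequence serves both. The limits lie in \<open>cf_set A m\<close> for every \<open>m\<close>,
  where no rational number survives.\<close>

lemma (in unit_irrational) bounded_digits_subsequence:
  assumes "\<And>n. cf_digit \<rho> n \<le> A"
  obtains r :: "nat \<Rightarrow> nat" and \<omega> t :: real where
    "strict_mono r" "(\<lambda>i. cf_tail \<rho> (r i)) \<longlonglongrightarrow> \<omega>"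
    "(\<lambda>i. real (cf_den \<rho> (r i)) / real (cf_den \<rho> (Suc (r i)))) \<longlonglongrightarrow> t"
    "\<omega> \<notin> \<rat>" "0 < \<omega>" "\<omega> < 1" "t \<notin> \<rat>" "0 < t" "t < 1"
proof -
  define f where "f n = (cf_tail \<rho> n, real (cf_den \<rho> n) / real (cf_den \<rho> (Suc n)))" for n
  have "compact ({0..1::real} \<times> {0..1::real})" by (intro compact_Times compact_Icc)
  moreover have "\<forall>n. f n \<in> {0..1} \<times> {0..1}"
    using cf_tail_in_cf_set[OF assms, of _ 0] cf_den_quotient_in_cf_set[OF assms, of 0] by (simp add: f_def)
  ultimately obtain p r where r: "strict_mono r" "(f \<circ> r) \<longlonglongrightarrow> p"
    unfolding compact_eq_seq_compact_metric seq_compact_def by blast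
  obtain \<omega> t where p: "p = (\<omega>, t)" by (cases p)
  have lim: "(\<lambda>i. cf_tail \<rho> (r i)) \<longlonglongrightarrow> \<omega>"
    "(\<lambda>i. real (cf_den \<rho> (r i)) / real (cf_den \<rho> (Suc (r i)))) \<longlonglongrightarrow> t"
    using tendsto_fst[OF r(2)] tendsto_snd[OF r(2)] by (simp_all add: f_def p o_def)
  have 1: "\<omega> \<in> cf_set A m" for m
    by (rule Lim_in_closed_set[OF compact_imp_closed[OF compact_cf_set] _ _ lim(1)])
      (simp_all add: cf_tail_in_cf_set[OF assms])
  have 2: "t \<in> cf_set A m" for m
  proof (rule Lim_in_closed_set[OF compact_imp_closed[OF compact_cf_set] _ _ lim(2)])
    show "\<forall>\<^sub>F i in sequentially. real (cf_den \<rho> (r i)) / real (cf_den \<rho> (Suc (r i))) \<in> cf_set A m"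
      using eventually_ge_at_top[of m]
    proof eventually_elim
      case (elim i)
      then have "m \<le> r i" using seq_suble[OF r(1), of i] by linarith
      then show ?case by (rule cf_den_quotient_in_cf_set[OF assms])
    qed
  qed simp
  have "\<omega> \<notin> \<rat>" "0 < \<omega>" "\<omega> < 1" by (rule all_cf_set_imp[OF 1])+
  moreover have "t \<notin> \<rat>" "0 < t" "t < 1" by (rule all_cf_set_imp[OF 2])+
  ultimately show ?thesis by (intro that[OF r(1) lim])
qed

section \<open>Auxiliary polynomials\<close>

text \<open>The qualitative form of Siegel's lemma, by fraction-free elimination of one equation at
  a time.\<close>

lemma homogeneous_system_nontrivial:
  fixes a :: "'e \<Rightarrow> 'i \<Rightarrow> int"
  assumes "finite E" "finite I" "card E < card I"
  shows "\<exists>x. (\<exists>i\<in>I. x i \<noteq> 0) \<and> (\<forall>e\<in>E. (\<Sum>i\<in>I. a e i * x i) = 0)"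
  using assms
proof (induction E arbitrary: I a rule: finite_induct)
  case empty
  then have "I \<noteq> {}" by auto
  then show ?case by (intro exI[of _ "\<lambda>_. 1"]) auto
next
  case (insert e E)
  show ?case
  proof (cases "\<forall>i\<in>I. a e i = 0")
    case True
    have "card E < card I" using insert by simp
    then obtain x where "\<exists>i\<in>I. x i \<noteq> 0" "\<forall>f\<in>E. (\<Sum>i\<in>I. a f i * x i) = 0"
      using insert.IH[of I a] insert.prems by auto
    then show ?thesis using True by (intro exI[of _ x]) auto
  next
    case False
    then obtain k where k: "k \<in> I" "a e k \<noteq> 0" by auto
    let ?I = "I - {k}"
    have "card E < card ?I" using insert k by simp
    then have "\<exists>x. (\<exists>i\<in>?I. x i \<noteq> 0) \<and> (\<forall>f\<in>E. (\<Sum>i\<in>?I. (a e k * a f i - a f k * a e i) * x i) = 0)"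
      using insert.IH[of ?I "\<lambda>f i. a e k * a f i - a f k * a e i"] insert.prems by simp
    then obtain x where x: "\<exists>i\<in>?I. x i \<noteq> 0" "\<And>f. f \<in> E \<Longrightarrow> (\<Sum>i\<in>?I. (a e k * a f i - a f k * a e i) * x i) = 0"
      by blast
    \<comment> \<open>Scaling by the pivot \<open>a e k\<close> keeps the solution integral; the
      value at \<open>k\<close> makes equation \<open>e\<close> hold identically and turns every
      other equation into one of the reduced system.\<close>
    define y where "y i = (if i = k then - (\<Sum>i\<in>?I. a e i * x i) else a e k * x i)" for i
    have sum_y: "(\<Sum>i\<in>I. a f i * y i) = (\<Sum>i\<in>?I. (a e k * a f i - a f k * a e i) * x i)" for f
    proof -
      have "(\<Sum>i\<in>I. a f i * y i) = a f k * y k + (\<Sum>i\<in>?I. a f i * y i)"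
        using insert.prems k by (simp add: sum.remove)
      also have "(\<Sum>i\<in>?I. a f i * y i) = (\<Sum>i\<in>?I. a f i * (a e k * x i))"
        by (intro sum.cong) (auto simp: y_def)
      also have "a f k * y k + (\<Sum>i\<in>?I. a f i * (a e k * x i)) = (\<Sum>i\<in>?I. a f i * (a e k * x i) - a f k * (a e i * x i))"
        by (simp add: y_def sum_distrib_left sum_subtractf)
      also have "\<dots> = (\<Sum>i\<in>?I. (a e k * a f i - a f k * a e i) * x i)"
        by (intro sum.cong refl) (simp add: algebra_simps)
      finally show ?thesis .
    qed
    have "\<exists>i\<in>I. y i \<noteq> 0" using x(1) k by (auto simp: y_def)
    moreover have "(\<Sum>i\<in>I. a e i * y i) = 0" unfolding sum_y by simp
    moreover have "\<forall>f\<in>E. (\<Sum>i\<in>I. a f i * y i) = 0" using x(2) sum_y by simp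
    ultimately show ?thesis by (intro exI[of _ y]) simp
  qed
qed

section \<open>The auxiliary polynomial as a power series\<close>

text \<open>A power series in \<open>z\<close> with integer polynomials in \<open>w\<close> as
  coefficients; \<open>sturm_fps_at\<close> is its specialisation at a real
  \<open>w\<close>.\<close>

definition sturm_fps :: "real \<Rightarrow> int poly fps" where
  "sturm_fps \<omega> = Abs_fps (\<lambda>k. if k = 0 then 0 else monom 1 (nat \<lfloor>real k * \<omega>\<rfloor>))"

definition sturm_fps_at :: "real \<Rightarrow> real \<Rightarrow> real fps" where
  "sturm_fps_at \<omega> w = Abs_fps (\<lambda>k. if k = 0 then 0 else w ^ nat \<lfloor>real k * \<omega>\<rfloor>)"

text \<open>\<open>p (j, a, b)\<close> is the coefficient of \<open>u ^ j * z ^ a * w ^ b\<close>.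
  The next two definitions are the same polynomial expression with \<open>w\<close>, and then with
  all three variables, specialised to numbers.\<close>

definition aux_fps :: "nat \<Rightarrow> (nat \<times> nat \<times> nat \<Rightarrow> int) \<Rightarrow> real \<Rightarrow> int poly fps" where
  "aux_fps N p \<omega> = (\<Sum>(j, a, b)\<in>{..N} \<times> {..N} \<times> {..N}.
     fps_const (monom (p (j, a, b)) b) * (fps_X ^ a * sturm_fps \<omega> ^ j))"

definition aux_fps_at :: "nat \<Rightarrow> (nat \<times> nat \<times> nat \<Rightarrow> int) \<Rightarrow> real \<Rightarrow> real \<Rightarrow> real fps" where
  "aux_fps_at N p \<omega> w = (\<Sum>(j, a, b)\<in>{..N} \<times> {..N} \<times> {..N}.
     fps_const (of_int (p (j, a, b)) * w ^ b) * (fps_X ^ a * sturm_fps_at \<omega> w ^ j))"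

definition aux_value :: "nat \<Rightarrow> (nat \<times> nat \<times> nat \<Rightarrow> int) \<Rightarrow> real \<Rightarrow> real \<Rightarrow> real \<Rightarrow> real" where
  "aux_value N p z w u = (\<Sum>(j, a, b)\<in>{..N} \<times> {..N} \<times> {..N}. of_int (p (j, a, b)) * w ^ b * (z ^ a * u ^ j))"

abbreviation eval_int_poly :: "int poly \<Rightarrow> real \<Rightarrow> real" where
  "eval_int_poly q x \<equiv> poly (map_poly of_int q) x"

lemma eval_int_poly_simps:
  "eval_int_poly 0 x = 0" "eval_int_poly 1 x = 1"
  "eval_int_poly (q + r) x = eval_int_poly q x + eval_int_poly r x"
  "eval_int_poly (q * r) x = eval_int_poly q x * eval_int_poly r x"
  "eval_int_poly (monom c n) x = of_int c * x ^ n"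
proof -
  show "eval_int_poly 0 x = 0" "eval_int_poly 1 x = 1" by simp_all
  have "map_poly real_of_int (q + r) = map_poly of_int q + map_poly of_int r"
    by (simp add: poly_eq_iff coeff_map_poly)
  then show "eval_int_poly (q + r) x = eval_int_poly q x + eval_int_poly r x" by simp
  have "map_poly real_of_int (q * r) = map_poly of_int q * map_poly of_int r"
    by (simp add: poly_eq_iff coeff_map_poly coeff_mult)
  then show "eval_int_poly (q * r) x = eval_int_poly q x * eval_int_poly r x" by simp
  show "eval_int_poly (monom c n) x = of_int c * x ^ n"
    by (simp add: map_poly_monom poly_monom)
qed

lemma eval_int_poly_sum: "eval_int_poly (\<Sum>i\<in>I. q i) x = (\<Sum>i\<in>I. eval_int_poly (q i) x)"
  by (induction I rule: infinite_finite_induct) (simp_all only: sum.infinite sum.empty sum.insert eval_int_poly_simps not_False_eq_True)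

lemma sturm_fps_power_at: "fps_nth (sturm_fps_at \<omega> w ^ j) k = eval_int_poly (fps_nth (sturm_fps \<omega> ^ j) k) w"
proof (induction j arbitrary: k)
  case 0
  show ?case by simp
next
  case (Suc j)
  have "fps_nth (sturm_fps_at \<omega> w) i = eval_int_poly (fps_nth (sturm_fps \<omega>) i) w" for i
    by (simp add: sturm_fps_at_def sturm_fps_def eval_int_poly_simps poly_monom)
  then show ?case
    by (simp add: fps_mult_nth eval_int_poly_sum eval_int_poly_simps Suc)
qed

lemma fps_nth_aux_fps:
  "fps_nth (aux_fps N p \<omega>) k = (\<Sum>(j, a, b)\<in>{..N} \<times> {..N} \<times> {..N}.
     monom (p (j, a, b)) b * (if k < a then 0 else fps_nth (sturm_fps \<omega> ^ j) (k - a)))"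
  unfolding aux_fps_def fps_sum_nth
  by (intro sum.cong refl) (auto simp: fps_X_power_mult_nth)

lemma fps_nth_aux_fps_at':
  "fps_nth (aux_fps_at N p \<omega> w) k = (\<Sum>(j, a, b)\<in>{..N} \<times> {..N} \<times> {..N}.
     of_int (p (j, a, b)) * w ^ b * (if k < a then 0 else fps_nth (sturm_fps_at \<omega> w ^ j) (k - a)))"
  unfolding aux_fps_at_def fps_sum_nth
  by (intro sum.cong refl) (auto simp: fps_X_power_mult_nth)

lemma fps_nth_aux_fps_at: "fps_nth (aux_fps_at N p \<omega> w) k = eval_int_poly (fps_nth (aux_fps N p \<omega>) k) w"
  unfolding fps_nth_aux_fps fps_nth_aux_fps_at' eval_int_poly_sum
  by (intro sum.cong refl) (auto simp: eval_int_poly_simps sturm_fps_power_at poly_monom)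

text \<open>Follows from \<open>floor (i * \<omega>) <= i\<close>. The bound does not involve
  \<open>j\<close>, which keeps the number of linear conditions for the auxiliary polynomial
  small.\<close>

lemma degree_sturm_fps_power:
  assumes "0 < \<omega>" "\<omega> < 1"
  shows "degree (fps_nth (sturm_fps \<omega> ^ j) k) \<le> k"
proof (induction j arbitrary: k)
  case (Suc j)
  have 1: "degree (fps_nth (sturm_fps \<omega>) i) \<le> i" for i
  proof -
    have "real i * \<omega> \<le> real i * 1" using assms by (intro mult_left_mono) auto
    then have "\<lfloor>real i * \<omega>\<rfloor> \<le> int i" by linarith
    then have "nat \<lfloor>real i * \<omega>\<rfloor> \<le> i" by linarith
    then show ?thesis by (simp add: sturm_fps_def degree_monom_eq)
  qed
  have "degree (fps_nth (sturm_fps \<omega>) i * fps_nth (sturm_fps \<omega> ^ j) (k - i)) \<le> k" if "i \<le> k" for i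
    using degree_mult_le[of "fps_nth (sturm_fps \<omega>) i" "fps_nth (sturm_fps \<omega> ^ j) (k - i)"] 1[of i] Suc[of "k - i"] that
    by linarith
  then show ?case unfolding power_Suc fps_mult_nth by (intro degree_sum_le) simp_all
qed simp

lemma fps_nth_sturm_fps_power_cong:
  assumes "\<And>k. k < T \<Longrightarrow> \<lfloor>real k * \<omega>\<rfloor> = \<lfloor>real k * \<omega>'\<rfloor>" "k < T"
  shows "fps_nth (sturm_fps \<omega> ^ j) k = fps_nth (sturm_fps \<omega>' ^ j) k"
  using assms(2)
proof (induction j arbitrary: k)
  case (Suc j)
  have "fps_nth (sturm_fps \<omega>) i = fps_nth (sturm_fps \<omega>') i" if "i < T" for i
    using assms(1)[OF that] by (simp add: sturm_fps_def)
  then show ?case using Suc by (auto simp: fps_mult_nth intro!: sum.cong)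
qed simp

text \<open>This lets one polynomial, built for the limit tail, serve all tails close to it.\<close>

lemma fps_nth_aux_fps_cong:
  assumes "\<And>k. k < T \<Longrightarrow> \<lfloor>real k * \<omega>\<rfloor> = \<lfloor>real k * \<omega>'\<rfloor>" "k < T"
  shows "fps_nth (aux_fps N p \<omega>) k = fps_nth (aux_fps N p \<omega>') k"
  unfolding fps_nth_aux_fps
  using fps_nth_sturm_fps_power_cong[OF assms(1)] assms(2) by (intro sum.cong refl) auto

text \<open>The unknowns are the \<open>(N + 1)^3\<close> coefficients. Each of the first
  \<open>M\<close> coefficients in \<open>z\<close> is a polynomial in \<open>w\<close> of degree at
  most \<open>N + M\<close>, which makes \<open>M * (N + M + 1)\<close> linear equations.\<close>

lemma exists_aux_fps:
  assumes \<omega>: "0 < \<omega>" "\<omega> < 1" and M: "M * (N + M + 1) < (N + 1) ^ 3"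
  obtains p where "\<exists>i\<in>{..N} \<times> {..N} \<times> {..N}. p i \<noteq> 0" "\<And>k. k < M \<Longrightarrow> fps_nth (aux_fps N p \<omega>) k = 0"
proof -
  let ?I = "{..N} \<times> {..N} \<times> {..N}"
  define c where "c = (\<lambda>(k, e) (j, a, b). coeff (monom 1 b * (if k < a then 0 else fps_nth (sturm_fps \<omega> ^ j) (k - a))) e :: int)"
  have "card ({..<M} \<times> {..N + M}) < card ?I"
  proof -
    have "card ?I = (N + 1) ^ 3" by (simp add: card_cartesian_product power3_eq_cube)
    moreover have "card ({..<M} \<times> {..N + M}) = M * (N + M + 1)" by (simp add: card_cartesian_product)
    ultimately show ?thesis using M by simp
  qed
  then obtain p where p: "\<exists>i\<in>?I. p i \<noteq> 0" "\<And>e. e \<in> {..<M} \<times> {..N + M} \<Longrightarrow> (\<Sum>i\<in>?I. c e i * p i) = 0"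
    using homogeneous_system_nontrivial[of "{..<M} \<times> {..N + M}" ?I c] by auto
  have coeff_eq: "coeff (fps_nth (aux_fps N p \<omega>) k) e = (\<Sum>i\<in>?I. c (k, e) i * p i)" for k e
    unfolding fps_nth_aux_fps coeff_sum
  proof (intro sum.cong refl, clarify)
    fix j a b
    have "monom (p (j, a, b)) b = Polynomial.smult (p (j, a, b)) (monom 1 b)" by (simp add: smult_monom)
    then show "coeff (monom (p (j, a, b)) b * (if k < a then 0 else fps_nth (sturm_fps \<omega> ^ j) (k - a))) e
      = c (k, e) (j, a, b) * p (j, a, b)"
      by (simp add: c_def)
  qed
  have "fps_nth (aux_fps N p \<omega>) k = 0" if k: "k < M" for k
  proof (rule poly_eqI)
    fix e
    show "coeff (fps_nth (aux_fps N p \<omega>) k) e = coeff 0 e"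
    proof (cases "e \<le> N + M")
      case True
      then show ?thesis using p(2)[of "(k, e)"] k by (simp add: coeff_eq)
    next
      case False
      have "c (k, e) i = 0" if "i \<in> ?I" for i
      proof -
        obtain j a b where i: "i = (j, a, b)" "b \<le> N" using \<open>i \<in> ?I\<close> by auto
        have "degree (monom (1::int) b * fps_nth (sturm_fps \<omega> ^ j) (k - a)) \<le> b + (k - a)"
          using degree_mult_le[of "monom (1::int) b" "fps_nth (sturm_fps \<omega> ^ j) (k - a)"]
            degree_sturm_fps_power[OF \<omega>, of j "k - a"] degree_monom_le[of "1::int" b] by linarith
        then have "degree (monom (1::int) b * fps_nth (sturm_fps \<omega> ^ j) (k - a)) < e" using i k False by linarith
        then show ?thesis by (simp add: c_def i coeff_eq_0)
      qed
      then show ?thesis by (simp add: coeff_eq)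
    qed
  qed
  then show ?thesis using p(1) that by blast
qed

section \<open>Analytic bounds for the evaluated series\<close>

text \<open>The coefficient counts the compositions of \<open>k\<close> into \<open>j\<close>
  positive parts with weights at most 1; there are at most \<open>2 ^ k\<close> of them for every
  \<open>j\<close>.\<close>

lemma sturm_fps_power_at_bounds:
  assumes "0 \<le> w" "w \<le> 1"
  shows "0 \<le> fps_nth (sturm_fps_at \<omega> w ^ j) k \<and> fps_nth (sturm_fps_at \<omega> w ^ j) k \<le> 2 ^ k"
proof (induction j arbitrary: k)
  case 0
  show ?case by simp
next
  case (Suc j)
  let ?u = "fps_nth (sturm_fps_at \<omega> w)" and ?v = "fps_nth (sturm_fps_at \<omega> w ^ j)"
  have u: "0 \<le> ?u i" "?u i \<le> (if i = 0 then 0 else 1)" for i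
    using assms by (auto simp: sturm_fps_at_def power_le_one)
  have eq: "fps_nth (sturm_fps_at \<omega> w ^ Suc j) k = (\<Sum>i\<in>{0..k}. ?u i * ?v (k - i))"
    by (simp add: fps_mult_nth)
  have "(\<Sum>i\<in>{0..k}. ?u i * ?v (k - i)) \<le> (\<Sum>i\<in>{0..k}. (if i = 0 then 0 else 1) * 2 ^ (k - i))"
    using u Suc by (intro sum_mono mult_mono) (auto simp: if_splits)
  also have "\<dots> = 2 ^ k - 1"
  proof (induction k)
    case (Suc k)
    have "(\<Sum>i\<in>{0..Suc k}. (if i = 0 then 0 else 1) * 2 ^ (Suc k - i)) =
        1 + (\<Sum>i\<in>{0..k}. 2 * ((if i = 0 then 0 else 1) * 2 ^ (k - i) :: real))"
      by (auto simp: Suc_diff_le intro!: sum.cong)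
    also have "\<dots> = 1 + 2 * (\<Sum>i\<in>{0..k}. (if i = 0 then 0 else 1) * 2 ^ (k - i))"
      by (simp only: sum_distrib_left)
    finally show ?case unfolding Suc by simp
  qed simp
  also have "\<dots> \<le> 2 ^ k" by simp
  finally show ?case unfolding eq using u Suc by (auto intro!: sum_nonneg)
qed

definition aux_height :: "nat \<Rightarrow> (nat \<times> nat \<times> nat \<Rightarrow> int) \<Rightarrow> real" where
  "aux_height N p = (\<Sum>i\<in>{..N} \<times> {..N} \<times> {..N}. \<bar>of_int (p i)\<bar>)"

lemma aux_height_nonneg: "0 \<le> aux_height N p"
  unfolding aux_height_def by (intro sum_nonneg) auto

lemma abs_fps_nth_aux_fps_at_le:
  assumes w: "0 \<le> w" "w \<le> 1"
  shows "\<bar>fps_nth (aux_fps_at N p \<omega> w) k\<bar> \<le> aux_height N p * 2 ^ k"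
  unfolding fps_nth_aux_fps_at' aux_height_def sum_distrib_right
proof (rule order_trans[OF sum_abs], rule sum_mono, clarify)
  fix j a b
  let ?x = "if k < a then 0 else fps_nth (sturm_fps_at \<omega> w ^ j) (k - a)"
  have "\<bar>?x\<bar> \<le> 2 ^ k"
  proof (cases "k < a")
    case False
    have "fps_nth (sturm_fps_at \<omega> w ^ j) (k - a) \<le> 2 ^ (k - a)" using sturm_fps_power_at_bounds[OF w] by blast
    also have "\<dots> \<le> 2 ^ k" by (intro power_increasing) auto
    finally show ?thesis using sturm_fps_power_at_bounds[OF w, of \<omega> j "k - a"] False by simp
  qed simp
  moreover have "w ^ b \<le> 1" using w by (simp add: power_le_one)
  ultimately have "w ^ b * \<bar>?x\<bar> \<le> 1 * 2 ^ k" using w by (intro mult_mono) auto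
  then have "\<bar>real_of_int (p (j, a, b))\<bar> * (w ^ b * \<bar>?x\<bar>) \<le> \<bar>of_int (p (j, a, b))\<bar> * 2 ^ k"
    by (intro mult_left_mono) auto
  then show "\<bar>of_int (p (j, a, b)) * w ^ b * ?x\<bar> \<le> \<bar>of_int (p (j, a, b))\<bar> * 2 ^ k"
    using w by (simp add: abs_mult mult.assoc)
qed

text \<open>Because \<open>w ^ floor (k * \<omega>) <= w powr (k * \<omega> - 1)\<close>. The bound
  exceeds 1, and its value \<open>w powr - \<omega>\<close> is the point where the series will be
  made to blow up.\<close>

lemma fps_conv_radius_sturm_fps_at:
  assumes "0 < \<omega>" "0 < w" "w < 1"
  shows "ereal (w powr - \<omega>) \<le> fps_conv_radius (sturm_fps_at \<omega> w)"
  unfolding fps_conv_radius_def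
proof (rule conv_radius_geI_ex')
  fix r :: real assume r: "0 < r" "ereal r < ereal (w powr - \<omega>)"
  define s where "s = r * w powr \<omega>"
  have "w powr - \<omega> * w powr \<omega> = w powr (- \<omega> + \<omega>)" by (rule powr_add[symmetric])
  also have "\<dots> = 1" using assms by simp
  finally have 1: "w powr - \<omega> * w powr \<omega> = 1" .
  have "s < w powr - \<omega> * w powr \<omega>"
    unfolding s_def using r assms by (intro mult_strict_right_mono) auto
  then have s: "0 < s" "s < 1" using r assms unfolding 1 by (simp_all add: s_def)
  have bd: "norm (fps_nth (sturm_fps_at \<omega> w) k * of_real r ^ k) \<le> (1 / w) * s ^ k" for k
  proof (cases "k = 0")
    case False
    have "0 \<le> \<lfloor>real k * \<omega>\<rfloor>" using assms by simp
    then have "real k * \<omega> - 1 \<le> real (nat \<lfloor>real k * \<omega>\<rfloor>)"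
      using real_of_int_floor_gt_diff_one[of "real k * \<omega>"] by simp
    then have "w powr real (nat \<lfloor>real k * \<omega>\<rfloor>) \<le> w powr (real k * \<omega> - 1)"
      using assms by (intro powr_mono') auto
    moreover have "w powr real (nat \<lfloor>real k * \<omega>\<rfloor>) = w ^ nat \<lfloor>real k * \<omega>\<rfloor>"
      using assms by (intro powr_realpow) auto
    moreover have "w powr (real k * \<omega> - 1) = (1 / w) * (w powr \<omega>) ^ k"
    proof -
      have "(w powr \<omega>) ^ k = (w powr \<omega>) powr real k" using assms by (intro powr_realpow[symmetric]) auto
      also have "\<dots> = w powr (real k * \<omega>)" by (simp add: powr_powr mult.commute)
      finally show ?thesis using assms by (simp add: powr_diff)
    qed
    ultimately have "w ^ nat \<lfloor>real k * \<omega>\<rfloor> * r ^ k \<le> (1 / w) * (w powr \<omega>) ^ k * r ^ k"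
      using r by (intro mult_right_mono) auto
    also have "\<dots> = (1 / w) * s ^ k" by (simp add: s_def power_mult_distrib)
    finally show ?thesis using False assms r
      by (simp add: sturm_fps_at_def abs_mult)
  qed (use assms in \<open>simp add: sturm_fps_at_def\<close>)
  have "summable (\<lambda>k. s ^ k)" using s by (intro summable_geometric) simp
  then have "summable (\<lambda>k. (1 / w) * s ^ k)" by (rule summable_mult)
  then show "summable (\<lambda>k. fps_nth (sturm_fps_at \<omega> w) k * of_real r ^ k)"
    by (rule summable_comparison_test'[where N = 0]) (rule bd)
qed

lemma sturm_series_eq_eval_fps: "eval_fps (sturm_fps_at \<omega> w) z = sturm_series \<omega> z w"
  by (simp add: eval_fps_def sturm_fps_at_def sturm_series_def)

text \<open>Radius and value go through one induction, since additivity of \<open>eval_fps\<close>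
  requires the radius of the partial sum.\<close>

lemma eval_fps_sum:
  fixes f :: "'i \<Rightarrow> 'a :: {banach, real_normed_div_algebra, comm_ring_1} fps"
  assumes "finite I" "\<And>i. i \<in> I \<Longrightarrow> R \<le> fps_conv_radius (f i)" "ereal (norm z) < R"
  shows "R \<le> fps_conv_radius (\<Sum>i\<in>I. f i) \<and> eval_fps (\<Sum>i\<in>I. f i) z = (\<Sum>i\<in>I. eval_fps (f i) z)"
  using assms
proof (induction I rule: finite_induct)
  case (insert x F)
  then have IH: "R \<le> fps_conv_radius (\<Sum>i\<in>F. f i)" "eval_fps (\<Sum>i\<in>F. f i) z = (\<Sum>i\<in>F. eval_fps (f i) z)"
    and x: "R \<le> fps_conv_radius (f x)" by auto
  have "R \<le> min (fps_conv_radius (f x)) (fps_conv_radius (\<Sum>i\<in>F. f i))" using IH x by simp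
  also have "\<dots> \<le> fps_conv_radius (f x + (\<Sum>i\<in>F. f i))" by (rule fps_conv_radius_add)
  finally have "R \<le> fps_conv_radius (f x + (\<Sum>i\<in>F. f i))" .
  moreover have "eval_fps (f x + (\<Sum>i\<in>F. f i)) z = eval_fps (f x) z + eval_fps (\<Sum>i\<in>F. f i) z"
    using insert.prems IH x by (intro eval_fps_add) (auto intro: less_le_trans)
  ultimately show ?case using insert.hyps IH by simp
qed simp

lemma aux_fps_at_sums:
  assumes \<omega>: "0 < \<omega>" and w: "0 < w" "w < 1" and z: "0 \<le> z" "z < w powr - \<omega>"
  shows "(\<lambda>k. fps_nth (aux_fps_at N p \<omega> w) k * z ^ k) sums aux_value N p z w (sturm_series \<omega> z w)"
proof -
  let ?R = "ereal (w powr - \<omega>)"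
  let ?u = "sturm_fps_at \<omega> w"
  have u: "?R \<le> fps_conv_radius ?u" by (rule fps_conv_radius_sturm_fps_at[OF \<omega> w])
  have nz: "ereal (norm z) < ?R" using z by simp
  have lt: "ereal (norm z) < fps_conv_radius ?u" using nz u by (rule less_le_trans)
  have uj: "?R \<le> fps_conv_radius (?u ^ j)" for j
    using u fps_conv_radius_power order_trans by blast
  have ltj: "ereal (norm z) < fps_conv_radius (?u ^ j)" for j using nz uj by (rule less_le_trans)
  have xu: "?R \<le> fps_conv_radius (fps_X ^ a * ?u ^ j)" for a j
    using fps_conv_radius_mult[of "fps_X ^ a" "?u ^ j"] uj[of j] by (auto simp: min_def intro: order_trans)
  have ltx: "ereal (norm z) < fps_conv_radius (fps_X ^ a * ?u ^ j)" for a j using nz xu by (rule less_le_trans)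
  have tm: "?R \<le> fps_conv_radius (fps_const c * (fps_X ^ a * ?u ^ j))" for c a j
    using fps_conv_radius_mult[of "fps_const c" "fps_X ^ a * ?u ^ j"] xu[of a j] by (auto simp: min_def intro: order_trans)
  have ev: "eval_fps (fps_const c * (fps_X ^ a * ?u ^ j)) z = c * (z ^ a * sturm_series \<omega> z w ^ j)" for c a j
    using lt ltj ltx by (simp add: eval_fps_mult eval_fps_power sturm_series_eq_eval_fps)
  let ?f = "\<lambda>(j, a, b). fps_const (of_int (p (j, a, b)) * w ^ b) * (fps_X ^ a * ?u ^ j)"
  have "?R \<le> fps_conv_radius (aux_fps_at N p \<omega> w) \<and>
      eval_fps (aux_fps_at N p \<omega> w) z = (\<Sum>i\<in>{..N} \<times> {..N} \<times> {..N}. eval_fps (?f i) z)"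
    unfolding aux_fps_at_def by (rule eval_fps_sum[OF _ _ nz]) (auto simp: tm)
  moreover have "(\<Sum>i\<in>{..N} \<times> {..N} \<times> {..N}. eval_fps (?f i) z) = aux_value N p z w (sturm_series \<omega> z w)"
    unfolding aux_value_def by (intro sum.cong refl) (auto simp: ev)
  ultimately have R: "?R \<le> fps_conv_radius (aux_fps_at N p \<omega> w)"
    and e: "eval_fps (aux_fps_at N p \<omega> w) z = aux_value N p z w (sturm_series \<omega> z w)" by auto
  have "summable (\<lambda>k. fps_nth (aux_fps_at N p \<omega> w) k * z ^ k)"
    using R nz by (intro summable_fps) (rule less_le_trans)
  then show ?thesis unfolding e[symmetric] eval_fps_def by (rule summable_sums)
qed

text \<open>The tail is dominated by a geometric series of ratio \<open>2 * z <= 1 / 2\<close>. The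
  bound is uniform in \<omega> and \<open>w\<close>, so it can be used along a sequence in which
  both vary.\<close>

lemma aux_value_approx:
  assumes \<omega>: "0 < \<omega>" and w: "0 < w" "w < 1" and z: "0 \<le> z" "z \<le> 1 / 4"
  shows "\<bar>aux_value N p z w (sturm_series \<omega> z w) - (\<Sum>k<T. fps_nth (aux_fps_at N p \<omega> w) k * z ^ k)\<bar>
    \<le> 2 * aux_height N p * (2 * z) ^ T"
proof -
  let ?c = "\<lambda>k. fps_nth (aux_fps_at N p \<omega> w) k * z ^ k"
  have "1 < w powr - \<omega>" using \<omega> w powr_less_mono'[of w "- \<omega>" 0] by simp
  then have s: "?c sums aux_value N p z w (sturm_series \<omega> z w)"
    using z by (intro aux_fps_at_sums[OF \<omega> w]) auto
  then have s': "(\<lambda>k. ?c (k + T)) sums (aux_value N p z w (sturm_series \<omega> z w) - (\<Sum>k<T. ?c k))"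
    by (rule sums_split_initial_segment)
  have bd: "\<bar>?c (k + T)\<bar> \<le> aux_height N p * (2 * z) ^ T * (2 * z) ^ k" for k
  proof -
    have "\<bar>?c (k + T)\<bar> \<le> aux_height N p * 2 ^ (k + T) * z ^ (k + T)"
      using abs_fps_nth_aux_fps_at_le[of w N p \<omega> "k + T"] w z
      by (auto simp: abs_mult intro!: mult_right_mono)
    then show ?thesis by (simp add: power_add power_mult_distrib mult_ac)
  qed
  have g: "(\<lambda>k. aux_height N p * (2 * z) ^ T * (2 * z) ^ k) sums (aux_height N p * (2 * z) ^ T * (1 / (1 - 2 * z)))"
    using z by (intro sums_mult geometric_sums) auto
  have "\<bar>aux_value N p z w (sturm_series \<omega> z w) - (\<Sum>k<T. ?c k)\<bar> \<le> aux_height N p * (2 * z) ^ T * (1 / (1 - 2 * z))"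
  proof -
    have "norm (\<Sum>k. ?c (k + T)) \<le> (\<Sum>k. aux_height N p * (2 * z) ^ T * (2 * z) ^ k)"
      using bd g by (intro norm_suminf_le) (auto simp: sums_iff)
    then show ?thesis using s' g by (simp add: sums_iff)
  qed
  also have "\<dots> \<le> aux_height N p * (2 * z) ^ T * 2"
    using z aux_height_nonneg[of N p] by (intro mult_left_mono) (auto simp: field_simps)
  finally show ?thesis by (simp add: mult_ac)
qed

text \<open>Now \<open>w ^ floor (k * \<omega>) >= w powr (k * \<omega>)\<close>, so the term of
  index \<open>k\<close> is at least \<open>s ^ k\<close>.\<close>

lemma sturm_series_unbounded:
  assumes \<omega>: "0 < \<omega>" and w: "0 < w" "w < 1" and s: "0 < s" "s < 1"
  shows "s / (1 - s) \<le> sturm_series \<omega> (s * w powr - \<omega>) w"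
proof -
  define z where "z = s * w powr - \<omega>"
  have z: "0 < z" "z < w powr - \<omega>" using s w by (simp_all add: z_def)
  have zw: "z * w powr \<omega> = s" using w by (simp add: z_def powr_minus)
  let ?f = "\<lambda>k. fps_nth (sturm_fps_at \<omega> w) k * z ^ k"
  have "ereal (norm z) < ereal (w powr - \<omega>)" using z by simp
  then have "ereal (norm z) < fps_conv_radius (sturm_fps_at \<omega> w)"
    using fps_conv_radius_sturm_fps_at[OF \<omega> w] by (rule less_le_trans)
  then have "summable ?f" by (rule summable_fps)
  then have "?f sums (\<Sum>k. ?f k)" by (rule summable_sums)
  then have f: "?f sums sturm_series \<omega> z w"
    unfolding sturm_series_eq_eval_fps[symmetric] eval_fps_def .
  have "(\<lambda>k. ?f (Suc k)) sums (sturm_series \<omega> z w - ?f 0)" using f by (subst sums_Suc_iff) simp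
  then have f': "(\<lambda>k. ?f (Suc k)) sums sturm_series \<omega> z w" by (simp add: sturm_fps_at_def)
  have g: "(\<lambda>k. s * s ^ k) sums (s * (1 / (1 - s)))"
    using s by (intro sums_mult geometric_sums) simp
  have le: "s * s ^ k \<le> ?f (Suc k)" for k
  proof -
    have "0 \<le> \<lfloor>real (Suc k) * \<omega>\<rfloor>" using \<omega> by simp
    then have "real (nat \<lfloor>real (Suc k) * \<omega>\<rfloor>) \<le> real (Suc k) * \<omega>" by simp
    then have "w powr (real (Suc k) * \<omega>) \<le> w powr real (nat \<lfloor>real (Suc k) * \<omega>\<rfloor>)"
      using w by (intro powr_mono') auto
    also have "\<dots> = w ^ nat \<lfloor>real (Suc k) * \<omega>\<rfloor>" using w by (intro powr_realpow)
    finally have le: "w powr (real (Suc k) * \<omega>) \<le> w ^ nat \<lfloor>real (Suc k) * \<omega>\<rfloor>" .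
    have "(w powr \<omega>) ^ Suc k = (w powr \<omega>) powr real (Suc k)" using w by (intro powr_realpow[symmetric]) simp
    also have "\<dots> = w powr (real (Suc k) * \<omega>)" by (simp only: powr_powr mult.commute)
    finally have "s ^ Suc k = w powr (real (Suc k) * \<omega>) * z ^ Suc k"
      unfolding zw[symmetric] power_mult_distrib by (simp only: mult.commute)
    also have "\<dots> \<le> w ^ nat \<lfloor>real (Suc k) * \<omega>\<rfloor> * z ^ Suc k" using le z by (intro mult_right_mono) auto
    finally show ?thesis by (simp add: sturm_fps_at_def del: of_nat_Suc)
  qed
  have "s * (1 / (1 - s)) \<le> sturm_series \<omega> z w" by (rule sums_le[OF le g f'])
  then show ?thesis by (simp add: z_def)
qed

lemma linear_form_inj:
  fixes \<theta> :: real
  assumes "\<theta> \<notin> \<rat>" "real a * \<theta> + real b = real a' * \<theta> + real b'"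
  shows "a = a' \<and> b = b'"
proof -
  have "(real a - real a') * \<theta> = real b' - real b" using assms(2) by (simp add: algebra_simps)
  moreover have "a = a'"
  proof (rule ccontr)
    assume "a \<noteq> a'"
    then have "\<theta> = (real b' - real b) / (real a - real a')" using calculation by (simp add: field_simps)
    then show False using assms(1) by (simp add: Rats_diff Rats_divide)
  qed
  ultimately show ?thesis by simp
qed

text \<open>Along \<open>z \<rightarrow> w powr -\<omega>\<close> the Sturmian series blows up, so the leading coefficient of a polynomial relation
  would vanish on that curve, where the monomials have pairwise distinct growth.\<close>

theorem aux_fps_nonzero:
  assumes \<omega>: "0 < \<omega>" and irr: "\<omega> \<notin> \<rat>" and p: "\<exists>i\<in>{..N} \<times> {..N} \<times> {..N}. p i \<noteq> 0"
  shows "\<exists>k. fps_nth (aux_fps N p \<omega>) k \<noteq> 0"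
proof (rule ccontr)
  assume "\<not> ?thesis"
  then have zero: "fps_nth (aux_fps_at N p \<omega> w) k = 0" for w k
    by (simp add: fps_nth_aux_fps_at)
  have value0: "aux_value N p z w (sturm_series \<omega> z w) = 0" if "0 < w" "w < 1" "0 \<le> z" "z < w powr - \<omega>" for z w
  proof -
    have "(\<lambda>k. 0) sums aux_value N p z w (sturm_series \<omega> z w)"
      using aux_fps_at_sums[OF \<omega> that, of N p] by (simp add: zero)
    then show ?thesis by (rule sums_unique2[OF _ sums_zero])
  qed
  define P where "P j z w = (\<Sum>(a, b)\<in>{..N} \<times> {..N}. of_int (p (j, a, b)) * w ^ b * z ^ a)" for j and z w :: real
  have av: "aux_value N p z w u = (\<Sum>j\<le>N. P j z w * u ^ j)" for z w u
    unfolding aux_value_def P_def sum.cartesian_product[symmetric] sum_distrib_right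
    by (simp add: mult_ac)
  define J where "J = Max {j. j \<le> N \<and> (\<exists>a\<le>N. \<exists>b\<le>N. p (j, a, b) \<noteq> 0)}"
  have fin: "finite {j. j \<le> N \<and> (\<exists>a\<le>N. \<exists>b\<le>N. p (j, a, b) \<noteq> 0)}" by simp
  have ne: "{j. j \<le> N \<and> (\<exists>a\<le>N. \<exists>b\<le>N. p (j, a, b) \<noteq> 0)} \<noteq> {}" using p by auto
  have J: "J \<le> N" "\<exists>a\<le>N. \<exists>b\<le>N. p (J, a, b) \<noteq> 0"
    using Max_in[OF fin ne] unfolding J_def[symmetric] by auto
  have above: "P j z w = 0" if "J < j" "j \<le> N" for j z w
  proof -
    have "p (j, a, b) = 0" if "a \<le> N" "b \<le> N" for a b
    proof (rule ccontr)
      assume "p (j, a, b) \<noteq> 0"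
      then have "j \<le> J" unfolding J_def using that \<open>j \<le> N\<close> by (intro Max_ge[OF fin]) auto
      then show False using \<open>J < j\<close> by simp
    qed
    then show ?thesis unfolding P_def by (intro sum.neutral) auto
  qed
  have lead: "P J (w powr - \<omega>) w = 0" if w: "0 < w" "w < 1" for w
  proof -
    \<comment> \<open>Chosen so that \<open>s n / (1 - s n) = Suc n\<close>, which makes
      \<open>u n\<close> at least \<open>Suc n\<close>. Dividing the relation by
      \<open>u n ^ J\<close> then isolates the leading coefficient in the limit.\<close>
    define s where "s n = real (Suc n) / real (Suc (Suc n))" for n
    define z where "z n = s n * w powr - \<omega>" for n
    define u where "u n = sturm_series \<omega> (z n) w" for n
    have s: "0 < s n" "s n < 1" for n by (simp_all add: s_def)
    have z: "0 \<le> z n" "z n < w powr - \<omega>" for n using s[of n] w by (simp_all add: z_def)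
    have u: "real (Suc n) \<le> u n" for n
    proof -
      have "s n / (1 - s n) = real (Suc n)" by (simp add: s_def field_simps)
      then show ?thesis using sturm_series_unbounded[OF \<omega> w s[of n]] by (simp only: u_def z_def)
    qed
    have rel: "P J (z n) w = - (\<Sum>j<J. P j (z n) w * (u n ^ j / u n ^ J))" for n
    proof -
      have u0: "u n > 0" using u[of n] by simp
      have "0 = (\<Sum>j\<le>N. P j (z n) w * u n ^ j)"
        using value0[OF w z] unfolding av u_def by simp
      also have "\<dots> = (\<Sum>j\<le>J. P j (z n) w * u n ^ j)"
        using J(1) above by (intro sum.mono_neutral_right) auto
      also have "\<dots> = (\<Sum>j<J. P j (z n) w * u n ^ j) + P J (z n) w * u n ^ J"
        by (simp flip: lessThan_Suc_atMost)
      finally have "P J (z n) w * u n ^ J = - (\<Sum>j<J. P j (z n) w * u n ^ j)" by simp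
      then have "P J (z n) w = - (\<Sum>j<J. P j (z n) w * u n ^ j) / u n ^ J"
      proof -
        have "u n ^ J \<noteq> 0" using u0 by simp
        then have "P J (z n) w = P J (z n) w * u n ^ J / u n ^ J" by simp
        then show ?thesis using \<open>P J (z n) w * u n ^ J = _\<close> by simp
      qed
      then show ?thesis by (simp add: sum_divide_distrib)
    qed
    have bound: "norm (P J (z n) w) \<le> (\<Sum>j<J. \<bar>P j (z n) w\<bar>) * (1 / real (Suc n))" for n
    proof -
      have "norm (P J (z n) w) \<le> (\<Sum>j<J. \<bar>P j (z n) w * (u n ^ j / u n ^ J)\<bar>)"
        unfolding rel real_norm_def abs_minus_cancel by (rule sum_abs)
      also have "\<dots> \<le> (\<Sum>j<J. \<bar>P j (z n) w\<bar> * (1 / real (Suc n)))"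
      proof (rule sum_mono)
        fix j assume j: "j \<in> {..<J}"
        have u1: "1 \<le> u n" using u[of n] by simp
        have "real (Suc n) * u n ^ j \<le> u n * u n ^ j" using u[of n] u1 by (intro mult_right_mono) auto
        also have "\<dots> = u n ^ Suc j" by simp
        also have "\<dots> \<le> u n ^ J" using j u1 by (intro power_increasing) auto
        finally have "u n ^ j / u n ^ J \<le> 1 / real (Suc n)"
          using u1 by (simp add: field_simps)
        then have "\<bar>u n ^ j / u n ^ J\<bar> \<le> 1 / real (Suc n)" using u1 by simp
        then show "\<bar>P j (z n) w * (u n ^ j / u n ^ J)\<bar> \<le> \<bar>P j (z n) w\<bar> * (1 / real (Suc n))"
          unfolding abs_mult by (intro mult_left_mono) auto
      qed
      finally show ?thesis unfolding sum_distrib_right .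
    qed
    have "(\<lambda>n. real (Suc n) / real (Suc (Suc n))) \<longlonglongrightarrow> 1"
      using LIMSEQ_Suc[OF LIMSEQ_n_over_Suc_n[where 'a = real]] by simp
    then have zlim: "z \<longlonglongrightarrow> 1 * w powr - \<omega>"
      unfolding z_def[abs_def] s_def by (intro tendsto_mult tendsto_const)
    have Plim: "(\<lambda>n. P j (z n) w) \<longlonglongrightarrow> P j (1 * w powr - \<omega>) w" for j
      unfolding P_def split_def by (intro tendsto_sum tendsto_mult tendsto_const tendsto_power zlim)
    have "(\<lambda>n. (\<Sum>j<J. \<bar>P j (z n) w\<bar>) * (1 / real (Suc n))) \<longlonglongrightarrow> (\<Sum>j<J. \<bar>P j (1 * w powr - \<omega>) w\<bar>) * 0"
      using LIMSEQ_inverse_real_of_nat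
      by (intro tendsto_mult tendsto_sum tendsto_rabs Plim) (simp add: inverse_eq_divide)
    then have "(\<lambda>n. (\<Sum>j<J. \<bar>P j (z n) w\<bar>) * (1 / real (Suc n))) \<longlonglongrightarrow> 0" by simp
    then have "(\<lambda>n. P J (z n) w) \<longlonglongrightarrow> 0"
      by (rule Lim_null_comparison[OF always_eventually[OF allI[OF bound]]])
    then show ?thesis using LIMSEQ_unique[OF Plim[of J]] by simp
  qed
  \<comment> \<open>On the curve, \<open>w ^ b * z ^ a\<close> is
    \<open>w powr (b - a * \<omega>)\<close>. These exponents are distinct as \<omega> is
    irrational, and the smallest one dominates when \<open>w\<close> tends to 0.\<close>
  define S where "S = {(a, b). a \<le> N \<and> b \<le> N \<and> p (J, a, b) \<noteq> 0}"
  have "S \<subseteq> {..N} \<times> {..N}" by (auto simp: S_def)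
  then have finS: "finite S" by (rule finite_subset) simp
  have "S \<noteq> {}" using J(2) by (auto simp: S_def)
  let ?f = "\<lambda>x. real (snd x) - real (fst x) * \<omega>"
  have "Min (?f ` S) \<in> ?f ` S" using finS \<open>S \<noteq> {}\<close> by (intro Min_in) auto
  then obtain ab where ab: "ab \<in> S" "Min (?f ` S) = ?f ab" by (rule imageE)
  have min: "?f ab \<le> ?f x" if "x \<in> S" for x
    unfolding ab(2)[symmetric] using finS that by (intro Min_le) auto
  obtain a0 b0 where ab0: "ab = (a0, b0)" by (cases ab)
  define e where "e a b = (real b - real a * \<omega>) - (real b0 - real a0 * \<omega>)" for a b
  have e_pos: "e a b > 0" if "(a, b) \<in> S" "(a, b) \<noteq> (a0, b0)" for a b
  proof -
    have "e a b \<ge> 0" using min[OF that(1)] by (simp add: e_def ab0)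
    moreover have "e a b \<noteq> 0"
    proof
      assume "e a b = 0"
      then have "real a0 * \<omega> + real b = real a * \<omega> + real b0" by (simp add: e_def)
      then show False using linear_form_inj[OF irr] that(2) by blast
    qed
    ultimately show ?thesis by simp
  qed
  define w where "w n = 1 / real (Suc (Suc n))" for n
  have w: "0 < w n" "w n < 1" for n by (simp_all add: w_def)
  have wlim: "w \<longlonglongrightarrow> 0"
    unfolding w_def[abs_def] using LIMSEQ_Suc[OF LIMSEQ_inverse_real_of_nat] by (simp add: inverse_eq_divide)
  have sum0: "(\<Sum>(a, b)\<in>S. of_int (p (J, a, b)) * w n powr e a b) = 0" for n
  proof -
    have t: "w n ^ b * (w n powr - \<omega>) ^ a = w n powr e a b * w n powr (real b0 - real a0 * \<omega>)" for a b
    proof -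
      have "w n ^ b = w n powr real b" using w by (intro powr_realpow[symmetric])
      moreover have "(w n powr - \<omega>) ^ a = (w n powr - \<omega>) powr real a" using w[of n] by (intro powr_realpow[symmetric]) simp
      moreover have "real b + - \<omega> * real a = e a b + (real b0 - real a0 * \<omega>)" by (simp add: e_def)
      ultimately show ?thesis by (simp only: powr_powr powr_add[symmetric])
    qed
    have "0 = (\<Sum>(a, b)\<in>{..N} \<times> {..N}. of_int (p (J, a, b)) * (w n ^ b * (w n powr - \<omega>) ^ a))"
      using lead[OF w] by (simp add: P_def mult.assoc)
    also have "\<dots> = (\<Sum>(a, b)\<in>S. of_int (p (J, a, b)) * (w n ^ b * (w n powr - \<omega>) ^ a))"
      by (intro sum.mono_neutral_right) (auto simp: S_def)
    also have "\<dots> = (\<Sum>(a, b)\<in>S. of_int (p (J, a, b)) * w n powr e a b) * w n powr (real b0 - real a0 * \<omega>)"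
      unfolding t sum_distrib_right by (intro sum.cong refl) auto
    finally show ?thesis using w[of n] by simp
  qed
  have "(\<lambda>n. \<Sum>(a, b)\<in>S. of_int (p (J, a, b)) * w n powr e a b)
    \<longlonglongrightarrow> (\<Sum>(a, b)\<in>S. of_int (p (J, a, b)) * (if (a, b) = (a0, b0) then 1 else 0))"
    unfolding split_def
  proof (intro tendsto_sum tendsto_mult tendsto_const)
    fix x assume x: "x \<in> S"
    show "(\<lambda>n. w n powr e (fst x) (snd x)) \<longlonglongrightarrow> (if (fst x, snd x) = (a0, b0) then 1 else 0)"
    proof (cases "(fst x, snd x) = (a0, b0)")
      case True
      then show ?thesis using w less_imp_neq[OF w(1)] by (simp add: e_def)
    next
      case False
      then have "0 < e (fst x) (snd x)" using x by (intro e_pos) auto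
      then have "(\<lambda>n. w n powr e (fst x) (snd x)) \<longlonglongrightarrow> 0 powr e (fst x) (snd x)"
        using w by (intro tendsto_powr' wlim tendsto_const) (auto intro: always_eventually less_imp_le)
      then show ?thesis using False by simp
    qed
  qed
  moreover have "(\<Sum>(a, b)\<in>S. of_int (p (J, a, b)) * (if (a, b) = (a0, b0) then 1 else 0)) = (of_int (p (J, a0, b0)) :: real)"
  proof -
    have "(\<Sum>(a, b)\<in>S. of_int (p (J, a, b)) * (if (a, b) = (a0, b0) then 1 else 0))
      = (\<Sum>x\<in>S. if x = (a0, b0) then of_int (p (J, a0, b0)) else (0::real))"
      by (intro sum.cong refl) (auto split: if_splits)
    then show ?thesis using finS ab(1) ab0 by simp
  qed
  ultimately have "(\<lambda>n. 0::real) \<longlonglongrightarrow> of_int (p (J, a0, b0))" by (simp add: sum0)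
  then have "real_of_int (p (J, a0, b0)) = 0" by (simp add: LIMSEQ_const_iff)
  then show False using ab(1) ab0 by (simp add: S_def)
qed

section \<open>Nonvanishing of the auxiliary values\<close>

text \<open>For \<open>k > 0\<close> the number \<open>k * \<omega>\<close> is not an integer, so
  its floor is locally constant; only finitely many \<open>k\<close> are involved.\<close>

lemma eventually_floor_mult_eq:
  assumes lim: "om \<longlonglongrightarrow> \<omega>" and irr: "\<omega> \<notin> \<rat>"
  shows "\<forall>\<^sub>F i in sequentially. \<forall>k<T. \<lfloor>real k * om i\<rfloor> = \<lfloor>real k * \<omega>\<rfloor>"
proof -
  have "\<forall>\<^sub>F i in sequentially. \<lfloor>real k * om i\<rfloor> = \<lfloor>real k * \<omega>\<rfloor>" for k
  proof (cases "k = 0")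
    case False
    have l: "(\<lambda>i. real k * om i) \<longlonglongrightarrow> real k * \<omega>" by (intro tendsto_mult tendsto_const lim)
    have "of_int \<lfloor>real k * \<omega>\<rfloor> \<le> real k * \<omega>" by simp
    moreover have "real k * \<omega> \<noteq> of_int \<lfloor>real k * \<omega>\<rfloor>"
      using False by (intro irrational_mult_nat_neq_int irr) simp
    ultimately have "of_int \<lfloor>real k * \<omega>\<rfloor> < real k * \<omega>" by (metis order_le_less)
    then have "\<forall>\<^sub>F i in sequentially. of_int \<lfloor>real k * \<omega>\<rfloor> < real k * om i" by (rule order_tendstoD(1)[OF l])
    moreover have "real k * \<omega> < of_int \<lfloor>real k * \<omega>\<rfloor> + 1" by simp
    then have "\<forall>\<^sub>F i in sequentially. real k * om i < of_int \<lfloor>real k * \<omega>\<rfloor> + 1" by (rule order_tendstoD(2)[OF l])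
    ultimately show ?thesis
    proof eventually_elim
      case (elim i)
      then show ?case by (intro floor_unique) auto
    qed
  qed simp
  then have "\<forall>\<^sub>F i in sequentially. \<forall>k\<in>{..<T}. \<lfloor>real k * om i\<rfloor> = \<lfloor>real k * \<omega>\<rfloor>"
    by (intro eventually_ball_finite) auto
  then show ?thesis by (rule eventually_mono) simp
qed

text \<open>With \<open>z\<close> close to \<open>w powr \<theta>\<close> in exponent, the monomial
  \<open>z ^ k * w ^ e\<close> has weight \<open>k * \<theta> + e\<close>. Irrationality of \<theta>
  makes the minimal weight among the nonzero coefficients unique, and its term dominates as
  \<open>w\<close> tends to 0.\<close>

lemma eventually_aux_value_nonzero:
  assumes om: "om \<longlonglongrightarrow> \<omega>" "\<omega> \<notin> \<rat>" "\<And>i. 0 < om i"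
    and th: "th \<longlonglongrightarrow> \<theta>" "\<theta> \<notin> \<rat>" "0 < \<theta>"
    and w: "w \<longlonglongrightarrow> 0" "\<And>i. 0 < w i" "\<And>i. w i < 1"
    and z: "\<And>i. z i = w i powr th i"
    and nz: "fps_nth (aux_fps N p \<omega>) k1 \<noteq> 0"
  shows "\<forall>\<^sub>F i in sequentially. aux_value N p (z i) (w i) (sturm_series (om i) (z i) (w i)) \<noteq> 0"
proof -
  define c where "c k e = coeff (fps_nth (aux_fps N p \<omega>) k) e" for k e
  obtain e1 where e1: "c k1 e1 \<noteq> 0" using nz by (auto simp: poly_eq_iff c_def)
  define val where "val k e = real k * \<theta> + real e" for k e
  \<comment> \<open>There may be infinitely many nonzero coefficients, but only finitely many have
    weight at most that of the given one, so a minimum exists.\<close>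
  define V where "V = {(k, e). c k e \<noteq> 0 \<and> val k e \<le> val k1 e1}"
  obtain K :: nat where K: "val k1 e1 < real K * \<theta>"
    using reals_Archimedean3[OF th(3)] by blast
  have "V \<subseteq> {..K} \<times> {..nat \<lceil>val k1 e1\<rceil>}"
  proof clarify
    fix k e assume ke: "(k, e) \<in> V"
    then have v: "real k * \<theta> + real e \<le> val k1 e1" by (simp add: V_def val_def)
    have "0 \<le> real k * \<theta>" using th by simp
    then have "real e \<le> val k1 e1" using v by linarith
    then have "e \<le> nat \<lceil>val k1 e1\<rceil>" by linarith
    moreover have "real k * \<theta> < real K * \<theta>" using v K by linarith
    then have "k \<le> K" using th(3) by simp
    ultimately show "k \<in> {..K} \<and> e \<in> {..nat \<lceil>val k1 e1\<rceil>}" by simp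
  qed
  then have finV: "finite V" by (rule finite_subset) simp
  have "(k1, e1) \<in> V" using e1 by (simp add: V_def)
  let ?f = "\<lambda>x. val (fst x) (snd x)"
  have "Min (?f ` V) \<in> ?f ` V" using finV \<open>(k1, e1) \<in> V\<close> by (intro Min_in) auto
  then obtain x0 where x0: "x0 \<in> V" "Min (?f ` V) = ?f x0" by (rule imageE)
  obtain k0 e0 where ke0: "x0 = (k0, e0)" by (cases x0)
  have c0: "c k0 e0 \<noteq> 0" and v0: "val k0 e0 \<le> val k1 e1" using x0(1) by (simp_all add: V_def ke0)
  have min: "val k0 e0 \<le> val k e" if "c k e \<noteq> 0" for k e
  proof (cases "val k e \<le> val k1 e1")
    case True
    then have "(k, e) \<in> V" using that by (simp add: V_def)
    then have "Min (?f ` V) \<le> ?f (k, e)" using finV by (intro Min_le finite_imageI imageI)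
    then show ?thesis using x0(2) ke0 by simp
  next
    case False
    then show ?thesis using v0 by simp
  qed
  have strict: "val k0 e0 < val k e" if "c k e \<noteq> 0" "(k, e) \<noteq> (k0, e0)" for k e
  proof -
    have "val k0 e0 \<noteq> val k e"
      using linear_form_inj[OF th(2), of k0 e0 k e] that(2) unfolding val_def by auto
    then show ?thesis using min[OF that(1)] by simp
  qed
  have k0K: "k0 < K"
  proof -
    have "real k0 * \<theta> \<le> val k0 e0" by (simp add: val_def)
    then have "real k0 * \<theta> < real K * \<theta>" using v0 K by linarith
    then show ?thesis using th(3) by simp
  qed
  define D where "D k = degree (fps_nth (aux_fps N p \<omega>) k)" for k
  define I where "I = Sigma {..<K} (\<lambda>k. {..D k})"
  have finI: "finite I" by (simp add: I_def)
  have mem0: "(k0, e0) \<in> I" using k0K c0 by (auto simp: I_def D_def c_def intro: le_degree)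
  \<comment> \<open>Exponents relative to the dominant monomial, formed with the current
    \<open>th i\<close> instead of its limit. After division by \<open>g i\<close> the dominant term
    is exactly \<open>c k0 e0\<close>, and for the others only the difference of weights has to
    converge.\<close>
  define x where "x k e i = (real k * th i + real e) - (real k0 * th i + real e0)" for k e i
  define g where "g i = w i powr (real k0 * th i + real e0)" for i
  have g_pos: "0 < g i" for i using w(2)[of i] by (simp add: g_def)
  define E where "E i = aux_value N p (z i) (w i) (sturm_series (om i) (z i) (w i))" for i
  have zpos: "0 < z i" for i using w(2)[of i] by (simp add: z)
  have mon: "z i ^ k * w i ^ e = g i * w i powr x k e i" for i k e
  proof -
    have "z i ^ k = z i powr real k" using zpos by (intro powr_realpow[symmetric])
    moreover have "w i ^ e = w i powr real e" using w(2) by (intro powr_realpow[symmetric])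
    moreover have "(real k0 * th i + real e0) + x k e i = th i * real k + real e" by (simp add: x_def)
    ultimately show ?thesis by (simp only: z powr_powr powr_add[symmetric] g_def)
  qed
  have x_lim: "(\<lambda>i. x k e i) \<longlonglongrightarrow> val k e - val k0 e0" for k e
    unfolding x_def val_def by (intro tendsto_intros th(1))
  have pow_lim: "(\<lambda>i. w i powr x k e i) \<longlonglongrightarrow> 0" if "val k0 e0 < val k e" for k e
  proof -
    have "(\<lambda>i. w i powr x k e i) \<longlonglongrightarrow> 0 powr (val k e - val k0 e0)"
      using that w(2) by (intro tendsto_powr' w(1) x_lim) (auto intro!: always_eventually less_imp_le)
    then show ?thesis by simp
  qed
  define main where "main i = (\<Sum>(k, e)\<in>I. of_int (c k e) * w i powr x k e i)" for i
  have main_lim: "main \<longlonglongrightarrow> of_int (c k0 e0)"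
  proof -
    have "(\<lambda>i. \<Sum>y\<in>I. of_int (c (fst y) (snd y)) * w i powr x (fst y) (snd y) i)
       \<longlonglongrightarrow> (\<Sum>y\<in>I. if y = (k0, e0) then of_int (c k0 e0) else 0)"
    proof (rule tendsto_sum)
      fix y assume "y \<in> I"
      obtain k e where y: "y = (k, e)" by (cases y)
      consider "(k, e) = (k0, e0)" | "c k e = 0" "(k, e) \<noteq> (k0, e0)" | "c k e \<noteq> 0" "(k, e) \<noteq> (k0, e0)" by blast
      then show "(\<lambda>i. of_int (c (fst y) (snd y)) * w i powr x (fst y) (snd y) i) \<longlonglongrightarrow> (if y = (k0, e0) then of_int (c k0 e0) else (0::real))"
      proof cases
        case 1
        have "w i \<noteq> 0" for i using w(2)[of i] by simp
        then show ?thesis using 1 by (simp add: y x_def)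
      next
        case 2
        then show ?thesis by (auto simp: y)
      next
        case 3
        have "(\<lambda>i. of_int (c k e) * w i powr x k e i) \<longlonglongrightarrow> of_int (c k e) * 0"
          by (intro tendsto_mult tendsto_const pow_lim strict[OF 3])
        then show ?thesis using 3 by (auto simp: y)
      qed
    qed
    then show ?thesis using finI mem0 by (simp add: main_def[abs_def] split_def)
  qed
  \<comment> \<open>The part of the series from index \<open>K\<close> on is at most
    \<open>H * z i ^ K\<close>, and \<open>z ^ K\<close> has weight above the minimum by the choice
    of \<open>K\<close>.\<close>
  define H where "H = 2 * aux_height N p * 2 ^ K"
  have valK: "val k0 e0 < val K 0" using v0 K by (simp add: val_def)
  have err_lim: "(\<lambda>i. H * w i powr x K 0 i) \<longlonglongrightarrow> H * 0"
    by (intro tendsto_mult tendsto_const pow_lim valK)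
  have z_lim: "z \<longlonglongrightarrow> 0"
  proof -
    have "(\<lambda>i. w i powr th i) \<longlonglongrightarrow> 0 powr \<theta>"
      using w(2) th(3) by (intro tendsto_powr' w(1) th(1)) (auto intro!: always_eventually less_imp_le)
    then show ?thesis by (simp add: z[abs_def])
  qed
  have z_small: "\<forall>\<^sub>F i in sequentially. z i < 1 / 4" by (rule order_tendstoD(2)[OF z_lim]) simp
  have approx: "\<forall>\<^sub>F i in sequentially. norm (E i / g i - main i) \<le> H * w i powr x K 0 i"
    using z_small eventually_floor_mult_eq[OF om(1,2), of K]
  proof eventually_elim
    case (elim i)
    have zi: "0 \<le> z i" "z i \<le> 1 / 4" using elim zpos[of i] by simp_all
    have co: "fps_nth (aux_fps_at N p (om i) (w i)) k = (\<Sum>e\<le>D k. of_int (c k e) * w i ^ e)" if "k < K" for k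
    proof -
      have "fps_nth (aux_fps N p (om i)) k = fps_nth (aux_fps N p \<omega>) k"
        using elim(2) that by (intro fps_nth_aux_fps_cong[of K]) auto
      then show ?thesis
        by (simp add: fps_nth_aux_fps_at poly_altdef D_def c_def degree_map_poly coeff_map_poly)
    qed
    have "(\<Sum>k<K. fps_nth (aux_fps_at N p (om i) (w i)) k * z i ^ k) = (\<Sum>k<K. \<Sum>e\<le>D k. of_int (c k e) * (z i ^ k * w i ^ e))"
      by (intro sum.cong refl) (simp add: co sum_distrib_left mult_ac)
    also have "\<dots> = (\<Sum>(k, e)\<in>I. of_int (c k e) * (z i ^ k * w i ^ e))"
      unfolding I_def by (rule sum.Sigma) auto
    also have "\<dots> = g i * main i"
      unfolding mon main_def sum_distrib_left by (intro sum.cong refl) auto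
    finally have s: "(\<Sum>k<K. fps_nth (aux_fps_at N p (om i) (w i)) k * z i ^ k) = g i * main i" .
    have "\<bar>E i - g i * main i\<bar> \<le> 2 * aux_height N p * (2 * z i) ^ K"
      using aux_value_approx[OF om(3)[of i] w(2)[of i] w(3)[of i] zi, of N p K] unfolding s E_def .
    also have "\<dots> = H * (z i ^ K * w i ^ 0)" by (simp add: H_def power_mult_distrib)
    also have "\<dots> = g i * (H * w i powr x K 0 i)" unfolding mon by simp
    finally have "\<bar>E i - g i * main i\<bar> \<le> g i * (H * w i powr x K 0 i)" .
    moreover have "E i - g i * main i = g i * (E i / g i - main i)"
      using g_pos[of i] by (simp add: right_diff_distrib)
    ultimately have "g i * \<bar>E i / g i - main i\<bar> \<le> g i * (H * w i powr x K 0 i)"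
      using g_pos[of i] by (simp add: abs_mult)
    then show ?case using g_pos[of i] by simp
  qed
  have "(\<lambda>i. E i / g i - main i) \<longlonglongrightarrow> 0"
    by (rule Lim_null_comparison[OF approx]) (use err_lim in simp)
  from tendsto_add[OF this main_lim] have "(\<lambda>i. E i / g i) \<longlonglongrightarrow> of_int (c k0 e0)" by simp
  then have "\<forall>\<^sub>F i in sequentially. E i / g i \<noteq> 0"
    using c0 by (intro tendsto_imp_eventually_ne) auto
  then show ?thesis
  proof eventually_elim
    case (elim i)
    then show ?case by (auto simp: E_def)
  qed
qed

section \<open>The contradiction between size and smallness\<close>

context mahler_setup
begin

text \<open>\<open>F = common_den n * w\<close> satisfies
  \<open>F * u = (1 - w) * (common_den n * X (Suc n))\<close>, so \<open>F ^ N\<close> clears every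
  \<open>u ^ j\<close> with \<open>j <= N\<close>. The 20 consists of 18 for \<open>F\<close> or
  \<open>F * u\<close> and 1 each for the powers of \<open>z\<close> and \<open>w\<close>. The
  constant \<open>G\<close> is the same for all \<open>n\<close>.\<close>

lemma sz_aux_value:
  "\<exists>G. \<forall>n. sz (G + 20 * N * Q (Suc (Suc n)))
      ((common_den n * l ^ Q (Suc n)) ^ N * aux_value N p (l ^ Q (Suc (Suc n))) (l ^ Q (Suc n))
        (sturm_series (cf_tail \<rho> (Suc n)) (l ^ Q (Suc (Suc n))) (l ^ Q (Suc n))))"
proof -
  let ?I = "{..N} \<times> {..N} \<times> {..N}"
  define P where "P = Max ((\<lambda>i. nat \<bar>p i\<bar> + 1) ` ?I)"
  have P: "sz P (of_int (p i))" if "i \<in> ?I" for i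
  proof (rule sz_mono[OF sz_of_int])
    show "nat \<bar>p i\<bar> + 1 \<le> P" unfolding P_def using that by (intro Max_ge) auto
  qed
  have "sz (P + card ?I + 1 + 20 * N * Q (Suc (Suc n)))
      ((common_den n * l ^ Q (Suc n)) ^ N * aux_value N p (l ^ Q (Suc (Suc n))) (l ^ Q (Suc n))
        (sturm_series (cf_tail \<rho> (Suc n)) (l ^ Q (Suc (Suc n))) (l ^ Q (Suc n))))" for n
  proof -
    define q where "q = Q (Suc (Suc n))"
    define z w where "z = l ^ q" and "w = l ^ Q (Suc n)"
    define u where "u = sturm_series (cf_tail \<rho> (Suc n)) z w"
    define F where "F = common_den n * w"
    define Y where "Y = (1 - w) * (common_den n * X (Suc n))"
    have Qq: "Q (Suc n) \<le> q" "1 \<le> q" using cf_den_mono[of "Suc n"] cf_den_pos[of "Suc n"] by (simp_all add: q_def)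
    have w1: "w < 1" using power_Q_bounds[of n] by (simp add: w_def)
    have Fu: "F * u = Y"
      using w1 by (simp add: F_def Y_def cf_value_def u_def z_def w_def q_def)
    have zs: "sz q z" unfolding z_def by (rule sz_l_power)
    have ws: "sz q w" unfolding w_def by (rule sz_mono[OF sz_l_power Qq(1)])
    have "sz (4 + 12 * Q (Suc n) + q) F" unfolding F_def by (rule sz_mult[OF size_bounds'(1) ws])
    then have Fs: "sz (18 * q) F" by (rule sz_mono) (use Qq in simp)
    have "sz (Q (Suc n) + 1 + (4 + 12 * Q (Suc n))) Y"
      unfolding Y_def w_def by (intro sz_mult sz_one_minus_l_power size_bounds'(2))
    then have Ys: "sz (18 * q) Y" by (rule sz_mono) (use Qq in simp)
    have t: "sz (P + 20 * N * q) (F ^ N * (of_int (p (j, a, b)) * w ^ b * (z ^ a * u ^ j)))"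
      if jab: "j \<le> N" "a \<le> N" "b \<le> N" for j a b
    proof -
      have "F ^ N = F ^ (N - j) * F ^ j" using jab by (simp flip: power_add)
      then have eq: "F ^ N * (of_int (p (j, a, b)) * w ^ b * (z ^ a * u ^ j))
          = of_int (p (j, a, b)) * w ^ b * (z ^ a * (F ^ (N - j) * Y ^ j))"
        unfolding Fu[symmetric] power_mult_distrib by simp
      have "sz (P + b * q + (a * q + ((N - j) * (18 * q) + j * (18 * q)))) (of_int (p (j, a, b)) * w ^ b * (z ^ a * (F ^ (N - j) * Y ^ j)))"
        using jab by (intro sz_mult sz_power P zs ws Fs Ys) auto
      moreover have "P + b * q + (a * q + ((N - j) * (18 * q) + j * (18 * q))) \<le> P + 20 * N * q"
      proof -
        have "b * q \<le> N * q" "a * q \<le> N * q" using jab by simp_all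
        moreover have "(N - j) * (18 * q) + j * (18 * q) = 18 * (N * q)"
          using jab by (simp flip: add_mult_distrib)
        moreover have "20 * N * q = 20 * (N * q)" by simp
        ultimately show ?thesis by linarith
      qed
      ultimately show ?thesis unfolding eq by (rule sz_mono)
    qed
    have "F ^ N * aux_value N p z w u = (\<Sum>i\<in>?I. F ^ N * (case i of (j, a, b) \<Rightarrow> of_int (p (j, a, b)) * w ^ b * (z ^ a * u ^ j)))"
      unfolding aux_value_def by (rule sum_distrib_left)
    moreover have "sz (P + 20 * N * q + card ?I + 1) \<dots>"
      by (rule sz_sum) (use t in auto)
    ultimately show ?thesis by (simp add: F_def u_def z_def w_def q_def ac_simps)
  qed
  then show ?thesis by blast
qed

theorem no_irrational_setup: False
proof -
  obtain A where A: "\<And>n. cf_digit \<rho> n \<le> A" using cf_digit_bounded by blast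
  obtain r \<omega> t where r: "strict_mono r" and om: "(\<lambda>i. cf_tail \<rho> (r i)) \<longlonglongrightarrow> \<omega>"
    and t: "(\<lambda>i. real (Q (r i)) / real (Q (Suc (r i)))) \<longlonglongrightarrow> t"
    and \<omega>: "\<omega> \<notin> \<rat>" "0 < \<omega>" "\<omega> < 1" and t01: "t \<notin> \<rat>" "0 < t" "t < 1"
    using bounded_digits_subsequence[OF A] .
  \<comment> \<open>Vanishing to order \<open>M = m * N\<close> will gain the factor
    \<open>(l ^ m) ^ (N * q)\<close> against the height \<open>\<kappa> ^ (20 * N * q)\<close>, so
    \<open>m\<close> is chosen to beat the base \<open>\<kappa> ^ 20\<close>.\<close>
  have "(\<lambda>m. \<kappa> ^ 20 * l ^ m) \<longlonglongrightarrow> \<kappa> ^ 20 * 0"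
    using l by (intro tendsto_mult tendsto_const LIMSEQ_realpow_zero) auto
  then have "\<forall>\<^sub>F m in sequentially. \<kappa> ^ 20 * l ^ m < 1 / 2" by (intro order_tendstoD(2)) auto
  then obtain m where m: "\<kappa> ^ 20 * l ^ m < 1 / 2" by (auto simp: eventually_sequentially)
  \<comment> \<open>Large enough that \<open>m * (m + 1) <= N\<close>, which bounds the main part
    \<open>m * (m + 1) * N^2\<close> of the number of equations by \<open>N^3\<close>.\<close>
  define N where "N = (m + 1) ^ 2"
  define M where "M = m * N"
  have N1: "1 \<le> N" by (simp add: N_def)
  have "M * (N + M + 1) < (N + 1) ^ 3"
  proof -
    have "m \<le> N" "m * (m + 1) \<le> N" by (simp_all add: N_def power2_eq_square)
    then have "m * N \<le> N * N" "m * (m + 1) * (N * N) \<le> N * (N * N)" by (auto intro: mult_right_mono)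
    moreover have "M * (N + M + 1) = m * (m + 1) * (N * N) + m * N" by (simp add: M_def algebra_simps)
    moreover have "(N + 1) ^ 3 = N * (N * N) + 3 * (N * N) + 3 * N + 1" by (simp add: power3_eq_cube algebra_simps)
    ultimately show ?thesis by linarith
  qed
  then obtain p where p: "\<exists>i\<in>{..N} \<times> {..N} \<times> {..N}. p i \<noteq> 0"
    and van: "\<And>k. k < M \<Longrightarrow> fps_nth (aux_fps N p \<omega>) k = 0"
    using exists_aux_fps[OF \<omega>(2,3)] by metis
  obtain k1 where k1: "fps_nth (aux_fps N p \<omega>) k1 \<noteq> 0" using aux_fps_nonzero[OF \<omega>(2,1) p] ..
  obtain G where G: "\<And>n. sz (G + 20 * N * Q (Suc (Suc n)))
      ((common_den n * l ^ Q (Suc n)) ^ N * aux_value N p (l ^ Q (Suc (Suc n))) (l ^ Q (Suc n))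
        (sturm_series (cf_tail \<rho> (Suc n)) (l ^ Q (Suc (Suc n))) (l ^ Q (Suc n))))"
    using sz_aux_value[of N p] by blast
  \<comment> \<open>The shift ensures \<open>s i > 0\<close>, so that \<open>s i\<close> is a
    successor, the form in which the size bounds are stated.\<close>
  define s where "s i = r (Suc i)" for i
  have s_ge: "i < s i" for i using seq_suble[OF r, of "Suc i"] by (simp add: s_def)
  define n where "n i = s i - 1" for i
  have sn: "s i = Suc (n i)" for i using s_ge[of i] by (simp add: n_def)
  have n_ge: "i \<le> n i" for i using s_ge[of i] sn[of i] by simp
  define w z om where "w i = l ^ Q (s i)" and "z i = l ^ Q (Suc (s i))" and "om i = cf_tail \<rho> (s i)" for i
  \<comment> \<open>The reciprocal of the quotient that converges to \<open>t\<close>; its limit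
    \<open>1 / t\<close> is irrational as well.\<close>
  define th where "th i = real (Q (Suc (s i))) / real (Q (s i))" for i
  define E where "E i = aux_value N p (z i) (w i) (sturm_series (om i) (z i) (w i))" for i
  have w01: "0 < w i" "w i < 1" and z01: "0 < z i" "z i \<le> l" for i
    using power_Q_bounds[of "n i"] power_Q_bounds[of "s i"] by (simp_all add: w_def z_def sn)
  have zpow: "z i = w i powr th i" for i
  proof -
    have "0 < Q (s i)" using cf_den_pos by (simp add: sn)
    then have "real (Q (s i)) * th i = real (Q (Suc (s i)))" by (simp add: th_def)
    moreover have "w i = l powr real (Q (s i))" unfolding w_def using l by (intro powr_realpow[symmetric])
    moreover have "z i = l powr real (Q (Suc (s i)))" unfolding z_def using l by (intro powr_realpow[symmetric])
    ultimately show ?thesis by (simp add: powr_powr)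
  qed
  have Q_top: "filterlim (\<lambda>i. Q (s i)) at_top sequentially"
  proof (rule filterlim_at_top_mono[OF filterlim_ident], rule always_eventually, rule allI)
    show "i \<le> Q (s i)" for i using cf_den_ge[of "n i"] n_ge[of i] by (simp add: sn)
  qed
  have l0: "(\<lambda>k. l ^ k) \<longlonglongrightarrow> 0" using l by (intro LIMSEQ_realpow_zero) auto
  have wlim: "w \<longlonglongrightarrow> 0" unfolding w_def[abs_def] by (rule filterlim_compose[OF l0 Q_top])
  have Q_top': "filterlim (\<lambda>i. Q (Suc (s i))) at_top sequentially"
    by (rule filterlim_at_top_mono[OF Q_top]) (simp add: cf_den_mono)
  have zlim: "z \<longlonglongrightarrow> 0" unfolding z_def[abs_def] by (rule filterlim_compose[OF l0 Q_top'])
  have omlim: "om \<longlonglongrightarrow> \<omega>" using LIMSEQ_Suc[OF om] by (simp add: om_def[abs_def] s_def)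
  have thlim: "th \<longlonglongrightarrow> 1 / t"
  proof -
    have "(\<lambda>i. 1 / (real (Q (s i)) / real (Q (Suc (s i))))) \<longlonglongrightarrow> 1 / t"
      using LIMSEQ_Suc[OF t] t01 unfolding s_def by (intro tendsto_divide tendsto_const) auto
    then show ?thesis by (simp add: th_def[abs_def])
  qed
  have "1 / t \<notin> \<rat>"
  proof
    assume "1 / t \<in> \<rat>"
    then have "inverse (inverse t) \<in> \<rat>" unfolding inverse_eq_divide[symmetric] by (rule Rats_inverse)
    then show False using t01 by simp
  qed
  moreover have "0 < om i" for i using cf_tail_props[of "s i"] by (simp add: om_def)
  ultimately have nz: "\<forall>\<^sub>F i in sequentially. E i \<noteq> 0"
    unfolding E_def using t01 k1
    by (intro eventually_aux_value_nonzero[OF omlim \<omega>(1) _ thlim _ _ wlim w01 zpow k1]) auto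
  define H where "H = 2 * aux_height N p * 2 ^ M"
  have small: "\<forall>\<^sub>F i in sequentially. \<bar>E i\<bar> \<le> H * z i ^ M"
  proof -
    have "\<forall>\<^sub>F i in sequentially. z i < 1 / 4" by (rule order_tendstoD(2)[OF zlim]) simp
    then show ?thesis using eventually_floor_mult_eq[OF omlim \<omega>(1), of M]
    proof eventually_elim
      case (elim i)
      have "fps_nth (aux_fps N p (om i)) k = 0" if "k < M" for k
        using fps_nth_aux_fps_cong[of M "om i" \<omega> k N p] elim(2) van that by simp
      then have "(\<Sum>k<M. fps_nth (aux_fps_at N p (om i) (w i)) k * z i ^ k) = 0"
        by (intro sum.neutral) (simp add: fps_nth_aux_fps_at)
      moreover have "0 < om i" using cf_tail_props[of "s i"] by (simp add: om_def)
      ultimately have "\<bar>E i\<bar> \<le> 2 * aux_height N p * (2 * z i) ^ M"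
        using aux_value_approx[of "om i" "w i" "z i" N p M] w01[of i] z01[of i] elim(1) by (simp add: E_def)
      then show ?case by (simp add: H_def power_mult_distrib mult.assoc)
    qed
  qed
  \<comment> \<open>All factors independent of \<open>i\<close> are collected here; since
    \<open>i <= N * q\<close>, the power \<open>(1 / 2) ^ i\<close> bounds what remains in the final
    comparison.\<close>
  have "(\<lambda>i. \<kappa> ^ (G + 1) * H * (1 / 2) ^ i) \<longlonglongrightarrow> \<kappa> ^ (G + 1) * H * 0"
    by (intro tendsto_mult tendsto_const LIMSEQ_realpow_zero) auto
  then have "\<forall>\<^sub>F i in sequentially. \<kappa> ^ (G + 1) * H * (1 / 2) ^ i < 1" by (intro order_tendstoD(2)) auto
  then have "\<forall>\<^sub>F i in sequentially. False"
    using nz small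
  proof eventually_elim
    case (elim i)
    define q where "q = Q (Suc (s i))"
    define F where "F = common_den (n i) * w i"
    have F: "0 < F" "F \<le> 1"
      using common_den_bounds[of "n i"] w01[of i] by (auto simp: F_def intro!: mult_le_one)
    have FN: "0 < F ^ N" "F ^ N \<le> 1" using F by (simp_all add: power_le_one)
    have H0: "0 \<le> H" by (simp add: H_def aux_height_nonneg)
    have "sz (G + 20 * N * q) (F ^ N * E i)"
      using G[of "n i"] by (simp add: F_def E_def q_def z_def w_def om_def sn)
    moreover have "F ^ N * E i \<noteq> 0" using elim(2) F by simp
    ultimately have "1 \<le> \<kappa> ^ (G + 20 * N * q + 1) * \<bar>F ^ N * E i\<bar>" by (rule sz_lower)
    also have "\<dots> \<le> \<kappa> ^ (G + 20 * N * q + 1) * (H * z i ^ M)"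
    proof (rule mult_left_mono)
      have "F ^ N * \<bar>E i\<bar> \<le> 1 * \<bar>E i\<bar>" using FN by (intro mult_right_mono) auto
      then show "\<bar>F ^ N * E i\<bar> \<le> H * z i ^ M" using elim(3) FN by (simp add: abs_mult)
    qed (use \<kappa> in simp)
    also have "\<dots> = \<kappa> ^ (G + 1) * H * (\<kappa> ^ 20 * l ^ m) ^ (N * q)"
    proof -
      have z_eq: "z i ^ M = (l ^ m) ^ (N * q)" by (simp add: z_def M_def q_def mult_ac flip: power_mult)
      have \<kappa>_eq: "\<kappa> ^ (G + 20 * N * q + 1) = \<kappa> ^ (G + 1) * (\<kappa> ^ 20) ^ (N * q)"
      proof -
        have "(\<kappa> ^ 20) ^ (N * q) = \<kappa> ^ (20 * N * q)" by (simp only: power_mult[symmetric] mult.assoc)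
        then show ?thesis by (simp add: power_add)
      qed
      show ?thesis unfolding z_eq \<kappa>_eq power_mult_distrib by (simp only: mult_ac)
    qed
    also have "\<dots> \<le> \<kappa> ^ (G + 1) * H * (1 / 2) ^ i"
    proof (rule mult_left_mono)
      have "(\<kappa> ^ 20 * l ^ m) ^ (N * q) \<le> (1 / 2) ^ (N * q)"
        using m l \<kappa> by (intro power_mono) auto
      also have "\<dots> \<le> (1 / 2) ^ i"
      proof (rule power_decreasing)
        have "i \<le> q" using cf_den_ge[of "s i"] s_ge[of i] by (simp add: q_def)
        also have "q \<le> N * q" using N1 by simp
        finally show "i \<le> N * q" .
      qed auto
      finally show "(\<kappa> ^ 20 * l ^ m) ^ (N * q) \<le> (1 / 2) ^ i" .
    qed (use \<kappa> H0 in simp)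
    finally show False using elim(1) by simp
  qed
  then show False by simp
qed

end

theorem theorem1:
  fixes l d :: real
  assumes "algebraic l" and "algebraic d"
    and "0 < l" and "l < 1"
    and "0 < d" and "d < 1"
  shows "rotation_number l d \<in> \<rat>"
proof (rule ccontr)
  assume irr: "rotation_number l d \<notin> \<rat>"
  obtain S \<kappa> where S: "1 < \<kappa>" "S 1 l" "S 1 d" "S 0 1"
    "\<And>e e' a. S e a \<Longrightarrow> e \<le> e' \<Longrightarrow> S e' a"
    "\<And>e a. S e a \<Longrightarrow> S e (- a)"
    "\<And>e a b. S e a \<Longrightarrow> S e b \<Longrightarrow> S (e + 1) (a + b)"
    "\<And>e e' a b. S e a \<Longrightarrow> S e' b \<Longrightarrow> S (e + e') (a * b)"
    "\<And>e a. S e a \<Longrightarrow> a \<noteq> 0 \<Longrightarrow> 1 \<le> \<kappa> ^ (e + 1) * \<bar>a\<bar>"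
    by (rule algebraic_pair_size[OF assms(1,2)]) (rule that)
  have bounds: "0 < rotation_number l d" "rotation_number l d < 1"
    by (rule irrational_rotation_number_bounds[OF assms(3-6) irr])+
  have floor_sums: "(\<lambda>k. of_int \<lfloor>real k * rotation_number l d\<rfloor> * l ^ k) sums (l * (d - (1 - l)) / (1 - l)\<^sup>2)"
    by (rule sums_floor_rotation_number[OF assms(3-6) irr])
  interpret mahler_setup S \<kappa> l d "rotation_number l d"
    by unfold_locales (fact S assms irr bounds floor_sums)+
  show False by (rule no_irrational_setup)
qed

end
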